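(* Let $k$ be an algebraically closed field and let $f:\mathbb{P}^1\to\mathbb{P}^1$ be a surjective morphism over $k$ of degree $n$. Then for any integers $q$ and $i$ with $0\leq i<n$, $$f_*\mathcal{O}(qn+i)\cong\mathcal{O}(q)^{\oplus(i+1)}\oplus\mathcal{O}(q-1)^{\oplus(n-i-1)}.$$
   Context: $\mathbb{P}^1$ is the projective line over $k$, and $\mathcal{O}(j)$ for $j\in\mathbb{Z}$ is the line bundle of degree $j$ on $\mathbb{P}^1$ (with $\mathcal{O}(1)$ the Serre twisting sheaf). *)

theory Defs
  imports
    "HOL-Algebra.Embedded_Algebras"
    "HOL-Computational_Algebra.Polynomial"
    "HOL-Library.FuncSet"
begin

text \<open>
  Over an algebraically closed field, the projective line is treated as a classical variety:
  its points are the lines through the origin of the affine plane, it carries the Zariski topology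
  and the sheaf of \<open>k\<close>-valued regular functions. Passing to the associated scheme only adds the
  generic point; it changes neither the lattice of open sets (hence neither the category of sheaves
  of modules) nor the set of morphisms over \<open>k\<close>.
\<close>

section \<open>The projective line\<close>

definition proj_rel :: "'k::field \<times> 'k \<Rightarrow> 'k \<times> 'k \<Rightarrow> bool"
  where "proj_rel u v \<longleftrightarrow> u \<noteq> (0, 0) \<and> v \<noteq> (0, 0) \<and>
    (\<exists>c. c \<noteq> 0 \<and> fst v = c * fst u \<and> snd v = c * snd u)"

lemma proj_rel_part_equivp: "part_equivp (proj_rel :: 'k::field \<times> 'k \<Rightarrow> 'k \<times> 'k \<Rightarrow> bool)"
proof (rule part_equivpI)
  have "proj_rel (1, 0) (1, 0 :: 'k)"
    unfolding proj_rel_def by (intro conjI exI[of _ 1]) auto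
  then show "\<exists>u. proj_rel u (u :: 'k \<times> 'k)" by blast
  show "symp (proj_rel :: 'k \<times> 'k \<Rightarrow> _)"
  proof (rule sympI)
    fix u v :: "'k \<times> 'k"
    assume "proj_rel u v"
    then obtain c where "u \<noteq> (0, 0)" "v \<noteq> (0, 0)" "c \<noteq> 0" "fst v = c * fst u" "snd v = c * snd u"
      unfolding proj_rel_def by blast
    then show "proj_rel v u"
      unfolding proj_rel_def by (intro conjI exI[of _ "inverse c"]) auto
  qed
  show "transp (proj_rel :: 'k \<times> 'k \<Rightarrow> _)"
  proof (rule transpI)
    fix u v w :: "'k \<times> 'k"
    assume "proj_rel u v" "proj_rel v w"
    then obtain c d where "u \<noteq> (0, 0)" "w \<noteq> (0, 0)" "c \<noteq> 0" "d \<noteq> 0"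
      "fst v = c * fst u" "snd v = c * snd u" "fst w = d * fst v" "snd w = d * snd v"
      unfolding proj_rel_def by blast
    then show "proj_rel u w"
      unfolding proj_rel_def by (intro conjI exI[of _ "d * c"]) auto
  qed
qed

quotient_type (overloaded) 'k proj_line = "'k::field \<times> 'k" / partial: proj_rel
  by (rule proj_rel_part_equivp)

text \<open>The preimage of a set of points in the punctured plane:\<close>

definition cone :: "'k::field proj_line set \<Rightarrow> ('k \<times> 'k) set"
  where "cone U = {v. v \<noteq> (0, 0) \<and> abs_proj_line v \<in> U}"

lemma cone_nonempty: "\<exists>v. v \<in> cone {p}"
proof -
  let ?v = "rep_proj_line p"
  have "proj_rel ?v ?v"
    using Quotient_rep_reflp[OF Quotient_proj_line] .
  then have "?v \<noteq> (0, 0)"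
    unfolding proj_rel_def by blast
  moreover have "abs_proj_line ?v = p"
    using Quotient_abs_rep[OF Quotient_proj_line] .
  ultimately show ?thesis
    unfolding cone_def by blast
qed

text \<open>Homogeneous polynomials of degree \<open>d\<close> in two variables, as functions on the affine plane
  (no information is lost, the field being infinite in the intended use):\<close>

definition forms :: "nat \<Rightarrow> ('k::field \<times> 'k \<Rightarrow> 'k) set"
  where "forms d = {F. \<exists>c. \<forall>x y. F (x, y) = (\<Sum>i\<le>d. c i * x ^ i * y ^ (d - i))}"

lemma const_in_forms: "(\<lambda>_. a) \<in> forms 0"
  unfolding forms_def by (auto intro!: exI[of _ "\<lambda>_. a"])

lemma mult_in_forms:
  assumes "F \<in> forms d" "G \<in> forms e"
  shows "(\<lambda>v. F v * G v) \<in> forms (d + e)"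
proof -
  obtain a b where a: "\<And>x y. F (x, y) = (\<Sum>i\<le>d. a i * x ^ i * y ^ (d - i))"
    and b: "\<And>x y. G (x, y) = (\<Sum>j\<le>e. b j * x ^ j * y ^ (e - j))"
    using assms unfolding forms_def by blast
  define c where "c m = (\<Sum>(i, j) \<in> {(i, j). i \<le> d \<and> j \<le> e \<and> i + j = m}. a i * b j)" for m
  have "F (x, y) * G (x, y) = (\<Sum>m\<le>d + e. c m * x ^ m * y ^ (d + e - m))" for x y
  proof -
    let ?t = "\<lambda>(i, j). a i * b j * x ^ (i + j) * y ^ (d + e - (i + j))"
    have fin: "finite {(i, j). i \<le> d \<and> j \<le> e \<and> i + j = m}" for m
      by (rule finite_subset[of _ "{..d} \<times> {..e}"]) auto
    have "F (x, y) * G (x, y) = (\<Sum>i\<le>d. \<Sum>j\<le>e. ?t (i, j))"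
      unfolding a b sum_product
    proof (intro sum.cong refl)
      fix i j assume "i \<in> {..d}" "j \<in> {..e}"
      then have "d + e - (i + j) = (d - i) + (e - j)" by auto
      then show "a i * x ^ i * y ^ (d - i) * (b j * x ^ j * y ^ (e - j)) = ?t (i, j)"
        by (simp add: power_add mult_ac)
    qed
    also have "\<dots> = sum ?t ({..d} \<times> {..e})"
      by (simp add: sum.cartesian_product)
    also have "\<dots> = (\<Sum>m\<in>{..d + e}. sum ?t {z \<in> {..d} \<times> {..e}. (\<lambda>(i, j). i + j) z = m})"
      by (rule sum.group[symmetric]) auto
    also have "\<dots> = (\<Sum>m\<le>d + e. c m * x ^ m * y ^ (d + e - m))"
    proof (rule sum.cong[OF refl])
      fix m
      have "{z \<in> {..d} \<times> {..e}. (\<lambda>(i, j). i + j) z = m} = {(i, j). i \<le> d \<and> j \<le> e \<and> i + j = m}"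
        by auto
      then show "sum ?t {z \<in> {..d} \<times> {..e}. (\<lambda>(i, j). i + j) z = m} = c m * x ^ m * y ^ (d + e - m)"
        unfolding c_def sum_distrib_right by (auto intro!: sum.cong)
    qed
    finally show ?thesis .
  qed
  then show ?thesis
    unfolding forms_def by blast
qed

definition zero_locus :: "('k::field \<times> 'k \<Rightarrow> 'k) set \<Rightarrow> 'k proj_line set"
  where "zero_locus T = {p. \<forall>F\<in>T. \<forall>v\<in>cone {p}. F v = 0}"

lemma zero_locusD: "p \<in> zero_locus T \<Longrightarrow> F \<in> T \<Longrightarrow> v \<in> cone {p} \<Longrightarrow> F v = 0"
  unfolding zero_locus_def by blast

lemma form_vanishing_representative:
  assumes "F \<in> forms d" "v \<in> cone {p}" "w \<in> cone {p}" "F v = 0"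
  shows "F w = 0"
proof -
  have "v \<noteq> (0, 0)" "w \<noteq> (0, 0)" "abs_proj_line v = abs_proj_line w"
    using assms(2,3) unfolding cone_def by auto
  moreover from this have "proj_rel v v" "proj_rel w w"
    unfolding proj_rel_def by (auto intro: exI[of _ 1])
  ultimately have "proj_rel v w"
    using Quotient_rel[OF Quotient_proj_line] by blast
  then obtain c where c: "fst w = c * fst v" "snd w = c * snd v"
    unfolding proj_rel_def by blast
  obtain a where a: "\<And>x y. F (x, y) = (\<Sum>i\<le>d. a i * x ^ i * y ^ (d - i))"
    using assms(1) unfolding forms_def by blast
  have "F w = F (c * fst v, c * snd v)"
    using c by (metis prod.collapse)
  also have "\<dots> = (\<Sum>i\<le>d. c ^ d * (a i * fst v ^ i * snd v ^ (d - i)))"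
    unfolding a
  proof (rule sum.cong[OF refl])
    fix i assume "i \<in> {..d}"
    then have "c ^ d = c ^ i * c ^ (d - i)"
      by (simp flip: power_add)
    then show "a i * (c * fst v) ^ i * (c * snd v) ^ (d - i) =
        c ^ d * (a i * fst v ^ i * snd v ^ (d - i))"
      by (simp add: power_mult_distrib mult_ac)
  qed
  also have "\<dots> = c ^ d * F (fst v, snd v)"
    unfolding a by (simp add: sum_distrib_left)
  finally show ?thesis
    using assms(4) by simp
qed

instantiation proj_line :: (field) topological_space
begin

definition open_proj_line :: "'a proj_line set \<Rightarrow> bool"
  where "open_proj_line U \<longleftrightarrow> (\<exists>T \<subseteq> (\<Union>d. forms d). - U = zero_locus T)"

instance
proof
  have "zero_locus {\<lambda>_. 1} = ({} :: 'a proj_line set)"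
    unfolding zero_locus_def using cone_nonempty by auto
  then show "open (UNIV :: 'a proj_line set)"
    unfolding open_proj_line_def using const_in_forms[of 1]
    by (intro exI[of _ "{\<lambda>_. 1}"]) auto
next
  fix U V :: "'a proj_line set"
  assume "open U" "open V"
  then obtain S T where S: "S \<subseteq> (\<Union>d. forms d)" "- U = zero_locus S"
    and T: "T \<subseteq> (\<Union>d. forms d)" "- V = zero_locus T"
    unfolding open_proj_line_def by blast
  let ?P = "{\<lambda>v. F v * G v | F G. F \<in> S \<and> G \<in> T}"
  have "?P \<subseteq> (\<Union>d. forms d)"
    using S(1) T(1) mult_in_forms by fastforce
  moreover have "zero_locus S \<union> zero_locus T = zero_locus ?P"
  proof (intro equalityI subsetI)
    fix p assume "p \<in> zero_locus S \<union> zero_locus T"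
    then show "p \<in> zero_locus ?P"
      unfolding zero_locus_def by auto
  next
    fix p assume p: "p \<in> zero_locus ?P"
    show "p \<in> zero_locus S \<union> zero_locus T"
    proof (rule ccontr)
      assume "p \<notin> zero_locus S \<union> zero_locus T"
      then obtain F G v w where *: "F \<in> S" "v \<in> cone {p}" "F v \<noteq> 0" "G \<in> T" "w \<in> cone {p}" "G w \<noteq> 0"
        unfolding zero_locus_def by auto
      obtain e where "G \<in> forms e"
        using * T(1) by blast
      then have Gv: "G v \<noteq> 0"
        using form_vanishing_representative * by blast
      have PI: "(\<lambda>v. F v * G v) \<in> ?P"
        by (rule CollectI, rule exI[of _ F], rule exI[of _ G], intro conjI refl *(1) *(4))
      have "F v * G v = 0"
        using zero_locusD[OF p PI *(2)] .
      then show False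
        using *(3) Gv by simp
    qed
  qed
  ultimately show "open (U \<inter> V)"
    unfolding open_proj_line_def Compl_Int S(2) T(2) by blast
next
  fix K :: "'a proj_line set set"
  assume "\<forall>U\<in>K. open U"
  then have "\<forall>U\<in>K. \<exists>T. T \<subseteq> (\<Union>d. forms d) \<and> - U = zero_locus T"
    unfolding open_proj_line_def by blast
  then obtain T where T: "\<And>U. U \<in> K \<Longrightarrow> T U \<subseteq> (\<Union>d. forms d)" "\<And>U. U \<in> K \<Longrightarrow> - U = zero_locus (T U)"
    by metis
  have "- \<Union>K = (\<Inter>U\<in>K. zero_locus (T U))"
    using T(2) by auto
  also have "\<dots> = zero_locus (\<Union>U\<in>K. T U)"
    unfolding zero_locus_def by auto
  finally have "- \<Union>K = zero_locus (\<Union>U\<in>K. T U)" .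
  moreover have "(\<Union>U\<in>K. T U) \<subseteq> (\<Union>d. forms d)"
    using T(1) by (rule UN_least)
  ultimately show "open (\<Union>K)"
    unfolding open_proj_line_def by blast
qed

end

definition regular_functions :: "'k::field proj_line set \<Rightarrow> ('k proj_line \<Rightarrow> 'k) set"
  where "regular_functions U = {g \<in> extensional U. \<forall>p\<in>U. \<exists>W d F G.
    open W \<and> p \<in> W \<and> W \<subseteq> U \<and> F \<in> forms d \<and> G \<in> forms d \<and>
    (\<forall>v\<in>cone W. G v \<noteq> 0 \<and> g (abs_proj_line v) = F v / G v)}"


section \<open>Morphisms and their degree\<close>

definition pullback ::
  "('k::field proj_line \<Rightarrow> 'k proj_line) \<Rightarrow> 'k proj_line set \<Rightarrow> ('k proj_line \<Rightarrow> 'k) \<Rightarrow> 'k proj_line \<Rightarrow> 'k"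
  where "pullback f V g = (\<lambda>p\<in>f -` V. g (f p))"

definition variety_morphism :: "('k::field proj_line \<Rightarrow> 'k proj_line) \<Rightarrow> bool"
  where "variety_morphism f \<longleftrightarrow> continuous_on UNIV f \<and>
    (\<forall>V. open V \<longrightarrow> (\<forall>g\<in>regular_functions V. pullback f V g \<in> regular_functions (f -` V)))"

definition rational_pairs :: "('k::field proj_line set \<times> ('k proj_line \<Rightarrow> 'k)) set"
  where "rational_pairs = {(U, g). open U \<and> U \<noteq> {} \<and> g \<in> regular_functions U}"

definition rational_rel ::
  "(('k::field proj_line set \<times> ('k proj_line \<Rightarrow> 'k)) \<times> ('k proj_line set \<times> ('k proj_line \<Rightarrow> 'k))) set"
  where "rational_rel = {((U, g), (V, h)). (U, g) \<in> rational_pairs \<and> (V, h) \<in> rational_pairs \<and>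
    (\<forall>p\<in>U \<inter> V. g p = h p)}"

definition function_field :: "('k::field proj_line set \<times> ('k proj_line \<Rightarrow> 'k)) set ring"
  where "function_field = \<lparr>
    carrier = rational_pairs // rational_rel,
    monoid.mult = (\<lambda>X Y. \<Union>(U, g)\<in>X. \<Union>(V, h)\<in>Y. rational_rel `` {(U \<inter> V, \<lambda>p\<in>U \<inter> V. g p * h p)}),
    one = rational_rel `` {(UNIV, \<lambda>_. 1)},
    zero = rational_rel `` {(UNIV, \<lambda>_. 0)},
    add = (\<lambda>X Y. \<Union>(U, g)\<in>X. \<Union>(V, h)\<in>Y. rational_rel `` {(U \<inter> V, \<lambda>p\<in>U \<inter> V. g p + h p)})\<rparr>"

text \<open>The inclusion of function fields induced by a dominant morphism:\<close>

definition function_field_pullback ::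
  "('k::field proj_line \<Rightarrow> 'k proj_line) \<Rightarrow>
   ('k proj_line set \<times> ('k proj_line \<Rightarrow> 'k)) set \<Rightarrow> ('k proj_line set \<times> ('k proj_line \<Rightarrow> 'k)) set"
  where "function_field_pullback f X = (\<Union>(V, h)\<in>X. rational_rel `` {(f -` V, pullback f V h)})"

text \<open>The degree of a dominant morphism is the degree of the extension of function fields:\<close>

definition has_degree :: "('k::field proj_line \<Rightarrow> 'k proj_line) \<Rightarrow> nat \<Rightarrow> bool"
  where "has_degree f n \<longleftrightarrow> ring.dimension function_field n
    (function_field_pullback f ` carrier function_field) (carrier function_field)"


section \<open>Sheaves of modules over the structure sheaf\<close>

text \<open>The ring multiplication and unit inherited by the library's module record carry no meaning for
  a module and are left undefined below. Only the values at open sets matter.\<close>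

record (overloaded) ('k, 'm) module_sheaf =
  sections :: "'k::field proj_line set \<Rightarrow> ('k proj_line \<Rightarrow> 'k, 'm) module"
  restriction :: "'k proj_line set \<Rightarrow> 'k proj_line set \<Rightarrow> 'm \<Rightarrow> 'm"

definition sheaf_iso :: "('k::field, 'm) module_sheaf \<Rightarrow> ('k, 'n) module_sheaf \<Rightarrow> bool"
    (infix \<open>\<cong>\<^sub>\<O>\<close> 50)
  where "A \<cong>\<^sub>\<O> B \<longleftrightarrow> (\<exists>\<phi>.
    (\<forall>U. open U \<longrightarrow>
      bij_betw (\<phi> U) (carrier (sections A U)) (carrier (sections B U)) \<and>
      (\<forall>s\<in>carrier (sections A U). \<forall>t\<in>carrier (sections A U).
        \<phi> U (s \<oplus>\<^bsub>sections A U\<^esub> t) = \<phi> U s \<oplus>\<^bsub>sections B U\<^esub> \<phi> U t) \<and>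
      (\<forall>g\<in>regular_functions U. \<forall>s\<in>carrier (sections A U).
        \<phi> U (g \<odot>\<^bsub>sections A U\<^esub> s) = g \<odot>\<^bsub>sections B U\<^esub> \<phi> U s)) \<and>
    (\<forall>U V. open U \<longrightarrow> open V \<longrightarrow> V \<subseteq> U \<longrightarrow>
      (\<forall>s\<in>carrier (sections A U). \<phi> V (restriction A U V s) = restriction B U V (\<phi> U s))))"

text \<open>The Serre twist of degree \<open>j\<close>, as in the Proj construction: its sections are locally fractions
  of homogeneous polynomials whose degrees differ by \<open>j\<close>. Such a fraction is not a function on the
  projective line but on the cone over it.\<close>

definition twist_sections :: "int \<Rightarrow> 'k::field proj_line set \<Rightarrow> ('k \<times> 'k \<Rightarrow> 'k) set"
  where "twist_sections j U = {s \<in> extensional (cone U). \<forall>p\<in>U. \<exists>W d e F G.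
    open W \<and> p \<in> W \<and> W \<subseteq> U \<and> F \<in> forms d \<and> G \<in> forms e \<and> int d - int e = j \<and>
    (\<forall>v\<in>cone W. G v \<noteq> 0 \<and> s v = F v / G v)}"

definition twisting_sheaf :: "int \<Rightarrow> ('k::field, 'k \<times> 'k \<Rightarrow> 'k) module_sheaf"  (\<open>\<O>'(_')\<close>)
  where "\<O>(j) = \<lparr>
    sections = (\<lambda>U. \<lparr>
      carrier = twist_sections j U,
      monoid.mult = undefined,
      one = undefined,
      zero = (\<lambda>v\<in>cone U. 0),
      add = (\<lambda>s t. \<lambda>v\<in>cone U. s v + t v),
      module.smult = (\<lambda>g s. \<lambda>v\<in>cone U. g (abs_proj_line v) * s v)\<rparr>),
    restriction = (\<lambda>U V s. restrict s (cone V))\<rparr>"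

definition direct_image ::
  "('k::field proj_line \<Rightarrow> 'k proj_line) \<Rightarrow> ('k, 'm) module_sheaf \<Rightarrow> ('k, 'm) module_sheaf"
  where "direct_image f A = \<lparr>
    sections = (\<lambda>V. \<lparr>
      carrier = carrier (sections A (f -` V)),
      monoid.mult = undefined,
      one = undefined,
      zero = \<zero>\<^bsub>sections A (f -` V)\<^esub>,
      add = add (sections A (f -` V)),
      module.smult = (\<lambda>g s. pullback f V g \<odot>\<^bsub>sections A (f -` V)\<^esub> s)\<rparr>),
    restriction = (\<lambda>V W. restriction A (f -` V) (f -` W))\<rparr>"

definition sheaf_sum ::
  "('k::field, 'm) module_sheaf \<Rightarrow> ('k, 'n) module_sheaf \<Rightarrow> ('k, 'm \<times> 'n) module_sheaf"
    (infixr \<open>\<oplus>\<^sub>\<O>\<close> 65)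
  where "A \<oplus>\<^sub>\<O> B = \<lparr>
    sections = (\<lambda>U. \<lparr>
      carrier = carrier (sections A U) \<times> carrier (sections B U),
      monoid.mult = undefined,
      one = undefined,
      zero = (\<zero>\<^bsub>sections A U\<^esub>, \<zero>\<^bsub>sections B U\<^esub>),
      add = (\<lambda>(s, t) (s', t'). (s \<oplus>\<^bsub>sections A U\<^esub> s', t \<oplus>\<^bsub>sections B U\<^esub> t')),
      module.smult = (\<lambda>g (s, t). (g \<odot>\<^bsub>sections A U\<^esub> s, g \<odot>\<^bsub>sections B U\<^esub> t))\<rparr>),
    restriction = (\<lambda>U V (s, t). (restriction A U V s, restriction B U V t))\<rparr>"

definition sheaf_power ::
  "('k::field, 'm) module_sheaf \<Rightarrow> nat \<Rightarrow> ('k, nat \<Rightarrow> 'm) module_sheaf"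
    (\<open>_\<^bsup>\<oplus>_\<^esup>\<close> [1000, 0] 1000)
  where "A\<^bsup>\<oplus>m\<^esup> = \<lparr>
    sections = (\<lambda>U. \<lparr>
      carrier = (\<Pi>\<^sub>E l\<in>{..<m}. carrier (sections A U)),
      monoid.mult = undefined,
      one = undefined,
      zero = (\<lambda>l\<in>{..<m}. \<zero>\<^bsub>sections A U\<^esub>),
      add = (\<lambda>s t. \<lambda>l\<in>{..<m}. s l \<oplus>\<^bsub>sections A U\<^esub> t l),
      module.smult = (\<lambda>g s. \<lambda>l\<in>{..<m}. g \<odot>\<^bsub>sections A U\<^esub> s l)\<rparr>),
    restriction = (\<lambda>U V s. \<lambda>l\<in>{..<m}. restriction A U V (s l))\<rparr>"

end

theory Submission
  imports Defs "HOL-Library.Function_Algebras"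
begin

text \<open>
  A surjective morphism is \<open>[v] \<mapsto> [P v : Q v]\<close> for forms \<open>P, Q\<close> of one degree \<open>m > 0\<close> without common
  zeros. Let \<open>R\<^sub>d\<close> be the space of forms of degree \<open>d\<close>, let \<open>i < m\<close>, and let \<open>B\<close> be a basis of a
  complement of \<open>P R\<^sub>i \<oplus> Q R\<^sub>i\<close> in \<open>R\<^bsub>m+i\<^esub>\<close>; it has \<open>m + i + 1 - 2 (i + 1) = m - i - 1\<close> elements.
  As \<open>P, Q\<close> is a regular sequence, \<open>\<Oplus>\<^sub>r R\<^bsub>rm+i\<^esub>\<close> is a free graded module over \<open>k[P, Q]\<close> on the
  monomials of degree \<open>i\<close> and on \<open>B\<close>: since \<open>R\<^bsub>d\<^esub> = P R\<^bsub>d-m\<^esub> + Q R\<^bsub>d-m\<^esub>\<close> for \<open>d \<ge> 2m\<close>, no further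
  generators are needed, and reduction modulo \<open>P\<close> shows independence. Every nonzero form divides a
  nonzero form in \<open>P, Q\<close>, with zeros only over the images of its zeros, so this basis may be used
  after localization: over an open set it gives the splitting of the direct image, and for \<open>i = 0\<close>
  at the generic point it shows that the degree of the morphism is \<open>m\<close>.
\<close>

text \<open>The multiplicities are a Hilbert function. Modulo \<open>P\<close> and \<open>Q\<close>,
  the ring \<open>k[x, y]\<close> has dimension \<open>d + 1\<close> in degree \<open>d < m\<close>,
  dimension \<open>2 m - 1 - d\<close> for \<open>m \<le> d < 2 m\<close>, and 0 above. Among the
  degrees congruent to \<open>i\<close> modulo \<open>m\<close> only \<open>i\<close> and
  \<open>m + i\<close> therefore need generators, \<open>i + 1\<close> and \<open>m - i - 1\<close>
  of them. A generator that sits one step of \<open>m\<close> higher leaves its coefficient one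
  degree less, which is why the generators in \<open>B\<close> carry the twist \<open>q - 1\<close>.
  The bound \<open>i < m\<close> enters because the first nontrivial relation between
  \<open>P\<close> and \<open>Q\<close> has coefficients of degree \<open>m\<close>. Two obstacles
  separate this algebra from the statement on sheaves. Sections are fractions of forms only locally;
  passing to lowest terms yields one fraction on the whole open set. And a denominator on the source
  is in general no form in \<open>P\<close> and \<open>Q\<close>; it is first multiplied up to one,
  without new zeros over the open set in question.\<close>

lemma infinite_UNIV_alg_closed: "infinite (UNIV :: 'k::alg_closed_field set)"
proof
  assume fin: "finite (UNIV :: 'k set)"
  \<comment> \<open>Euclid's argument: over a finite field, \<open>p + 1\<close> would be
    nonconstant and have the value 1 everywhere, hence no root.\<close>
  define p :: "'k poly" where "p = (\<Prod>a\<in>UNIV. [:- a, 1:])"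
  have "poly (p + 1) x = 1" for x
    using fin by (simp add: p_def poly_prod)
  moreover have "degree (p + 1) > 0"
  proof -
    have "degree p = card (UNIV :: 'k set)"
      unfolding p_def by (subst degree_prod_eq_sum_degree) auto
    then have "degree p > 0"
      using fin by (simp add: card_gt_0_iff)
    then show ?thesis
      by (subst degree_add_eq_left) auto
  qed
  ultimately show False
    using alg_closed_imp_poly_has_root[of "p + 1"] by auto
qed

text \<open>This is what allows forms, which are encoded as functions, to be handled through their
  coefficients.\<close>

lemma poly_eq_0_if_vanishes:
  fixes p :: "'k::alg_closed_field poly"
  assumes "\<And>t. poly p t = 0"
  shows "p = 0"
  using poly_roots_finite[of p] assms infinite_UNIV_alg_closed by auto

subsection \<open>Forms\<close>

lemma zero_in_forms: "(\<lambda>_. 0) \<in> forms d"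
  unfolding forms_def by (auto intro!: exI[of _ "\<lambda>_. 0"])

lemma add_in_forms:
  assumes "F \<in> forms d" "G \<in> forms d"
  shows "(\<lambda>v. F v + G v) \<in> forms d"
proof -
  obtain a b where "\<And>x y. F (x, y) = (\<Sum>i\<le>d. a i * x ^ i * y ^ (d - i))"
    and "\<And>x y. G (x, y) = (\<Sum>i\<le>d. b i * x ^ i * y ^ (d - i))"
    using assms unfolding forms_def by blast
  then show ?thesis
    unfolding forms_def
    by (auto intro!: exI[of _ "\<lambda>i. a i + b i"] simp: sum.distrib algebra_simps)
qed

lemma cmult_in_forms: "F \<in> forms d \<Longrightarrow> (\<lambda>v. c * F v) \<in> forms d"
  using mult_in_forms[OF const_in_forms[of c]] by fastforce

lemma minus_in_forms: "F \<in> forms d \<Longrightarrow> (\<lambda>v. - F v) \<in> forms d"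
  using cmult_in_forms[of F d "-1"] by simp

lemma diff_in_forms: "F \<in> forms d \<Longrightarrow> G \<in> forms d \<Longrightarrow> (\<lambda>v. F v - G v) \<in> forms d"
  using add_in_forms[OF _ minus_in_forms, of F d G] by simp

lemma sum_in_forms:
  assumes "\<And>l. l \<in> I \<Longrightarrow> F l \<in> forms d"
  shows "(\<lambda>v. \<Sum>l\<in>I. F l v) \<in> forms d"
  using assms
  by (induction I rule: infinite_finite_induct) (auto intro: add_in_forms zero_in_forms)

lemma fst_in_forms: "fst \<in> forms 1" and snd_in_forms: "snd \<in> forms 1"
proof -
  show "fst \<in> forms 1"
    \<comment> \<open>On the indices 0 and 1 the coefficients \<open>of_nat i\<close> are 0 and 1,
      which selects \<open>x\<close>; for \<open>snd\<close> they are reversed.\<close>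
    unfolding forms_def by (auto intro!: exI[of _ "\<lambda>i. of_nat i"])
  show "snd \<in> forms 1"
    unfolding forms_def by (auto intro!: exI[of _ "\<lambda>i. of_nat (1 - i)"])
qed

lemma power_in_forms: "F \<in> forms d \<Longrightarrow> (\<lambda>v. F v ^ m) \<in> forms (d * m)"
proof (induction m)
  case 0
  then show ?case using const_in_forms[of 1] by simp
next
  case (Suc m)
  then show ?case using mult_in_forms[of F d "\<lambda>v. F v ^ m"] by simp
qed

text \<open>A monomial of degree \<open>d\<close> only for \<open>l \<le> d\<close>; beyond that the
  truncated difference leaves \<open>x ^ l\<close>.\<close>

definition hmon :: "nat \<Rightarrow> nat \<Rightarrow> 'k::field \<times> 'k \<Rightarrow> 'k"
  where "hmon d l = (\<lambda>v. fst v ^ l * snd v ^ (d - l))"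

lemma hmon_in_forms: "l \<le> d \<Longrightarrow> hmon d l \<in> forms d"
  using mult_in_forms[OF power_in_forms[OF fst_in_forms, of l] power_in_forms[OF snd_in_forms, of "d - l"]]
  by (simp add: hmon_def)

lemma forms_altdef: "forms d = {F. \<exists>c. F = (\<lambda>v. \<Sum>l\<le>d. c l * hmon d l v)}"
  unfolding forms_def hmon_def by (auto simp: fun_eq_iff mult.assoc)

lemma formsE:
  assumes "F \<in> forms d"
  obtains c where "F = (\<lambda>v. \<Sum>l\<le>d. c l * hmon d l v)"
  using assms unfolding forms_altdef by blast

lemma forms_0E:
  assumes "F \<in> forms 0"
  obtains c where "F = (\<lambda>_. c)"
  using formsE[OF assms] by (auto simp: hmon_def)

lemma linear_in_forms: "(\<lambda>v. a * fst v + b * snd v) \<in> forms 1"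
  by (intro add_in_forms cmult_in_forms fst_in_forms snd_in_forms)

lemma forms_homogeneous:
  assumes "F \<in> forms d"
  shows "F (c * x, c * y) = c ^ d * F (x, y)"
proof -
  obtain a where a: "F = (\<lambda>v. \<Sum>l\<le>d. a l * hmon d l v)"
    using assms by (rule formsE)
  have "hmon d l (c * x, c * y) = c ^ d * hmon d l (x, y)" if "l \<le> d" for l
  proof -
    have "c ^ d = c ^ l * c ^ (d - l)"
      using that by (simp flip: power_add)
    then show ?thesis
      by (simp add: hmon_def power_mult_distrib mult_ac)
  qed
  then show ?thesis
    by (simp add: a sum_distrib_left mult_ac)
qed

lemma comp_in_forms:
  assumes "F \<in> forms d" "P \<in> forms m" "Q \<in> forms m"
  shows "(\<lambda>v. F (P v, Q v)) \<in> forms (d * m)"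
proof -
  obtain c where c: "F = (\<lambda>v. \<Sum>l\<le>d. c l * hmon d l v)"
    using assms(1) by (rule formsE)
  have "(\<lambda>v. hmon d l (P v, Q v)) \<in> forms (d * m)" if "l \<le> d" for l
  proof -
    have "m * l + m * (d - l) = d * m"
      using that by (simp add: algebra_simps flip: add_mult_distrib2)
    then show ?thesis
      using mult_in_forms[OF power_in_forms[OF assms(2), of l] power_in_forms[OF assms(3), of "d - l"]]
      by (simp add: hmon_def)
  qed
  then show ?thesis
    unfolding c by (intro sum_in_forms cmult_in_forms) auto
qed

text \<open>On the chart \<open>y = 1\<close> a form becomes a polynomial with the same
  coefficients. The degree is only bounded by \<open>d\<close>, because it drops exactly when the
  form vanishes at \<open>(1, 0)\<close>, the point outside the chart.\<close>

lemma forms_dehomogenize: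
  assumes "F \<in> forms d"
  obtains p where "degree p \<le> d" "\<And>t. F (t, 1) = poly p t" "F = (\<lambda>v. \<Sum>l\<le>d. coeff p l * hmon d l v)"
proof -
  obtain c where c: "F = (\<lambda>v. \<Sum>l\<le>d. c l * hmon d l v)"
    using assms by (rule formsE)
  define p where "p = (\<Sum>l\<le>d. monom (c l) l)"
  have coeff: "coeff p l = (if l \<le> d then c l else 0)" for l
    by (simp add: p_def coeff_sum)
  show ?thesis
  proof
    show "degree p \<le> d"
      by (rule degree_le) (simp add: coeff)
    show "F (t, 1) = poly p t" for t
      by (simp add: c p_def poly_sum poly_monom hmon_def)
    show "F = (\<lambda>v. \<Sum>l\<le>d. coeff p l * hmon d l v)"
      by (simp add: c coeff)
  qed
qed

lemma forms_eq_0: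
  fixes F :: "'k::alg_closed_field \<times> 'k \<Rightarrow> 'k"
  assumes "F \<in> forms d" "\<And>t. F (t, 1) = 0"
  shows "F = (\<lambda>_. 0)"
proof -
  obtain p where p: "degree p \<le> d" "\<And>t. F (t, 1) = poly p t" "F = (\<lambda>v. \<Sum>l\<le>d. coeff p l * hmon d l v)"
    using forms_dehomogenize[OF assms(1)] by metis
  have "p = 0"
    using p(2) assms(2) by (intro poly_eq_0_if_vanishes) auto
  then show ?thesis
    using p(3) by simp
qed

text \<open>On the chart \<open>y = 1\<close> this is the fact that polynomials over a field form a
  domain. Vanishing is asked only away from the origin because that is what statements about points
  of the line provide.\<close>

lemma forms_no_zero_divisors:
  fixes F :: "'k::alg_closed_field \<times> 'k \<Rightarrow> 'k"
  assumes "F \<in> forms d" "G \<in> forms e" "\<And>v. v \<noteq> (0, 0) \<Longrightarrow> F v * G v = 0"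
  shows "F = (\<lambda>_. 0) \<or> G = (\<lambda>_. 0)"
proof -
  obtain p where p: "\<And>t. F (t, 1) = poly p t"
    using forms_dehomogenize[OF assms(1)] by metis
  obtain r where r: "\<And>t. G (t, 1) = poly r t"
    using forms_dehomogenize[OF assms(2)] by metis
  have "poly (p * r) t = 0" for t
    using assms(3)[of "(t, 1)"] p r by simp
  then have "p * r = 0"
    by (rule poly_eq_0_if_vanishes)
  then have "p = 0 \<or> r = 0"
    by simp
  then show ?thesis
    using forms_eq_0[OF assms(1)] forms_eq_0[OF assms(2)] p r by auto
qed

lemma forms_cancel:
  fixes F :: "'k::alg_closed_field \<times> 'k \<Rightarrow> 'k"
  assumes "F \<in> forms d" "G \<in> forms e" "H \<in> forms e" "F \<noteq> (\<lambda>_. 0)"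
    "\<And>v. v \<noteq> (0, 0) \<Longrightarrow> F v * G v = F v * H v"
  shows "G = H"
proof -
  have "F v * (G v - H v) = 0" if "v \<noteq> (0, 0)" for v
    using assms(5)[OF that] by (simp add: algebra_simps)
  then have "(\<lambda>v. G v - H v) = (\<lambda>_. 0)"
    using forms_no_zero_divisors[OF assms(1) diff_in_forms[OF assms(2,3)]] assms(4) by simp
  then show ?thesis
    by (simp add: fun_eq_iff)
qed

section \<open>Linear forms and the zeros of forms\<close>

definition lin :: "'k::field \<times> 'k \<Rightarrow> 'k \<times> 'k \<Rightarrow> 'k"
  where "lin v = (\<lambda>w. snd v * fst w - fst v * snd w)"

lemma lin_in_forms: "lin v \<in> forms 1"
  unfolding lin_def
  by (intro diff_in_forms cmult_in_forms fst_in_forms snd_in_forms)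

lemma lin_self [simp]: "lin v v = 0"
  by (simp add: lin_def)

lemma lin_nonzero:
  assumes "v \<noteq> (0, 0)"
  shows "lin v \<noteq> (\<lambda>_. 0)"
proof
  assume "lin v = (\<lambda>_. 0)"
  then have "lin v (1, 0) = 0" "lin v (0, 1) = 0"
    by simp_all
  then show False
    using assms by (cases v) (simp add: lin_def)
qed

text \<open>\<open>lin v w\<close> is the determinant of \<open>w\<close> and \<open>v\<close>, so
  for nonzero vectors it detects proportionality, that is, equality of points.\<close>

lemma lin_eq_0_iff:
  assumes "v \<noteq> (0, 0)" "w \<noteq> (0, 0)"
  shows "lin v w = 0 \<longleftrightarrow> (\<exists>c. c \<noteq> 0 \<and> w = (c * fst v, c * snd v))"
proof
  obtain a b x y where vw: "v = (a, b)" "w = (x, y)"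
    by (cases v, cases w)
  assume "lin v w = 0"
  then have eq: "b * x = a * y"
    by (simp add: lin_def vw)
  show "\<exists>c. c \<noteq> 0 \<and> w = (c * fst v, c * snd v)"
  proof (cases "b = 0")
    case True
    then have "y = 0" "a \<noteq> 0" "x \<noteq> 0"
      using eq assms vw by auto
    then show ?thesis
      using True by (intro exI[of _ "x / a"]) (simp add: vw)
  next
    case False
    have "y \<noteq> 0"
      using eq False assms vw by auto
    with False eq show ?thesis
      by (intro exI[of _ "y / b"]) (auto simp: vw field_simps)
  qed
qed (auto simp: lin_def)

text \<open>For a zero in the chart \<open>y = 1\<close>, the factor comes from dividing the
  dehomogenized polynomial by the linear polynomial of its root. A zero at the class of
  \<open>(1, 0)\<close> shows only as a vanishing top coefficient, and there the factor is a
  multiple of \<open>y\<close>.\<close>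

lemma forms_factor:
  assumes "F \<in> forms d" "v \<noteq> (0, 0)" "F v = 0" "F \<noteq> (\<lambda>_. 0)"
  obtains e F' where "d = Suc e" "F' \<in> forms e" "F = (\<lambda>w. lin v w * F' w)"
proof -
  obtain p where p: "degree p \<le> d" "\<And>t. F (t, 1) = poly p t" "F = (\<lambda>v. \<Sum>l\<le>d. coeff p l * hmon d l v)"
    using forms_dehomogenize[OF assms(1)] by metis
  obtain a b where v: "v = (a, b)" by (cases v)
  have "d \<noteq> 0"
  proof
    assume "d = 0"
    then obtain c where "F = (\<lambda>_. c)"
      using assms(1) forms_0E by blast
    then show False
      using assms(3,4) by simp
  qed
  then obtain e where e: "d = Suc e"
    by (cases d) auto
  show ?thesis
  proof (cases "b = 0")
    case True
    then have "a \<noteq> 0"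
      using assms(2) v by auto
    have "F v = coeff p d * a ^ d"
      unfolding p(3) v True
      by (subst sum.mono_neutral_right[of _ "{d}"]) (auto simp: hmon_def)
    then have cd: "coeff p d = 0"
      using assms(3) \<open>a \<noteq> 0\<close> by simp
    define F' where "F' = (\<lambda>w. \<Sum>l\<le>e. (- coeff p l / a) * hmon e l w)"
    have "F w = lin v w * F' w" for w
    proof -
      have "F w = (\<Sum>l\<le>e. coeff p l * hmon d l w)"
        using cd by (simp add: p(3) e)
      also have "\<dots> = (\<Sum>l\<le>e. lin v w * ((- coeff p l / a) * hmon e l w))"
        using \<open>a \<noteq> 0\<close> by (intro sum.cong) (auto simp: hmon_def e lin_def v True Suc_diff_le)
      finally show ?thesis
        by (simp add: F'_def sum_distrib_left)
    qed
    moreover have "F' \<in> forms e"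
      unfolding F'_def by (intro sum_in_forms cmult_in_forms hmon_in_forms) auto
    ultimately show ?thesis
      using that e by blast
  next
    case False
    have "b ^ d * F (a / b, 1) = F (b * (a / b), b * 1)"
      using forms_homogeneous[OF assms(1), of b "a / b" 1] by simp
    then have "poly p (a / b) = 0"
      using assms(3) False p(2) v by simp
    then obtain r where r: "p = [:- (a / b), 1:] * r"
      by (auto simp: poly_eq_0_iff_dvd)
    have "p \<noteq> 0"
      using assms(4) p(3) by auto
    then have "r \<noteq> 0"
      using r by auto
    then have "degree p = Suc (degree r)"
      unfolding r by (subst degree_mult_eq) auto
    then have dr: "degree r \<le> e"
      using p(1) e by simp
    have cp: "coeff p l = (if l = 0 then 0 else coeff r (l - 1)) - a / b * coeff r l" for l
      unfolding r by (cases l) (auto simp: coeff_pCons)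
    \<comment> \<open>On the chart \<open>lin v\<close> is \<open>b\<close> times
      \<open>X - a / b\<close>, so the cofactor \<open>r\<close> is divided by
      \<open>b\<close>.\<close>
    define F' where "F' = (\<lambda>w. \<Sum>l\<le>e. (coeff r l / b) * hmon e l w)"
    have "F w = lin v w * F' w" for w
    proof -
      have "F w = (\<Sum>l\<le>d. (if l = 0 then 0 else coeff r (l - 1)) * hmon d l w) - a / b * (\<Sum>l\<le>d. coeff r l * hmon d l w)"
        unfolding p(3) cp by (simp add: algebra_simps sum_subtractf sum_distrib_left)
      also have "(\<Sum>l\<le>d. (if l = 0 then 0 else coeff r (l - 1)) * hmon d l w) = (\<Sum>l\<le>e. coeff r l * hmon d (Suc l) w)"
        unfolding e by (subst sum.atMost_Suc_shift) simp
      also have "\<dots> = fst w * (\<Sum>l\<le>e. coeff r l * hmon e l w)"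
        unfolding sum_distrib_left by (intro sum.cong) (auto simp: hmon_def e)
      also have "(\<Sum>l\<le>d. coeff r l * hmon d l w) = (\<Sum>l\<le>e. coeff r l * hmon d l w)"
        using dr by (simp add: e coeff_eq_0)
      also have "\<dots> = snd w * (\<Sum>l\<le>e. coeff r l * hmon e l w)"
        unfolding sum_distrib_left by (intro sum.cong) (auto simp: hmon_def e Suc_diff_le)
      also have "fst w * (\<Sum>l\<le>e. coeff r l * hmon e l w) - a / b * (snd w * (\<Sum>l\<le>e. coeff r l * hmon e l w))
          = lin v w * ((\<Sum>l\<le>e. coeff r l * hmon e l w) / b)"
        using False by (simp add: lin_def v field_simps)
      finally show ?thesis
        by (simp add: F'_def sum_divide_distrib)
    qed
    moreover have "F' \<in> forms e"
      unfolding F'_def by (intro sum_in_forms cmult_in_forms hmon_in_forms) auto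
    ultimately show ?thesis
      using that e by blast
  qed
qed

text \<open>Either the dehomogenized polynomial keeps the degree \<open>d\<close> and has a root, or
  its degree drops and \<open>(1, 0)\<close> is a zero.\<close>

lemma forms_has_zero:
  fixes F :: "'k::alg_closed_field \<times> 'k \<Rightarrow> 'k"
  assumes "F \<in> forms d" "0 < d"
  obtains v where "v \<noteq> (0, 0)" "F v = 0"
proof -
  obtain p where p: "degree p \<le> d" "\<And>t. F (t, 1) = poly p t" "F = (\<lambda>v. \<Sum>l\<le>d. coeff p l * hmon d l v)"
    using forms_dehomogenize[OF assms(1)] by metis
  show ?thesis
  proof (cases "degree p = d")
    case True
    then obtain t where "poly p t = 0"
      using alg_closed_imp_poly_has_root assms(2) by blast
    then show ?thesis
      using p(2) by (intro that[of "(t, 1)"]) auto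
  next
    case False
    then have "coeff p d = 0"
      using p(1) by (simp add: coeff_eq_0)
    moreover have "F (1, 0) = coeff p d"
      unfolding p(3) by (subst sum.mono_neutral_right[of _ "{d}"]) (auto simp: hmon_def)
    ultimately show ?thesis
      by (intro that[of "(1, 0)"]) auto
  qed
qed

lemma forms_interpolate:
  assumes "v \<noteq> (0, 0)"
  obtains F where "F \<in> forms d" "F v = c"
proof (cases "fst v = 0")
  case True
  then have "snd v \<noteq> 0"
    using assms by (metis prod.collapse)
  then show ?thesis
    using that[OF cmult_in_forms[OF power_in_forms[OF snd_in_forms, of d, simplified]], of "c / snd v ^ d"] by simp
next
  case False
  then show ?thesis
    using that[OF cmult_in_forms[OF power_in_forms[OF fst_in_forms, of d, simplified]], of "c / fst v ^ d"] by simp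
qed

subsection \<open>Coprime forms\<close>

text \<open>Euclid's lemma without a gcd: at a zero of \<open>P\<close> the form \<open>Q\<close>
  does not vanish, so \<open>C\<close> does, and the same linear factor cancels from
  \<open>P\<close> and from \<open>C\<close>. Induction on the degree of \<open>P\<close> strips all
  its zeros. The bound \<open>n \<le> m\<close> is what later rules out relations in low
  degree.\<close>

lemma forms_coprime_dvd:
  fixes P :: "'k::alg_closed_field \<times> 'k \<Rightarrow> 'k"
  assumes "P \<in> forms n" "Q \<in> forms b" "A \<in> forms a" "C \<in> forms m" "n + a = b + m"
    and "P \<noteq> (\<lambda>_. 0)" "C \<noteq> (\<lambda>_. 0)"
    and "\<And>v. v \<noteq> (0, 0) \<Longrightarrow> P v = 0 \<Longrightarrow> Q v \<noteq> 0"
    and "\<And>v. P v * A v = Q v * C v"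
  shows "n \<le> m \<and> (\<exists>D\<in>forms (m - n). C = (\<lambda>v. P v * D v))"
  using assms
proof (induction n arbitrary: P C m)
  case 0
  then obtain c where c: "P = (\<lambda>_. c)"
    using forms_0E by blast
  then have "c \<noteq> 0"
    using 0 by auto
  then show ?case
    using cmult_in_forms[OF 0(4), of "inverse c"] c
    by (auto intro!: bexI[of _ "\<lambda>v. inverse c * C v"])
next
  case (Suc n)
  obtain v where v: "v \<noteq> (0, 0)" "P v = 0"
    using forms_has_zero[OF Suc.prems(1)] by auto
  have "C v = 0"
    using Suc.prems(8)[OF v] Suc.prems(9)[of v] v(2) by simp
  obtain P' where P': "P' \<in> forms n" "P = (\<lambda>w. lin v w * P' w)"
    using forms_factor[OF Suc.prems(1) v Suc.prems(6)] by blast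
  obtain m' C' where C': "m = Suc m'" "C' \<in> forms m'" "C = (\<lambda>w. lin v w * C' w)"
    using forms_factor[OF Suc.prems(4) v(1) \<open>C v = 0\<close> Suc.prems(7)] by blast
  have deg: "n + a = b + m'"
    using Suc.prems(5) C'(1) by simp
  have "(\<lambda>w. P' w * A w) = (\<lambda>w. Q w * C' w)"
  proof (rule forms_cancel[OF lin_in_forms mult_in_forms[OF P'(1) Suc.prems(3)] _ lin_nonzero[OF v(1)]])
    show "(\<lambda>w. Q w * C' w) \<in> forms (n + a)"
      unfolding deg by (rule mult_in_forms[OF Suc.prems(2) C'(2)])
    show "lin v w * (P' w * A w) = lin v w * (Q w * C' w)" for w
      using Suc.prems(9)[of w] unfolding P'(2) C'(3) by (simp add: mult_ac)
  qed
  then have eq: "P' w * A w = Q w * C' w" for w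
    by (rule fun_cong)
  have "n \<le> m' \<and> (\<exists>D\<in>forms (m' - n). C' = (\<lambda>v. P' v * D v))"
  proof (rule Suc.IH[OF P'(1) Suc.prems(2,3) C'(2) deg _ _ _ eq])
    show "P' \<noteq> (\<lambda>_. 0)" "C' \<noteq> (\<lambda>_. 0)"
      using Suc.prems(6,7) P'(2) C'(3) by auto
    show "Q w \<noteq> 0" if "w \<noteq> (0, 0)" "P' w = 0" for w
      using Suc.prems(8)[OF that(1)] that(2) P'(2) by simp
  qed
  then show ?case
    using P'(2) C'(1,3) by (auto simp: mult.assoc)
qed

text \<open>Modulo \<open>Q\<close>, the form \<open>G\<close> can be corrected at one zero of
  \<open>P\<close> at a time: since \<open>Q v \<noteq> 0\<close>, some \<open>c\<close> makes
  \<open>G - Q c\<close> vanish at the zero \<open>v\<close>; then \<open>lin v\<close> is divided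
  out of this difference and of \<open>P\<close>. Both sides of \<open>a + b \<le> d\<close> drop by
  one in each step, so there is always room for \<open>c\<close> in degree
  \<open>d - b\<close>.\<close>

lemma forms_coprime_ideal:
  fixes P :: "'k::alg_closed_field \<times> 'k \<Rightarrow> 'k"
  assumes "P \<in> forms a" "Q \<in> forms b" "P \<noteq> (\<lambda>_. 0)" "a + b \<le> d" "G \<in> forms d"
    and "\<And>v. v \<noteq> (0, 0) \<Longrightarrow> P v = 0 \<Longrightarrow> Q v \<noteq> 0"
  shows "\<exists>u\<in>forms (d - a). \<exists>w\<in>forms (d - b). G = (\<lambda>v. P v * u v + Q v * w v)"
  using assms
proof (induction a arbitrary: P G d)
  case 0
  then obtain c where c: "P = (\<lambda>_. c)"
    using forms_0E by blast
  then have "c \<noteq> 0"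
    using 0 by auto
  then have "G = (\<lambda>v. P v * (inverse c * G v) + Q v * 0)"
    by (simp add: c mult.assoc[symmetric])
  moreover have "(\<lambda>v. inverse c * G v) \<in> forms (d - 0)"
    using cmult_in_forms[OF 0(5)] by simp
  ultimately show ?case
    using zero_in_forms[of "d - b"]
    by - (intro bexI[of _ "\<lambda>v. inverse c * G v"] bexI[of _ "\<lambda>_. 0"])
next
  case (Suc a)
  obtain v where v: "v \<noteq> (0, 0)" "P v = 0"
    using forms_has_zero[OF Suc.prems(1)] by auto
  obtain P' where P': "P' \<in> forms a" "P = (\<lambda>w. lin v w * P' w)"
    using forms_factor[OF Suc.prems(1) v Suc.prems(3)] by blast
  obtain c where c: "c \<in> forms (d - b)" "c v = G v / Q v"
    using forms_interpolate[OF v(1)] by blast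
  have bd: "b + (d - b) = d"
    using Suc.prems(4) by simp
  have H: "(\<lambda>w. G w - Q w * c w) \<in> forms d"
    using diff_in_forms[OF Suc.prems(5), of "\<lambda>w. Q w * c w"] mult_in_forms[OF Suc.prems(2) c(1)] bd
    by simp
  show ?case
  proof (cases "(\<lambda>w. G w - Q w * c w) = (\<lambda>_. 0)")
    case True
    then have "G = (\<lambda>w. P w * 0 + Q w * c w)"
      by (simp add: fun_eq_iff)
    then show ?thesis
      using c(1) zero_in_forms[of "d - Suc a"]
      by - (intro bexI[of _ "\<lambda>_. 0"] bexI[of _ c])
  next
    case False
    have "G v - Q v * c v = 0"
      using Suc.prems(6)[OF v] c(2) by simp
    then obtain d' G' where G': "d = Suc d'" "G' \<in> forms d'"
      "(\<lambda>w. G w - Q w * c w) = (\<lambda>w. lin v w * G' w)"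
      using forms_factor[OF H v(1) _ False] by blast
    have "\<exists>u\<in>forms (d' - a). \<exists>w\<in>forms (d' - b). G' = (\<lambda>v. P' v * u v + Q v * w v)"
    proof (rule Suc.IH[OF P'(1) Suc.prems(2) _ _ G'(2)])
      show "P' \<noteq> (\<lambda>_. 0)"
        using Suc.prems(3) P'(2) by auto
      show "a + b \<le> d'"
        using Suc.prems(4) G'(1) by simp
      show "Q w \<noteq> 0" if "w \<noteq> (0, 0)" "P' w = 0" for w
        using Suc.prems(6)[OF that(1)] that(2) P'(2) by simp
    qed
    then obtain u w where uw: "u \<in> forms (d' - a)" "w \<in> forms (d' - b)"
      "G' = (\<lambda>v. P' v * u v + Q v * w v)"
      by blast
    have "1 + (d' - b) = d - b"
      using Suc.prems(4) G'(1) by simp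
    then have "(\<lambda>x. c x + lin v x * w x) \<in> forms (d - b)"
      using add_in_forms[OF c(1)] mult_in_forms[OF lin_in_forms uw(2)] by metis
    moreover have "G = (\<lambda>x. P x * u x + Q x * (c x + lin v x * w x))"
    proof
      fix x
      show "G x = P x * u x + Q x * (c x + lin v x * w x)"
        using fun_cong[OF G'(3), of x] unfolding uw(3) P'(2) by (simp add: algebra_simps)
    qed
    moreover have "u \<in> forms (d - Suc a)"
      using uw(1) G'(1) by simp
    ultimately show ?thesis
      by - (intro bexI[of _ u] bexI[of _ "\<lambda>x. c x + lin v x * w x"])
  qed
qed

section \<open>The dimension of the space of forms\<close>

interpretation form_space: vector_space "\<lambda>(c :: 'k::field) (F :: 'k \<times> 'k \<Rightarrow> 'k) v. c * F v"
  by standard (auto simp: algebra_simps fun_eq_iff)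

lemma sum_fun_apply: "(\<Sum>i\<in>I. F i) v = (\<Sum>i\<in>I. F i v)"
  for F :: "'i \<Rightarrow> 'a \<Rightarrow> 'b::comm_monoid_add"
  by (induction I rule: infinite_finite_induct) auto

context vector_space
begin

text \<open>Independence in the library concerns sets, whereas the bases here are indexed families;
  that the members are distinct has to come out as well. The converse translation is
  \<open>scalars_zero_if_independent\<close>.\<close>

lemma
  assumes "finite I" "\<And>c. (\<Sum>i\<in>I. scale (c i) (b i)) = 0 \<Longrightarrow> \<forall>i\<in>I. c i = 0"
  shows inj_on_if_scalars_zero: "inj_on b I"
    and independent_image_if_scalars_zero: "independent (b ` I)"
proof -
  show inj: "inj_on b I"
  proof (rule inj_onI, rule ccontr)
    fix i j assume ij: "i \<in> I" "j \<in> I" "b i = b j" "i \<noteq> j"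
    \<comment> \<open>Two equal members with weights 1 and -1 would give a nontrivial
      relation.\<close>
    define c where "c l = (if l = i then 1 else if l = j then -1 else 0 :: 'a)" for l
    have "(\<Sum>l\<in>I. scale (c l) (b l)) = (\<Sum>l\<in>{i, j}. scale (c l) (b l))"
      using ij assms(1) by (intro sum.mono_neutral_right) (auto simp: c_def)
    also have "\<dots> = 0"
      using ij by (simp add: c_def)
    finally show False
      using assms(2)[of c] ij by (auto simp: c_def)
  qed
  show "independent (b ` I)"
  proof (rule independent_if_scalars_zero)
    fix f x assume "(\<Sum>x\<in>b ` I. scale (f x) x) = 0" "x \<in> b ` I"
    then show "f x = 0"
      using assms(2)[of "f \<circ> b"] by (auto simp: sum.reindex[OF inj])
  qed (use assms(1) in simp)
qed

lemma scalars_zero_if_independent: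
  assumes "independent C" "finite C" "bij_betw g J C" "(\<Sum>j\<in>J. scale (c j) (g j)) = 0" "j \<in> J"
  shows "c j = 0"
proof -
  define h where "h = the_inv_into J g"
  have h: "h (g j) = j" if "j \<in> J" for j
    using assms(3) that by (simp add: h_def bij_betw_def the_inv_into_f_f)
  have "(\<Sum>x\<in>C. scale (c (h x)) x) = (\<Sum>j\<in>J. scale (c (h (g j))) (g j))"
    by (rule sum.reindex_bij_betw[OF assms(3), symmetric])
  also have "\<dots> = 0"
    using assms(4) h by simp
  finally have "c (h (g j)) = 0"
    using independentD[OF assms(1,2) subset_refl, of "\<lambda>x. c (h x)"] bij_betwE[OF assms(3)] assms(5)
    by blast
  then show ?thesis
    using h[OF assms(5)] by simp
qed

end

lemma hmon_independent:
  fixes c :: "nat \<Rightarrow> 'k::alg_closed_field"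
  assumes "\<And>v. (\<Sum>l\<le>d. c l * hmon d l v) = 0" "l \<le> d"
  shows "c l = 0"
proof -
  have "(\<Sum>l\<le>d. monom (c l) l) = 0"
  proof (rule poly_eq_0_if_vanishes)
    fix t show "poly (\<Sum>l\<le>d. monom (c l) l) t = 0"
      using assms(1)[of "(t, 1)"] by (simp add: poly_sum poly_monom hmon_def)
  qed
  then have "coeff (\<Sum>l\<le>d. monom (c l) l) l = 0"
    by simp
  then show ?thesis
    using assms(2) by (simp add: coeff_sum)
qed

lemma forms_eq_span: "forms d = form_space.span (hmon d ` {..d})"
proof (intro equalityI subsetI)
  fix F :: "'a \<times> 'a \<Rightarrow> 'a"
  assume "F \<in> forms d"
  then obtain c where "F = (\<lambda>v. \<Sum>l\<le>d. c l * hmon d l v)"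
    by (rule formsE)
  then have "F = (\<Sum>l\<le>d. (\<lambda>v. c l * hmon d l v))"
    by (simp add: fun_eq_iff sum_fun_apply)
  also have "\<dots> \<in> form_space.span (hmon d ` {..d})"
    by (intro form_space.span_sum form_space.span_scale form_space.span_base) auto
  finally show "F \<in> form_space.span (hmon d ` {..d})" .
next
  have "form_space.subspace (forms d :: ('a \<times> 'a \<Rightarrow> 'a) set)"
    unfolding form_space.subspace_def
    using zero_in_forms add_in_forms cmult_in_forms
    by (auto simp: zero_fun_def plus_fun_def)
  then have "form_space.span (hmon d ` {..d}) \<subseteq> (forms d :: ('a \<times> 'a \<Rightarrow> 'a) set)"
    by (intro form_space.span_minimal) (auto intro: hmon_in_forms)
  then show "F \<in> forms d" if "F \<in> form_space.span (hmon d ` {..d})" for F :: "'a \<times> 'a \<Rightarrow> 'a"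
    using that by blast
qed

lemma dim_forms: "form_space.dim (forms d :: ('k::alg_closed_field \<times> 'k \<Rightarrow> 'k) set) = Suc d"
proof -
  have *: "\<forall>l\<in>{..d}. c l = 0" if "(\<Sum>l\<le>d. (\<lambda>v. c l * hmon d l v)) = 0" for c :: "nat \<Rightarrow> 'k"
    using hmon_independent[of c d] fun_cong[OF that] by (auto simp: sum_fun_apply)
  show ?thesis
  proof (rule form_space.dim_unique)
    show "hmon d ` {..d} \<subseteq> (forms d :: ('k \<times> 'k \<Rightarrow> 'k) set)"
      by (auto intro: hmon_in_forms)
    show "(forms d :: ('k \<times> 'k \<Rightarrow> 'k) set) \<subseteq> form_space.span (hmon d ` {..d})"
      by (simp add: forms_eq_span)
    show "form_space.independent (hmon d ` {..d} :: ('k \<times> 'k \<Rightarrow> 'k) set)"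
      by (rule form_space.independent_image_if_scalars_zero[OF _ *]) auto
    show "card (hmon d ` {..d} :: ('k \<times> 'k \<Rightarrow> 'k) set) = Suc d"
      using form_space.inj_on_if_scalars_zero[OF _ *] by (simp add: card_image)
  qed
qed

text \<open>Meant for the coefficient forms in \<open>free_independence\<close>, where
  \<open>x\<close> and \<open>y\<close> become \<open>P\<close> and \<open>Q\<close>: modulo
  \<open>P\<close> only the multiple of \<open>Q ^ r\<close> survives. For \<open>r = 0\<close> the
  truncated degree \<open>r - 1\<close> would admit constants, hence the extra clause.\<close>

lemma forms_split:
  assumes "F \<in> forms r"
  obtains a F' where "F' \<in> forms (r - 1)" "r = 0 \<Longrightarrow> F' = (\<lambda>_. 0)"
    "F = (\<lambda>v. fst v * F' v + a * snd v ^ r)"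
proof (cases r)
  case 0
  then obtain c where "F = (\<lambda>_. c)"
    using assms forms_0E by blast
  then show ?thesis
    using that[OF zero_in_forms, of c] 0 by simp
next
  case (Suc e)
  obtain c where c: "F = (\<lambda>v. \<Sum>l\<le>r. c l * hmon r l v)"
    using assms by (rule formsE)
  define F' where "F' = (\<lambda>v. \<Sum>l\<le>e. c (Suc l) * hmon e l v)"
  have "F v = fst v * F' v + c 0 * snd v ^ r" for v
    unfolding c Suc sum.atMost_Suc_shift F'_def sum_distrib_left
    by (simp add: hmon_def mult_ac add.commute)
  moreover have "F' \<in> forms e"
    unfolding F'_def by (intro sum_in_forms cmult_in_forms hmon_in_forms) auto
  ultimately show ?thesis
    using that[of F' "c 0"] Suc by (simp add: fun_eq_iff)
qed

section \<open>Freeness over the subring generated by \<open>P\<close> and \<open>Q\<close>\<close>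

locale coprime_forms =
  fixes P Q :: "'k::alg_closed_field \<times> 'k \<Rightarrow> 'k" and m :: nat
  assumes P_form: "P \<in> forms m" and Q_form: "Q \<in> forms m" and m_pos: "0 < m"
    and no_common_zero: "\<And>v. v \<noteq> (0, 0) \<Longrightarrow> P v = 0 \<Longrightarrow> Q v \<noteq> 0"
begin

text \<open>As \<open>m\<close> is positive, \<open>Q\<close> has a zero, and there \<open>P\<close>
  cannot vanish.\<close>

lemma P_nonzero: "P \<noteq> (\<lambda>_. 0)"
  using forms_has_zero[OF Q_form m_pos] no_common_zero by metis

text \<open>A relation makes \<open>P\<close> divide \<open>C\<close>, and a nonzero multiple of
  \<open>P\<close> has degree at least \<open>m > i\<close>.\<close>

lemma relation_trivial:
  assumes "A \<in> forms i" "C \<in> forms i" "i < m" "\<And>v. P v * A v + Q v * C v = 0"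
  shows "A = (\<lambda>_. 0)" "C = (\<lambda>_. 0)"
proof -
  show C: "C = (\<lambda>_. 0)"
  proof (rule ccontr)
    assume "C \<noteq> (\<lambda>_. 0)"
    moreover have "P v * - A v = Q v * C v" for v
      using assms(4)[of v] by (simp add: minus_unique)
    ultimately have "m \<le> i"
      using forms_coprime_dvd[OF P_form Q_form minus_in_forms[OF assms(1)] assms(2) refl P_nonzero]
        no_common_zero by blast
    with assms(3) show False by simp
  qed
  show "A = (\<lambda>_. 0)"
    using forms_no_zero_divisors[OF P_form assms(1)] P_nonzero assms(4) C by auto
qed

text \<open>Existence and uniqueness are stated for the triple \<open>A\<close>, \<open>C\<close>,
  \<open>b\<close> rather than for a subspace. The last clause thus includes that
  \<open>(A, C)\<close> is determined by \<open>P A + Q C\<close>, and later arguments can compare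
  coefficients directly.\<close>

definition complement_basis :: "nat \<Rightarrow> (nat \<Rightarrow> 'k \<times> 'k \<Rightarrow> 'k) \<Rightarrow> bool"
  where "complement_basis i B \<longleftrightarrow>
    (\<forall>l<m - i - 1. B l \<in> forms (m + i)) \<and>
    (\<forall>G\<in>forms (m + i). \<exists>A\<in>forms i. \<exists>C\<in>forms i. \<exists>b.
      G = (\<lambda>v. P v * A v + Q v * C v + (\<Sum>l<m - i - 1. b l * B l v))) \<and>
    (\<forall>A\<in>forms i. \<forall>C\<in>forms i. \<forall>b.
      (\<forall>v. P v * A v + Q v * C v + (\<Sum>l<m - i - 1. b l * B l v) = 0) \<longrightarrow>
      A = (\<lambda>_. 0) \<and> C = (\<lambda>_. 0) \<and> (\<forall>l<m - i - 1. b l = 0))"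

lemma complement_basis_form: "complement_basis i B \<Longrightarrow> l < m - i - 1 \<Longrightarrow> B l \<in> forms (m + i)"
  by (simp add: complement_basis_def)

lemma complement_basis_independent:
  assumes "complement_basis i B" "A \<in> forms i" "C \<in> forms i"
    and "\<And>v. P v * A v + Q v * C v + (\<Sum>l<m - i - 1. b l * B l v) = 0"
  shows "A = (\<lambda>_. 0)" "C = (\<lambda>_. 0)" "\<forall>l<m - i - 1. b l = 0"
proof -
  have "(\<forall>v. P v * A v + Q v * C v + (\<Sum>l<m - i - 1. b l * B l v) = 0) \<longrightarrow>
      A = (\<lambda>_. 0) \<and> C = (\<lambda>_. 0) \<and> (\<forall>l<m - i - 1. b l = 0)"
    using assms(1-3) unfolding complement_basis_def by blast
  then show "A = (\<lambda>_. 0)" "C = (\<lambda>_. 0)" "\<forall>l<m - i - 1. b l = 0"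
    using assms(4) by auto
qed

lemma complement_basis_exists:
  assumes "i < m"
  obtains B where "complement_basis i B"
proof -
  \<comment> \<open>The left copy indexes the multiples of \<open>P\<close>, the right copy those of
    \<open>Q\<close>; independence of the whole family is \<open>relation_trivial\<close>.\<close>
  define I :: "(nat + nat) set" where "I = {..i} <+> {..i}"
  define e where "e = case_sum (\<lambda>l v. P v * hmon i l v) (\<lambda>l v. Q v * hmon i l v)"
  have finI: "finite I" and cardI: "card I = 2 * Suc i"
    by (simp_all add: I_def card_Plus)
  have sum_e: "(\<Sum>j\<in>I. c j * e j v) =
      P v * (\<Sum>l\<le>i. c (Inl l) * hmon i l v) + Q v * (\<Sum>l\<le>i. c (Inr l) * hmon i l v)" for c v
    by (simp add: I_def e_def sum.Plus sum_distrib_left mult_ac)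
  have e_zero: "\<forall>j\<in>I. c j = 0" if "(\<Sum>j\<in>I. (\<lambda>v. c j * e j v)) = 0" for c
  proof -
    have *: "P v * (\<Sum>l\<le>i. c (Inl l) * hmon i l v) + Q v * (\<Sum>l\<le>i. c (Inr l) * hmon i l v) = 0" for v
      using fun_cong[OF that, of v] by (simp add: sum_fun_apply sum_e)
    have form: "(\<lambda>v. \<Sum>l\<le>i. a l * hmon i l v) \<in> forms i" for a :: "nat \<Rightarrow> 'k"
      by (intro sum_in_forms cmult_in_forms hmon_in_forms) auto
    note rel = relation_trivial[OF form form assms *]
    have "c (Inl l) = 0" "c (Inr l) = 0" if "l \<le> i" for l
      using fun_cong[OF rel(1)] fun_cong[OF rel(2)]
        hmon_independent[of "\<lambda>l. c (Inl l)" i l] hmon_independent[of "\<lambda>l. c (Inr l)" i l] that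
      by simp_all
    then show ?thesis
      by (auto simp: I_def)
  qed
  have e_inj: "inj_on e I" and e_indep: "form_space.independent (e ` I)"
    using form_space.inj_on_if_scalars_zero[OF finI e_zero]
      form_space.independent_image_if_scalars_zero[OF finI e_zero] by auto
  have "e ` I \<subseteq> forms (m + i)"
    using mult_in_forms[OF P_form hmon_in_forms] mult_in_forms[OF Q_form hmon_in_forms]
    by (auto simp: I_def e_def)
  then obtain C where C: "e ` I \<subseteq> C" "C \<subseteq> forms (m + i)" "form_space.independent C"
    "forms (m + i) \<subseteq> form_space.span C"
    using e_indep by (rule form_space.maximal_independent_subset_extend)
  have "card C = Suc (m + i)"
    using form_space.basis_card_eq_dim[OF C(2,4,3)] dim_forms[where 'k = 'k] by simp
  then have finC: "finite C"
    by (intro card_ge_0_finite) simp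
  have "card (C - e ` I) = m - i - 1"
    using C(1) finI \<open>card C = _\<close> assms by (simp add: card_Diff_subset card_image[OF e_inj] cardI)
  then obtain B where B: "bij_betw B {..<m - i - 1} (C - e ` I)"
    using ex_bij_betw_nat_finite[of "C - e ` I"] finC by (auto simp: atLeast0LessThan)
  define J where "J = I <+> {..<m - i - 1}"
  define g where "g = case_sum e B"
  have disj: "e x \<noteq> B l" if "x \<in> I" "l \<in> {..<m - i - 1}" for x l
    using bij_betwE[OF B] that by (metis DiffD2 imageI)
  have "inj_on g J"
  proof (rule inj_onI)
    fix x y assume "x \<in> J" "y \<in> J" "g x = g y"
    then show "x = y"
      unfolding J_def
      by (elim PlusE) (simp_all add: g_def inj_on_eq_iff[OF e_inj]
          inj_on_eq_iff[OF bij_betw_imp_inj_on[OF B]] disj disj[symmetric])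
  qed
  moreover have "g ` J = e ` I \<union> B ` {..<m - i - 1}"
    by (simp add: J_def g_def Plus_def image_Un image_image)
  ultimately have g: "bij_betw g J C"
    using C(1) bij_betw_imp_surj_on[OF B] by (auto simp: bij_betw_def)
  have sum_g: "(\<Sum>j\<in>J. c j * g j v) = P v * (\<Sum>l\<le>i. c (Inl (Inl l)) * hmon i l v) +
      Q v * (\<Sum>l\<le>i. c (Inl (Inr l)) * hmon i l v) + (\<Sum>l<m - i - 1. c (Inr l) * B l v)" for c v
    using sum_e[of "\<lambda>j. c (Inl j)" v] finI by (simp add: J_def g_def sum.Plus)
  have "complement_basis i B"
    unfolding complement_basis_def
  proof (intro conjI allI ballI impI)
    fix l assume "l < m - i - 1"
    then show "B l \<in> forms (m + i)"
      using B C(2) by (auto simp: bij_betw_def)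
  next
    fix G :: "'k \<times> 'k \<Rightarrow> 'k"
    assume "G \<in> forms (m + i)"
    then have "G \<in> form_space.span C"
      using C(4) by blast
    then obtain u where u: "G = (\<Sum>x\<in>C. (\<lambda>v. u x * x v))"
      unfolding form_space.span_finite[OF finC] by blast
    have "G v = (\<Sum>j\<in>J. u (g j) * g j v)" for v
      unfolding u sum_fun_apply by (rule sum.reindex_bij_betw[OF g, symmetric])
    then have "G = (\<lambda>v. P v * (\<Sum>l\<le>i. u (g (Inl (Inl l))) * hmon i l v) +
        Q v * (\<Sum>l\<le>i. u (g (Inl (Inr l))) * hmon i l v) + (\<Sum>l<m - i - 1. u (g (Inr l)) * B l v))"
      unfolding sum_g by (rule ext)
    moreover have "(\<lambda>v. \<Sum>l\<le>i. a l * hmon i l v) \<in> forms i" for a :: "nat \<Rightarrow> 'k"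
      by (intro sum_in_forms cmult_in_forms hmon_in_forms) auto
    ultimately show "\<exists>A\<in>forms i. \<exists>C\<in>forms i. \<exists>b.
        G = (\<lambda>v. P v * A v + Q v * C v + (\<Sum>l<m - i - 1. b l * B l v))"
      by (intro bexI[of _ "\<lambda>v. \<Sum>l\<le>i. u (g (Inl (Inl l))) * hmon i l v"]
          bexI[of _ "\<lambda>v. \<Sum>l\<le>i. u (g (Inl (Inr l))) * hmon i l v"]
          exI[of _ "\<lambda>l. u (g (Inr l))"])
  next
    fix A D :: "'k \<times> 'k \<Rightarrow> 'k" and b
    assume AD: "A \<in> forms i" "D \<in> forms i"
      and zero: "\<forall>v. P v * A v + Q v * D v + (\<Sum>l<m - i - 1. b l * B l v) = 0"
    obtain a where a: "A = (\<lambda>v. \<Sum>l\<le>i. a l * hmon i l v)"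
      using AD(1) by (rule formsE)
    obtain d where d: "D = (\<lambda>v. \<Sum>l\<le>i. d l * hmon i l v)"
      using AD(2) by (rule formsE)
    define c where "c = case_sum (case_sum a d) b"
    have "(\<Sum>j\<in>J. (\<lambda>v. c j * g j v)) = 0"
      using zero by (simp add: fun_eq_iff sum_fun_apply sum_g a d c_def)
    then have "c j = 0" if "j \<in> J" for j
      using form_space.scalars_zero_if_independent[OF C(3) finC g] that by blast
    then have "\<forall>l\<le>i. a l = 0" "\<forall>l\<le>i. d l = 0" "\<forall>l<m - i - 1. b l = 0"
      by (force simp: c_def J_def I_def)+
    then show "A = (\<lambda>_. 0)" "D = (\<lambda>_. 0)" "\<And>l. l < m - i - 1 \<Longrightarrow> b l = 0"
      by (simp_all add: a d)
  qed
  then show ?thesis by (rule that)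
qed

text \<open>A factor \<open>P\<close> or \<open>Q\<close> in front of a form becomes a factor
  \<open>x\<close> or \<open>y\<close> of its coefficients, which drives the induction. The
  coefficients of \<open>B\<close> have degree \<open>r - 1\<close>; for \<open>r = 0\<close> this
  degree would be negative, and the clause \<open>t l = (\<lambda>_. 0)\<close> stands in for
  it.\<close>

lemma free_generation:
  assumes "complement_basis i B" "i < m" "G \<in> forms (r * m + i)"
  obtains s t where "\<And>l. s l \<in> forms r" "\<And>l. t l \<in> forms (r - 1)"
    "\<And>l. r = 0 \<Longrightarrow> t l = (\<lambda>_. 0)"
    "G = (\<lambda>v. (\<Sum>l\<le>i. s l (P v, Q v) * hmon i l v) + (\<Sum>l<m - i - 1. t l (P v, Q v) * B l v))"
proof -
  let ?rep = "\<lambda>r G s t. (\<forall>l. s l \<in> forms r) \<and> (\<forall>l. t l \<in> forms (r - 1)) \<and>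
    (\<forall>l. r = 0 \<longrightarrow> t l = (\<lambda>_. 0)) \<and>
    G = (\<lambda>v. (\<Sum>l\<le>i. s l (P v, Q v) * hmon i l v) + (\<Sum>l<m - i - 1. t l (P v, Q v) * B l v))"
  have "\<exists>s t. ?rep r G s t"
    using assms(3)
  proof (induction r arbitrary: G rule: less_induct)
    case (less r)
    \<comment> \<open>Membership in the ideal of \<open>P\<close> and \<open>Q\<close> is available
      from degree \<open>2 m\<close> on, hence for \<open>r \<ge> 2\<close>. The degree
      \<open>i\<close> is spanned by monomials, and the degree \<open>m + i\<close> is covered by
      the choice of \<open>B\<close>.\<close>
    consider "r = 0" | "r = 1" | "2 \<le> r" by linarith
    then show ?case
    proof cases
      case 1
      then obtain c where "G = (\<lambda>v. \<Sum>l\<le>i. c l * hmon i l v)"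
        using less.prems by (auto elim: formsE)
      then show ?thesis
        using 1 by (intro exI[of _ "\<lambda>l _. c l"] exI[of _ "\<lambda>_ _. 0"])
          (auto intro: const_in_forms zero_in_forms)
    next
      case 2
      then obtain A C b where AC: "A \<in> forms i" "C \<in> forms i"
        "G = (\<lambda>v. P v * A v + Q v * C v + (\<Sum>l<m - i - 1. b l * B l v))"
        using less.prems assms(1) unfolding complement_basis_def by auto
      obtain a where a: "A = (\<lambda>v. \<Sum>l\<le>i. a l * hmon i l v)"
        using AC(1) by (rule formsE)
      obtain c where c: "C = (\<lambda>v. \<Sum>l\<le>i. c l * hmon i l v)"
        using AC(2) by (rule formsE)
      have "?rep r G (\<lambda>l v. a l * fst v + c l * snd v) (\<lambda>l _. b l)"
        unfolding 2
      proof (intro conjI allI)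
        show "(\<lambda>v. a l * fst v + c l * snd v) \<in> forms 1" for l
          by (rule linear_in_forms)
        show "(\<lambda>_. b l) \<in> forms (1 - 1)" for l
          using const_in_forms by simp
        show "G = (\<lambda>v. (\<Sum>l\<le>i. (a l * fst (P v, Q v) + c l * snd (P v, Q v)) * hmon i l v)
            + (\<Sum>l<m - i - 1. b l * B l v))"
          by (simp add: AC(3) a c fun_eq_iff sum_distrib_left sum.distrib algebra_simps)
      qed simp
      then show ?thesis
        by (rule exI[of _ "\<lambda>l v. a l * fst v + c l * snd v", OF exI[of _ "\<lambda>l _. b l"]])
    next
      case 3
      define k where "k = r - 2"
      have k: "r = Suc (Suc k)"
        using 3 unfolding k_def by linarith
      have d: "r * m + i - m = Suc k * m + i" "m + m \<le> r * m + i"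
        by (simp_all add: k)
      obtain u w where uw: "u \<in> forms (Suc k * m + i)" "w \<in> forms (Suc k * m + i)"
        "G = (\<lambda>v. P v * u v + Q v * w v)"
        using forms_coprime_ideal[OF P_form Q_form P_nonzero d(2) less.prems no_common_zero]
        unfolding d(1) by blast
      obtain s t where st: "?rep (Suc k) u s t"
        using less.IH[OF _ uw(1)] k by blast
      obtain s' t' where st': "?rep (Suc k) w s' t'"
        using less.IH[OF _ uw(2)] k by blast
      have comb: "(\<lambda>v. fst v * F v + snd v * F' v) \<in> forms (Suc e)"
        if "F \<in> forms e" "F' \<in> forms e" for e and F F' :: "'k \<times> 'k \<Rightarrow> 'k"
        using add_in_forms[OF mult_in_forms[OF fst_in_forms that(1)] mult_in_forms[OF snd_in_forms that(2)]]
        by simp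
      have "?rep r G (\<lambda>l v. fst v * s l v + snd v * s' l v) (\<lambda>l v. fst v * t l v + snd v * t' l v)"
      proof (intro conjI allI)
        show "(\<lambda>v. fst v * s l v + snd v * s' l v) \<in> forms r" for l
          using st st' comb k by auto
        show "(\<lambda>v. fst v * t l v + snd v * t' l v) \<in> forms (r - 1)" for l
          using st st' comb k by auto
        show "G = (\<lambda>v. (\<Sum>l\<le>i. (fst (P v, Q v) * s l (P v, Q v) + snd (P v, Q v) * s' l (P v, Q v)) * hmon i l v)
          + (\<Sum>l<m - i - 1. (fst (P v, Q v) * t l (P v, Q v) + snd (P v, Q v) * t' l (P v, Q v)) * B l v))"
        proof
          fix v
          have "u v = (\<Sum>l\<le>i. s l (P v, Q v) * hmon i l v) + (\<Sum>l<m - i - 1. t l (P v, Q v) * B l v)"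
            "w v = (\<Sum>l\<le>i. s' l (P v, Q v) * hmon i l v) + (\<Sum>l<m - i - 1. t' l (P v, Q v) * B l v)"
            using st st' by auto
          then show "G v = (\<Sum>l\<le>i. (fst (P v, Q v) * s l (P v, Q v) + snd (P v, Q v) * s' l (P v, Q v)) * hmon i l v)
          + (\<Sum>l<m - i - 1. (fst (P v, Q v) * t l (P v, Q v) + snd (P v, Q v) * t' l (P v, Q v)) * B l v)"
            unfolding uw(3) by (simp add: sum_distrib_left sum.distrib algebra_simps)
        qed
      qed (simp add: k)
      then show ?thesis
        by (rule exI[of _ "\<lambda>l v. fst v * s l v + snd v * s' l v",
            OF exI[of _ "\<lambda>l v. fst v * t l v + snd v * t' l v"]])
    qed
  qed
  then show ?thesis
    using that by blast
qed

text \<open>Splitting \<open>x\<close> off all coefficients turns the relation in degree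
  \<open>r + 1\<close> into \<open>P S + Q ^ r Z = 0\<close>, where \<open>Z\<close> has constant
  coefficients. As \<open>P\<close> is coprime to \<open>Q ^ r\<close>, it divides \<open>Z\<close>,
  and uniqueness for \<open>complement_basis\<close> kills all constants in \<open>Z\<close>. Then
  \<open>S = 0\<close>, which is a relation of the same kind one degree lower.\<close>

lemma free_independence:
  assumes "complement_basis i B" "i < m"
    and "\<And>l. l \<le> i \<Longrightarrow> s l \<in> forms r" "\<And>l. l < m - i - 1 \<Longrightarrow> t l \<in> forms (r - 1)"
    and "\<And>l. l < m - i - 1 \<Longrightarrow> r = 0 \<Longrightarrow> t l = (\<lambda>_. 0)"
    and "\<And>v. (\<Sum>l\<le>i. s l (P v, Q v) * hmon i l v) + (\<Sum>l<m - i - 1. t l (P v, Q v) * B l v) = 0"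
  shows "(\<forall>l\<le>i. s l = (\<lambda>_. 0)) \<and> (\<forall>l<m - i - 1. t l = (\<lambda>_. 0))"
  using assms(3-)
proof (induction r arbitrary: s t)
  case 0
  have "\<exists>c. s l = (\<lambda>_. c)" if "l \<le> i" for l
    using 0(1)[OF that] forms_0E by blast
  then obtain c where c: "\<And>l. l \<le> i \<Longrightarrow> s l = (\<lambda>_. c l)"
    by metis
  have "(\<Sum>l\<le>i. c l * hmon i l v) = 0" for v
    using 0(4)[of v] 0(3) c by simp
  then show ?case
    using hmon_independent[of c i] c 0(3) by simp
next
  case (Suc r)
  have "\<forall>l\<in>{..i}. \<exists>p. fst p \<in> forms r \<and> s l = (\<lambda>v. fst v * fst p v + snd p * snd v ^ Suc r)"
  proof
    fix l assume "l \<in> {..i}"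
    then have "s l \<in> forms (Suc r)"
      using Suc.prems(1) by simp
    then obtain a F' where "F' \<in> forms (Suc r - 1)" "s l = (\<lambda>v. fst v * F' v + a * snd v ^ Suc r)"
      by (rule forms_split)
    then show "\<exists>p. fst p \<in> forms r \<and> s l = (\<lambda>v. fst v * fst p v + snd p * snd v ^ Suc r)"
      by (intro exI[of _ "(F', a)"]) simp
  qed
  from bchoice[OF this] obtain p where
    p: "\<forall>l\<in>{..i}. fst (p l) \<in> forms r \<and> s l = (\<lambda>v. fst v * fst (p l) v + snd (p l) * snd v ^ Suc r)"
    by blast
  define s' a where "s' l = fst (p l)" and "a l = snd (p l)" for l
  have s': "s' l \<in> forms r" "s l = (\<lambda>v. fst v * s' l v + a l * snd v ^ Suc r)" if "l \<le> i" for l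
    using p that by (simp_all add: s'_def a_def)
  have "\<forall>l\<in>{..<m - i - 1}. \<exists>p. fst p \<in> forms (r - 1) \<and> (r = 0 \<longrightarrow> fst p = (\<lambda>_. 0)) \<and>
      t l = (\<lambda>v. fst v * fst p v + snd p * snd v ^ r)"
  proof
    fix l assume "l \<in> {..<m - i - 1}"
    then have "t l \<in> forms r"
      using Suc.prems(2)[of l] by simp
    then obtain a F' where "F' \<in> forms (r - 1)" "r = 0 \<Longrightarrow> F' = (\<lambda>_. 0)"
      "t l = (\<lambda>v. fst v * F' v + a * snd v ^ r)"
      by (rule forms_split) blast
    then show "\<exists>p. fst p \<in> forms (r - 1) \<and> (r = 0 \<longrightarrow> fst p = (\<lambda>_. 0)) \<and>
      t l = (\<lambda>v. fst v * fst p v + snd p * snd v ^ r)"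
      by (intro exI[of _ "(F', a)"]) simp
  qed
  from bchoice[OF this] obtain p' where p': "\<forall>l\<in>{..<m - i - 1}. fst (p' l) \<in> forms (r - 1) \<and>
      (r = 0 \<longrightarrow> fst (p' l) = (\<lambda>_. 0)) \<and> t l = (\<lambda>v. fst v * fst (p' l) v + snd (p' l) * snd v ^ r)"
    by blast
  define t' b where "t' l = fst (p' l)" and "b l = snd (p' l)" for l
  have t': "t' l \<in> forms (r - 1)" "r = 0 \<Longrightarrow> t' l = (\<lambda>_. 0)"
    "t l = (\<lambda>v. fst v * t' l v + b l * snd v ^ r)" if "l < m - i - 1" for l
    using p' that by (simp_all add: t'_def b_def)
  define S where "S = (\<lambda>v. (\<Sum>l\<le>i. s' l (P v, Q v) * hmon i l v) + (\<Sum>l<m - i - 1. t' l (P v, Q v) * B l v))"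
  define A where "A = (\<lambda>v. \<Sum>l\<le>i. a l * hmon i l v)"
  \<comment> \<open>What remains of the relation modulo \<open>P\<close>, after the common factor
    \<open>Q ^ r\<close> is taken out. The extra \<open>Q\<close> at \<open>A\<close> reflects that
    the coefficients \<open>s\<close> have one degree more than the coefficients
    \<open>t\<close>.\<close>
  define Z where "Z = (\<lambda>v. Q v * A v + (\<Sum>l<m - i - 1. b l * B l v))"
  have B: "B l \<in> forms (m + i)" if "l < m - i - 1" for l
    using complement_basis_form[OF assms(1) that] .
  have A_form: "A \<in> forms i"
    unfolding A_def by (intro sum_in_forms cmult_in_forms hmon_in_forms) auto
  have Z_form: "Z \<in> forms (m + i)"
    unfolding Z_def by (intro add_in_forms mult_in_forms Q_form A_form sum_in_forms cmult_in_forms B) auto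
  \<comment> \<open>For positive \<open>r\<close> the degrees are
    \<open>(r - 1) m + (m + i)\<close>; for \<open>r = 0\<close> this count fails, but then
    \<open>t' l\<close> is zero.\<close>
  have "(\<lambda>v. t' l (P v, Q v) * B l v) \<in> forms (r * m + i)" if l: "l < m - i - 1" for l
  proof (cases r)
    case 0
    then show ?thesis using t'(2)[OF l] zero_in_forms by simp
  next
    case (Suc k)
    then show ?thesis
      using mult_in_forms[OF comp_in_forms[OF t'(1)[OF l] P_form Q_form] B[OF l]]
      by (simp add: add_ac)
  qed
  then have S_form: "S \<in> forms (r * m + i)"
    unfolding S_def
    by (intro add_in_forms sum_in_forms mult_in_forms[OF comp_in_forms[OF s'(1) P_form Q_form] hmon_in_forms]) auto
  have rel: "P v * S v + Q v ^ r * Z v = 0" for v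
  proof -
    have "P v * S v + Q v ^ r * Z v
      = (\<Sum>l\<le>i. s l (P v, Q v) * hmon i l v) + (\<Sum>l<m - i - 1. t l (P v, Q v) * B l v)"
      unfolding S_def Z_def A_def
      by (simp add: s'(2) t'(3) sum_distrib_left sum.distrib algebra_simps)
    then show ?thesis
      using Suc.prems(4) by simp
  qed
  have "\<exists>D\<in>forms i. Z = (\<lambda>v. P v * D v)"
  proof (cases "Z = (\<lambda>_. 0)")
    case True
    then show ?thesis using zero_in_forms by force
  next
    case False
    have "P v * - S v = Q v ^ r * Z v" for v
      using rel[of v] by (simp add: minus_unique)
    then show ?thesis
      using forms_coprime_dvd[OF P_form power_in_forms[OF Q_form, of r] minus_in_forms[OF S_form] Z_form _ P_nonzero False]
        no_common_zero by (auto simp: algebra_simps)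
  qed
  then obtain D where D: "D \<in> forms i" "Z = (\<lambda>v. P v * D v)"
    by blast
  have "P v * - D v + Q v * A v + (\<Sum>l<m - i - 1. b l * B l v) = 0" for v
    using fun_cong[OF D(2), of v] unfolding Z_def by (simp add: algebra_simps)
  note AD = complement_basis_independent[OF assms(1) minus_in_forms[OF D(1)] A_form this]
  have a0: "a l = 0" if "l \<le> i" for l
    using hmon_independent[of a i l] fun_cong[OF AD(2)] that unfolding A_def by simp
  have "Z = (\<lambda>_. 0)"
    using AD(2,3) by (simp add: Z_def)
  then have "S = (\<lambda>_. 0)"
    using forms_no_zero_divisors[OF P_form S_form] P_nonzero rel by simp
  then have "(\<forall>l\<le>i. s' l = (\<lambda>_. 0)) \<and> (\<forall>l<m - i - 1. t' l = (\<lambda>_. 0))"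
    using s'(1) t'(1,2) by (intro Suc.IH) (auto simp: S_def fun_eq_iff)
  then show ?case
    using s'(2) t'(3) a0 AD(3) by simp
qed

end

subsection \<open>Points and basic open sets of the projective line\<close>

lemma abs_proj_line_eq_iff:
  assumes "v \<noteq> (0, 0)" "w \<noteq> (0, 0)"
  shows "abs_proj_line v = abs_proj_line w \<longleftrightarrow> (\<exists>c. c \<noteq> 0 \<and> w = (c * fst v, c * snd v))"
proof -
  have "proj_rel v v" "proj_rel w w"
    using assms unfolding proj_rel_def by (auto intro: exI[of _ 1])
  then have "abs_proj_line v = abs_proj_line w \<longleftrightarrow> proj_rel v w"
    using Quotient_rel[OF Quotient_proj_line] by blast
  then show ?thesis
    using assms by (simp add: proj_rel_def prod_eq_iff)
qed

lemma abs_proj_line_cases: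
  obtains v where "v \<noteq> (0, 0)" "p = abs_proj_line v"
  using cone_nonempty[of p] by (auto simp: cone_def)

lemma mem_cone: "v \<in> cone U \<longleftrightarrow> v \<noteq> (0, 0) \<and> abs_proj_line v \<in> U"
  by (simp add: cone_def)

lemma abs_proj_line_eq_iff_lin:
  assumes "v \<noteq> (0, 0)" "w \<noteq> (0, 0)"
  shows "abs_proj_line v = abs_proj_line w \<longleftrightarrow> lin v w = 0"
  using abs_proj_line_eq_iff[OF assms] lin_eq_0_iff[OF assms] by simp

text \<open>The basic open set usually written \<open>D_+(F)\<close>; these sets form a basis of the
  topology by \<open>open_contains_nonvanishing\<close>.\<close>

definition nonvanishing :: "('k::field \<times> 'k \<Rightarrow> 'k) \<Rightarrow> 'k proj_line set"
  where "nonvanishing F = - zero_locus {F}"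

text \<open>\<open>zero_locus\<close> quantifies over all representatives of a point; by homogeneity
  one of them decides.\<close>

lemma mem_nonvanishing:
  assumes "F \<in> forms d" "v \<noteq> (0, 0)"
  shows "abs_proj_line v \<in> nonvanishing F \<longleftrightarrow> F v \<noteq> 0"
proof -
  have "v \<in> cone {abs_proj_line v}"
    using assms(2) by (simp add: mem_cone)
  moreover from this have "F w = 0" if "w \<in> cone {abs_proj_line v}" "F v = 0" for w
    using form_vanishing_representative[OF assms(1) _ that(1) that(2)] by blast
  ultimately show ?thesis
    unfolding nonvanishing_def zero_locus_def by blast
qed

lemma open_nonvanishing:
  assumes "F \<in> forms d"
  shows "open (nonvanishing F)"
  unfolding open_proj_line_def nonvanishing_def using assms by (intro exI[of _ "{F}"]) auto

lemma open_contains_nonvanishing: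
  assumes "open U" "p \<in> U"
  obtains d F where "F \<in> forms d" "p \<in> nonvanishing F" "nonvanishing F \<subseteq> U"
proof -
  obtain T where T: "T \<subseteq> (\<Union>d. forms d)" "- U = zero_locus T"
    using assms(1) unfolding open_proj_line_def by blast
  have "p \<notin> zero_locus T"
    using assms(2) T(2) by blast
  then obtain F where F: "F \<in> T" "p \<in> nonvanishing F"
    unfolding nonvanishing_def zero_locus_def by auto
  moreover have "nonvanishing F \<subseteq> U"
    using F(1) T(2) unfolding nonvanishing_def zero_locus_def by auto
  ultimately show ?thesis
    using that T(1) by blast
qed

text \<open>Density of open sets in algebraic form: for a nonzero form \<open>H\<close> supported in
  \<open>U\<close>, the product \<open>F H\<close> vanishes everywhere, and there are no zero
  divisors.\<close>

lemma form_eq_0_if_vanishes_on_open: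
  fixes F :: "'k::alg_closed_field \<times> 'k \<Rightarrow> 'k"
  assumes "F \<in> forms d" "open U" "U \<noteq> {}" "\<And>v. v \<in> cone U \<Longrightarrow> F v = 0"
  shows "F = (\<lambda>_. 0)"
proof -
  obtain p where "p \<in> U"
    using assms(3) by blast
  with assms(2) obtain e H where H: "H \<in> forms e" "p \<in> nonvanishing H" "nonvanishing H \<subseteq> U"
    by (rule open_contains_nonvanishing)
  have "F v * H v = 0" if "v \<noteq> (0, 0)" for v
    using assms(4)[of v] H(3) mem_nonvanishing[OF H(1) that] that by (auto simp: mem_cone)
  moreover have "H \<noteq> (\<lambda>_. 0)"
    using H(2) by (auto simp: nonvanishing_def zero_locus_def)
  ultimately show ?thesis
    using forms_no_zero_divisors[OF assms(1) H(1)] by blast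
qed

lemma forms_eq_if_eq_on_open:
  fixes F :: "'k::alg_closed_field \<times> 'k \<Rightarrow> 'k"
  assumes "F \<in> forms d" "G \<in> forms d" "open U" "U \<noteq> {}" "\<And>v. v \<in> cone U \<Longrightarrow> F v = G v"
  shows "F = G"
  using form_eq_0_if_vanishes_on_open[OF diff_in_forms[OF assms(1,2)] assms(3,4)] assms(5)
  by (simp add: fun_eq_iff)

lemma nonvanishing_nonempty:
  fixes F :: "'k::alg_closed_field \<times> 'k \<Rightarrow> 'k"
  assumes "F \<in> forms d" "F \<noteq> (\<lambda>_. 0)"
  shows "nonvanishing F \<noteq> {}"
proof -
  obtain t where "F (t, 1) \<noteq> 0"
    using forms_eq_0[OF assms(1)] assms(2) by blast
  then show ?thesis
    using mem_nonvanishing[OF assms(1), of "(t, 1)"] by auto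
qed

text \<open>This is the irreducibility of the line.\<close>

lemma open_Int_nonempty:
  fixes U V :: "'k::alg_closed_field proj_line set"
  assumes "open U" "U \<noteq> {}" "open V" "V \<noteq> {}"
  shows "U \<inter> V \<noteq> {}"
proof -
  obtain p where "p \<in> V"
    using assms(4) by blast
  with assms(3) obtain d F where F: "F \<in> forms d" "p \<in> nonvanishing F" "nonvanishing F \<subseteq> V"
    by (rule open_contains_nonvanishing)
  have "F \<noteq> (\<lambda>_. 0)"
    using F(2) by (auto simp: nonvanishing_def zero_locus_def)
  then obtain v where "v \<in> cone U" "F v \<noteq> 0"
    using form_eq_0_if_vanishes_on_open[OF F(1) assms(1,2)] by blast
  then have "abs_proj_line v \<in> U" "abs_proj_line v \<in> nonvanishing F"
    using mem_nonvanishing[OF F(1), of v] by (simp_all add: mem_cone)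
  then show ?thesis
    using F(3) by blast
qed

subsection \<open>Sections of the twisting sheaves\<close>

lemma twist_sectionsE:
  assumes "s \<in> twist_sections j U" "v \<in> cone U"
  obtains W d e F G where "open W" "abs_proj_line v \<in> W" "W \<subseteq> U" "F \<in> forms d" "G \<in> forms e"
    "int d - int e = j" "\<And>w. w \<in> cone W \<Longrightarrow> G w \<noteq> 0" "\<And>w. w \<in> cone W \<Longrightarrow> s w = F w / G w"
proof -
  have "abs_proj_line v \<in> U"
    using assms(2) by (simp add: mem_cone)
  then obtain W d e F G where "open W" "abs_proj_line v \<in> W" "W \<subseteq> U" "F \<in> forms d" "G \<in> forms e"
    "int d - int e = j" "\<forall>w\<in>cone W. G w \<noteq> 0 \<and> s w = F w / G w"
    using assms(1) unfolding twist_sections_def by auto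
  then show ?thesis
    using that by blast
qed

lemma twist_sectionsI:
  assumes "s \<in> extensional (cone U)"
    and "\<And>v. v \<in> cone U \<Longrightarrow> \<exists>W d e F G. open W \<and> abs_proj_line v \<in> W \<and> W \<subseteq> U \<and>
      F \<in> forms d \<and> G \<in> forms e \<and> int d - int e = j \<and> (\<forall>w\<in>cone W. G w \<noteq> 0 \<and> s w = F w / G w)"
  shows "s \<in> twist_sections j U"
proof -
  have "\<exists>W d e F G. open W \<and> p \<in> W \<and> W \<subseteq> U \<and>
      F \<in> forms d \<and> G \<in> forms e \<and> int d - int e = j \<and> (\<forall>w\<in>cone W. G w \<noteq> 0 \<and> s w = F w / G w)"
    if "p \<in> U" for p
  proof -
    obtain v where "v \<noteq> (0, 0)" "p = abs_proj_line v"
      by (rule abs_proj_line_cases)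
    then show ?thesis
      using assms(2)[of v] that by (simp add: mem_cone)
  qed
  then show ?thesis
    using assms(1) unfolding twist_sections_def by blast
qed

lemma fraction_in_twist_sections:
  assumes "open U" "F \<in> forms d" "G \<in> forms e" "int d - int e = j" "\<And>v. v \<in> cone U \<Longrightarrow> G v \<noteq> 0"
  shows "(\<lambda>v\<in>cone U. F v / G v) \<in> twist_sections j U"
proof (rule twist_sectionsI)
  fix v assume "v \<in> cone U"
  then show "\<exists>W d e F' G'. open W \<and> abs_proj_line v \<in> W \<and> W \<subseteq> U \<and> F' \<in> forms d \<and> G' \<in> forms e \<and>
      int d - int e = j \<and> (\<forall>w\<in>cone W. G' w \<noteq> 0 \<and> (\<lambda>v\<in>cone U. F v / G v) w = F' w / G' w)"
    using assms by (intro exI[of _ U] exI[of _ d] exI[of _ e] exI[of _ F] exI[of _ G]) (auto simp: mem_cone)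
qed simp

lemma form_in_twist_sections:
  assumes "open U" "F \<in> forms d"
  shows "restrict F (cone U) \<in> twist_sections (int d) U"
  using fraction_in_twist_sections[OF assms const_in_forms[of 1]] by simp

lemma restrict_in_twist_sections:
  assumes "s \<in> twist_sections j U" "open V" "V \<subseteq> U"
  shows "restrict s (cone V) \<in> twist_sections j V"
proof (rule twist_sectionsI)
  fix v assume v: "v \<in> cone V"
  then have "v \<in> cone U"
    using assms(3) by (auto simp: mem_cone)
  with assms(1) obtain W d e F G where loc: "open W" "abs_proj_line v \<in> W" "W \<subseteq> U" "F \<in> forms d" "G \<in> forms e"
    "int d - int e = j" "\<And>w. w \<in> cone W \<Longrightarrow> G w \<noteq> 0" "\<And>w. w \<in> cone W \<Longrightarrow> s w = F w / G w"
    by (rule twist_sectionsE) blast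
  then show "\<exists>W d e F G. open W \<and> abs_proj_line v \<in> W \<and> W \<subseteq> V \<and> F \<in> forms d \<and> G \<in> forms e \<and>
      int d - int e = j \<and> (\<forall>w\<in>cone W. G w \<noteq> 0 \<and> restrict s (cone V) w = F w / G w)"
    using assms(2) v
    by (intro exI[of _ "W \<inter> V"] exI[of _ d] exI[of _ e] exI[of _ F] exI[of _ G])
      (auto simp: mem_cone)
qed simp

lemma add_in_twist_sections:
  assumes "s \<in> twist_sections j U" "t \<in> twist_sections j U"
  shows "(\<lambda>v\<in>cone U. s v + t v) \<in> twist_sections j U"
proof (rule twist_sectionsI)
  fix v assume v: "v \<in> cone U"
  obtain W d e F G where loc: "open W" "abs_proj_line v \<in> W" "W \<subseteq> U" "F \<in> forms d" "G \<in> forms e"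
    "int d - int e = j" "\<And>w. w \<in> cone W \<Longrightarrow> G w \<noteq> 0" "\<And>w. w \<in> cone W \<Longrightarrow> s w = F w / G w"
    using assms(1) v by (rule twist_sectionsE) blast
  obtain W' d' e' F' G' where loc': "open W'" "abs_proj_line v \<in> W'" "W' \<subseteq> U" "F' \<in> forms d'" "G' \<in> forms e'"
    "int d' - int e' = j" "\<And>w. w \<in> cone W' \<Longrightarrow> G' w \<noteq> 0" "\<And>w. w \<in> cone W' \<Longrightarrow> t w = F' w / G' w"
    using assms(2) v by (rule twist_sectionsE) blast
  \<comment> \<open>Both fractions have degree \<open>j\<close>, so the two cross products have
    equal degree and their sum is again a form.\<close>
  have "e + d' = d + e'"
    using loc(6) loc'(6) by linarith
  then have "(\<lambda>w. F w * G' w + G w * F' w) \<in> forms (d + e')"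
    using add_in_forms[OF mult_in_forms[OF loc(4) loc'(5)]] mult_in_forms[OF loc(5) loc'(4)] by metis
  moreover have "int (d + e') - int (e + e') = j"
    using loc(6) by simp
  moreover have "\<forall>w\<in>cone (W \<inter> W'). G w * G' w \<noteq> 0 \<and>
      (\<lambda>v\<in>cone U. s v + t v) w = (F w * G' w + G w * F' w) / (G w * G' w)"
  proof
    fix w assume "w \<in> cone (W \<inter> W')"
    then have "w \<in> cone W" "w \<in> cone W'" "w \<in> cone U"
      using loc(3) by (auto simp: mem_cone)
    then show "G w * G' w \<noteq> 0 \<and>
      (\<lambda>v\<in>cone U. s v + t v) w = (F w * G' w + G w * F' w) / (G w * G' w)"
      using loc(7,8)[of w] loc'(7,8)[of w] by (simp add: field_simps)
  qed
  moreover have "open (W \<inter> W')" "abs_proj_line v \<in> W \<inter> W'" "W \<inter> W' \<subseteq> U"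
    using loc loc' by auto
  ultimately show "\<exists>W d e F G. open W \<and> abs_proj_line v \<in> W \<and> W \<subseteq> U \<and> F \<in> forms d \<and> G \<in> forms e \<and>
      int d - int e = j \<and> (\<forall>w\<in>cone W. G w \<noteq> 0 \<and> (\<lambda>v\<in>cone U. s v + t v) w = F w / G w)"
    using mult_in_forms[OF loc(5) loc'(5)]
    by - (rule exI[of _ "W \<inter> W'"], rule exI[of _ "d + e'"], rule exI[of _ "e + e'"],
        rule exI[of _ "\<lambda>w. F w * G' w + G w * F' w"], rule exI[of _ "\<lambda>w. G w * G' w"], intro conjI)
qed simp

lemma mult_in_twist_sections:
  assumes "s \<in> twist_sections j U" "t \<in> twist_sections j' U"
  shows "(\<lambda>v\<in>cone U. s v * t v) \<in> twist_sections (j + j') U"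
proof (rule twist_sectionsI)
  fix v assume v: "v \<in> cone U"
  obtain W d e F G where loc: "open W" "abs_proj_line v \<in> W" "W \<subseteq> U" "F \<in> forms d" "G \<in> forms e"
    "int d - int e = j" "\<And>w. w \<in> cone W \<Longrightarrow> G w \<noteq> 0" "\<And>w. w \<in> cone W \<Longrightarrow> s w = F w / G w"
    using assms(1) v by (rule twist_sectionsE) blast
  obtain W' d' e' F' G' where loc': "open W'" "abs_proj_line v \<in> W'" "W' \<subseteq> U" "F' \<in> forms d'" "G' \<in> forms e'"
    "int d' - int e' = j'" "\<And>w. w \<in> cone W' \<Longrightarrow> G' w \<noteq> 0" "\<And>w. w \<in> cone W' \<Longrightarrow> t w = F' w / G' w"
    using assms(2) v by (rule twist_sectionsE) blast
  have "int (d + d') - int (e + e') = j + j'"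
    using loc(6) loc'(6) by simp
  moreover have "\<forall>w\<in>cone (W \<inter> W'). G w * G' w \<noteq> 0 \<and>
      (\<lambda>v\<in>cone U. s v * t v) w = (F w * F' w) / (G w * G' w)"
  proof
    fix w assume "w \<in> cone (W \<inter> W')"
    then have "w \<in> cone W" "w \<in> cone W'" "w \<in> cone U"
      using loc(3) by (auto simp: mem_cone)
    then show "G w * G' w \<noteq> 0 \<and> (\<lambda>v\<in>cone U. s v * t v) w = (F w * F' w) / (G w * G' w)"
      using loc(7,8)[of w] loc'(7,8)[of w] by simp
  qed
  moreover have "open (W \<inter> W')" "abs_proj_line v \<in> W \<inter> W'" "W \<inter> W' \<subseteq> U"
    using loc loc' by auto
  ultimately show "\<exists>W d e F G. open W \<and> abs_proj_line v \<in> W \<and> W \<subseteq> U \<and> F \<in> forms d \<and> G \<in> forms e \<and>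
      int d - int e = j + j' \<and> (\<forall>w\<in>cone W. G w \<noteq> 0 \<and> (\<lambda>v\<in>cone U. s v * t v) w = F w / G w)"
    using mult_in_forms[OF loc(4) loc'(4)] mult_in_forms[OF loc(5) loc'(5)]
    by - (rule exI[of _ "W \<inter> W'"], rule exI[of _ "d + d'"], rule exI[of _ "e + e'"],
        rule exI[of _ "\<lambda>w. F w * F' w"], rule exI[of _ "\<lambda>w. G w * G' w"], intro conjI)
qed simp

text \<open>Even the zero section must be written as a fraction of degree \<open>j\<close>. For
  negative \<open>j\<close> its denominator has positive degree and therefore zeros, so it has to be
  chosen locally.\<close>

lemma zero_in_twist_sections:
  assumes "open U"
  shows "(\<lambda>v\<in>cone U. 0) \<in> twist_sections j U"
proof (rule twist_sectionsI)
  fix v :: "'a \<times> 'a" assume v: "v \<in> cone U"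
  then have "v \<noteq> (0, 0)"
    by (simp add: mem_cone)
  \<comment> \<open>The degrees \<open>nat j\<close> and \<open>nat (- j)\<close> differ by
    \<open>j\<close>, and one of them is 0.\<close>
  then obtain G where G: "G \<in> forms (nat (- j))" "G v = 1"
    by (rule forms_interpolate)
  have "abs_proj_line v \<in> U \<inter> nonvanishing G"
    using v G mem_nonvanishing[OF G(1)] by (simp add: mem_cone)
  moreover have "\<forall>w\<in>cone (U \<inter> nonvanishing G). G w \<noteq> 0 \<and> (\<lambda>v\<in>cone U. 0) w = 0 / G w"
    using mem_nonvanishing[OF G(1)] by (auto simp: mem_cone)
  ultimately show "\<exists>W d e F G. open W \<and> abs_proj_line v \<in> W \<and> W \<subseteq> U \<and> F \<in> forms d \<and> G \<in> forms e \<and>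
      int d - int e = j \<and> (\<forall>w\<in>cone W. G w \<noteq> 0 \<and> (\<lambda>v\<in>cone U. 0) w = F w / G w)"
    using assms open_nonvanishing[OF G(1)] G(1) zero_in_forms[of "nat j"]
    by (intro exI[of _ "U \<inter> nonvanishing G"] exI[of _ "nat j"] exI[of _ "nat (- j)"]
        exI[of _ "\<lambda>_. 0"] exI[of _ G]) auto
qed simp

lemma sum_in_twist_sections:
  assumes "open U" "\<And>l. l \<in> I \<Longrightarrow> s l \<in> twist_sections j U"
  shows "(\<lambda>v\<in>cone U. \<Sum>l\<in>I. s l v) \<in> twist_sections j U"
  using assms(2)
proof (induction I rule: infinite_finite_induct)
  case (insert x I)
  have eq: "(\<lambda>v\<in>cone U. \<Sum>l\<in>insert x I. s l v) = (\<lambda>v\<in>cone U. s x v + (\<lambda>v\<in>cone U. \<Sum>l\<in>I. s l v) v)"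
    using insert.hyps by (auto simp: restrict_def)
  show ?case
    unfolding eq by (rule add_in_twist_sections) (use insert.IH insert.prems in auto)
qed (use zero_in_twist_sections[OF assms(1)] in simp_all)

lemma regular_function_in_twist_sections:
  assumes "g \<in> regular_functions U"
  shows "(\<lambda>v\<in>cone U. g (abs_proj_line v)) \<in> twist_sections 0 U"
proof (rule twist_sectionsI)
  fix v assume v: "v \<in> cone U"
  then have "abs_proj_line v \<in> U"
    by (simp add: mem_cone)
  then obtain W d F G where loc: "open W" "abs_proj_line v \<in> W" "W \<subseteq> U" "F \<in> forms d" "G \<in> forms d"
    "\<forall>w\<in>cone W. G w \<noteq> 0 \<and> g (abs_proj_line w) = F w / G w"
    using assms unfolding regular_functions_def by auto
  then show "\<exists>W d e F G. open W \<and> abs_proj_line v \<in> W \<and> W \<subseteq> U \<and> F \<in> forms d \<and> G \<in> forms e \<and>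
      int d - int e = 0 \<and> (\<forall>w\<in>cone W. G w \<noteq> 0 \<and> (\<lambda>v\<in>cone U. g (abs_proj_line v)) w = F w / G w)"
    by (intro exI[of _ W] exI[of _ d] exI[of _ F] exI[of _ G]) (auto simp: mem_cone)
qed simp

text \<open>Among all fractions that represent \<open>s\<close> generically, one with a denominator of least degree is
  in lowest terms, and therefore represents \<open>s\<close> everywhere.\<close>

lemma twist_section_eq_fraction:
  fixes s :: "'k::alg_closed_field \<times> 'k \<Rightarrow> 'k"
  assumes "U \<noteq> {}" "s \<in> twist_sections j U" "\<exists>v\<in>cone U. s v \<noteq> 0"
  obtains d e F G where "F \<in> forms d" "G \<in> forms e" "int d - int e = j" "F \<noteq> (\<lambda>_. 0)"
    "\<And>v. v \<noteq> (0, 0) \<Longrightarrow> F v = 0 \<Longrightarrow> G v \<noteq> 0"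
    "\<And>v. v \<in> cone U \<Longrightarrow> G v \<noteq> 0" "\<And>v. v \<in> cone U \<Longrightarrow> s v = F v / G v"
proof -
  obtain v0 where v0: "v0 \<in> cone U" "s v0 \<noteq> 0"
    using assms(3) by blast
  obtain W0 d0 e0 F0 G0 where 0: "open W0" "abs_proj_line v0 \<in> W0" "W0 \<subseteq> U" "F0 \<in> forms d0" "G0 \<in> forms e0"
    "int d0 - int e0 = j" "\<And>w. w \<in> cone W0 \<Longrightarrow> G0 w \<noteq> 0" "\<And>w. w \<in> cone W0 \<Longrightarrow> s w = F0 w / G0 w"
    using assms(2) v0(1) by (rule twist_sectionsE) blast
  have v0W: "v0 \<in> cone W0"
    using v0(1) 0(2) by (simp add: mem_cone)
  have G0: "G0 \<noteq> (\<lambda>_. 0)"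
    using 0(7)[OF v0W] by auto
  have F0: "F0 \<noteq> (\<lambda>_. 0)"
    using 0(8)[OF v0W] v0(2) by auto
  \<comment> \<open>The condition \<open>F G0 = F0 G\<close> on all vectors says that
    \<open>F / G\<close> and \<open>F0 / G0\<close> agree generically. Only one local representation
    of \<open>s\<close> enters the minimization.\<close>
  let ?Q = "\<lambda>e. \<exists>d F G. F \<in> forms d \<and> G \<in> forms e \<and> int d - int e = j \<and> F \<noteq> (\<lambda>_. 0) \<and> G \<noteq> (\<lambda>_. 0) \<and>
    (\<forall>v. F v * G0 v = F0 v * G v)"
  define e where "e = (LEAST e. ?Q e)"
  have "?Q e0"
    using 0(4-6) F0 G0 by - (rule exI[of _ d0], rule exI[of _ F0], rule exI[of _ G0], simp)
  then have "?Q e"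
    unfolding e_def by (rule LeastI)
  then obtain d F G where FG: "F \<in> forms d" "G \<in> forms e" "int d - int e = j" "F \<noteq> (\<lambda>_. 0)"
    "G \<noteq> (\<lambda>_. 0)" "\<And>v. F v * G0 v = F0 v * G v"
    by blast
  \<comment> \<open>A common zero would let its linear factor be cancelled, leaving a denominator of
    smaller degree.\<close>
  have coprime: "G v \<noteq> 0" if v: "v \<noteq> (0, 0)" "F v = 0" for v
  proof
    assume "G v = 0"
    obtain d' F' where F': "d = Suc d'" "F' \<in> forms d'" "F = (\<lambda>w. lin v w * F' w)"
      using forms_factor[OF FG(1) v FG(4)] by blast
    obtain e' G' where G': "e = Suc e'" "G' \<in> forms e'" "G = (\<lambda>w. lin v w * G' w)"
      using forms_factor[OF FG(2) v(1) \<open>G v = 0\<close> FG(5)] by blast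
    have deg: "d' + e0 = d0 + e'"
      using FG(3) 0(6) F'(1) G'(1) by linarith
    have "(\<lambda>w. F' w * G0 w) = (\<lambda>w. F0 w * G' w)"
    proof (rule forms_cancel[OF lin_in_forms mult_in_forms[OF F'(2) 0(5)] _ lin_nonzero[OF v(1)]])
      show "(\<lambda>w. F0 w * G' w) \<in> forms (d' + e0)"
        unfolding deg by (rule mult_in_forms[OF 0(4) G'(2)])
      show "lin v w * (F' w * G0 w) = lin v w * (F0 w * G' w)" for w
        using FG(6)[of w] unfolding F'(3) G'(3) by (simp add: mult_ac)
    qed
    then have "\<forall>w. F' w * G0 w = F0 w * G' w"
      by (simp add: fun_eq_iff)
    moreover have "F' \<noteq> (\<lambda>_. 0)" "G' \<noteq> (\<lambda>_. 0)"
      using FG(4,5) F'(3) G'(3) by auto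
    moreover have "int d' - int e' = j"
      using FG(3) F'(1) G'(1) by simp
    ultimately have "?Q e'"
      using F'(2) G'(2) by blast
    then have "e \<le> e'"
      unfolding e_def by (rule Least_le)
    then show False
      using G'(1) by simp
  qed
  \<comment> \<open>Near any point of \<open>U\<close> a local fraction \<open>F1 / G1\<close>
    agrees with \<open>F / G\<close> on a nonempty open set, so \<open>F G1 = F1 G\<close> as
    forms.\<close>
  have "G v \<noteq> 0 \<and> s v = F v / G v" if v: "v \<in> cone U" for v
  proof -
    obtain W d1 e1 F1 G1 where 1: "open W" "abs_proj_line v \<in> W" "W \<subseteq> U" "F1 \<in> forms d1" "G1 \<in> forms e1"
      "int d1 - int e1 = j" "\<And>w. w \<in> cone W \<Longrightarrow> G1 w \<noteq> 0" "\<And>w. w \<in> cone W \<Longrightarrow> s w = F1 w / G1 w"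
      using assms(2) v by (rule twist_sectionsE) blast
    have "F w * G1 w = F1 w * G w" if w: "w \<in> cone (W \<inter> W0)" for w
    proof -
      have "w \<in> cone W" "w \<in> cone W0"
        using w by (auto simp: mem_cone)
      then have nz: "G0 w \<noteq> 0" and "F0 w * G1 w = F1 w * G0 w"
        using 1(7,8)[of w] 0(7,8)[of w] by (auto simp: frac_eq_eq)
      then have "G0 w * (F w * G1 w) = G0 w * (F1 w * G w)"
        using FG(6)[of w] by (metis mult.assoc mult.commute)
      then show ?thesis
        using nz by simp
    qed
    moreover have "open (W \<inter> W0)" "W \<inter> W0 \<noteq> {}"
      using 0(1,2) 1(1,2) open_Int_nonempty[of W W0] by auto
    moreover have "(\<lambda>w. F1 w * G w) \<in> forms (d + e1)"
    proof -
      have "d1 + e = d + e1"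
        using 1(6) FG(3) by linarith
      then show ?thesis
        using mult_in_forms[OF 1(4) FG(2)] by simp
    qed
    ultimately have "(\<lambda>w. F w * G1 w) = (\<lambda>w. F1 w * G w)"
      using forms_eq_if_eq_on_open[OF mult_in_forms[OF FG(1) 1(5)]] by blast
    then have eq: "F v * G1 v = F1 v * G v"
      by (rule fun_cong)
    have "v \<in> cone W" "v \<noteq> (0, 0)"
      using v 1(2) by (auto simp: mem_cone)
    then have "G1 v \<noteq> 0" "s v = F1 v / G1 v" "F v = 0 \<Longrightarrow> G v \<noteq> 0"
      using 1(7,8) coprime by auto
    \<comment> \<open>If \<open>G v\<close> were 0, then so would be \<open>F v G1 v\<close> and
      hence \<open>F v\<close>, against coprimality.\<close>
    moreover from this eq have "G v \<noteq> 0"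
      by auto
    ultimately show ?thesis
      using eq by (simp add: frac_eq_eq)
  qed
  then show ?thesis
    using that[OF FG(1-4) coprime] by blast
qed

subsection \<open>Regular functions and morphisms\<close>

text \<open>The choice of a representative is immaterial when numerator and denominator have the
  same degree; this is \<open>ratio_abs\<close>.\<close>

definition ratio :: "('k::field \<times> 'k \<Rightarrow> 'k) \<Rightarrow> ('k \<times> 'k \<Rightarrow> 'k) \<Rightarrow> 'k proj_line \<Rightarrow> 'k"
  where "ratio F G p = (let v = SOME v. v \<in> cone {p} in F v / G v)"

lemma ratio_abs:
  assumes "F \<in> forms d" "G \<in> forms d" "v \<noteq> (0, 0)"
  shows "ratio F G (abs_proj_line v) = F v / G v"
proof -
  define w where "w = (SOME w. w \<in> cone {abs_proj_line v})"
  have "w \<in> cone {abs_proj_line v}"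
    unfolding w_def using cone_nonempty by (rule someI_ex)
  then have "w \<noteq> (0, 0)" "abs_proj_line v = abs_proj_line w"
    by (auto simp: mem_cone)
  then obtain c where c: "c \<noteq> 0" "w = (c * fst v, c * snd v)"
    using abs_proj_line_eq_iff[OF assms(3)] by blast
  have "F w = c ^ d * F v" "G w = c ^ d * G v"
    using forms_homogeneous[OF assms(1), of c "fst v" "snd v"]
      forms_homogeneous[OF assms(2), of c "fst v" "snd v"] c(2) by simp_all
  then show ?thesis
    using c(1) by (simp add: ratio_def Let_def flip: w_def)
qed

lemma ratio_regular:
  assumes "F \<in> forms d" "G \<in> forms d" "open U" "U \<subseteq> nonvanishing G"
  shows "restrict (ratio F G) U \<in> regular_functions U"
proof -
  have "\<exists>W d F' G'. open W \<and> p \<in> W \<and> W \<subseteq> U \<and> F' \<in> forms d \<and> G' \<in> forms d \<and>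
      (\<forall>v\<in>cone W. G' v \<noteq> 0 \<and> restrict (ratio F G) U (abs_proj_line v) = F' v / G' v)" if "p \<in> U" for p
    using assms that mem_nonvanishing[OF assms(2)] ratio_abs[OF assms(1,2)]
    by (intro exI[of _ U] exI[of _ d] exI[of _ F] exI[of _ G]) (auto simp: mem_cone)
  then show ?thesis
    unfolding regular_functions_def by auto
qed

text \<open>Regular functions are the sections of twist 0, so lowest terms give a single ratio on
  the whole open set.\<close>

lemma regular_function_eq_ratio:
  fixes g :: "'k::alg_closed_field proj_line \<Rightarrow> 'k"
  assumes "U \<noteq> {}" "g \<in> regular_functions U" "\<exists>p\<in>U. g p \<noteq> 0"
  obtains d F G where "F \<in> forms d" "G \<in> forms d" "F \<noteq> (\<lambda>_. 0)"
    "\<And>v. v \<noteq> (0, 0) \<Longrightarrow> F v = 0 \<Longrightarrow> G v \<noteq> 0"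
    "\<And>v. v \<in> cone U \<Longrightarrow> G v \<noteq> 0" "\<And>v. v \<in> cone U \<Longrightarrow> g (abs_proj_line v) = F v / G v"
proof -
  let ?s = "\<lambda>v\<in>cone U. g (abs_proj_line v)"
  obtain p where p: "p \<in> U" "g p \<noteq> 0"
    using assms(3) by blast
  obtain v where "v \<noteq> (0, 0)" "p = abs_proj_line v"
    by (rule abs_proj_line_cases)
  then have "v \<in> cone U" "?s v \<noteq> 0"
    using p by (simp_all add: mem_cone)
  then have "\<exists>v\<in>cone U. ?s v \<noteq> 0"
    by blast
  with assms(1) regular_function_in_twist_sections[OF assms(2)]
  obtain d e F G where FG: "F \<in> forms d" "G \<in> forms e" "int d - int e = 0" "F \<noteq> (\<lambda>_. 0)"
    "\<And>v. v \<noteq> (0, 0) \<Longrightarrow> F v = 0 \<Longrightarrow> G v \<noteq> 0"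
    "\<And>v. v \<in> cone U \<Longrightarrow> G v \<noteq> 0" "\<And>v. v \<in> cone U \<Longrightarrow> ?s v = F v / G v"
    by (rule twist_section_eq_fraction) blast
  show ?thesis
  proof (rule that[OF FG(1) _ FG(4,5,6)])
    show "G \<in> forms d"
      using FG(2,3) by simp
    show "g (abs_proj_line v) = F v / G v" if "v \<in> cone U" for v
      using FG(7)[OF that] that by simp
  qed
qed

section \<open>Surjective morphisms as pairs of forms\<close>

locale projective_map = coprime_forms +
  fixes f :: "'a proj_line \<Rightarrow> 'a proj_line"
  assumes morphism: "variety_morphism f" and surjective: "surj f"
    and f_abs: "\<And>v. v \<noteq> (0, 0) \<Longrightarrow> f (abs_proj_line v) = abs_proj_line (P v, Q v)"

lemma variety_morphism_open_vimage:
  assumes "variety_morphism f" "open V"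
  shows "open (f -` V)"
  using assms unfolding variety_morphism_def by (metis open_vimage)

text \<open>The coordinate \<open>X / Y\<close> is regular on the chart \<open>Y \<noteq> 0\<close>,
  so its pullback is a ratio in lowest terms. Surjectivity supplies a point over the class of
  \<open>(1, 1)\<close>; there the pullback is defined and has the value 1, so it is not the zero
  function, for which no lowest terms are available. The lemma serves both affine charts.\<close>

lemma morphism_chart:
  fixes f :: "'k::alg_closed_field proj_line \<Rightarrow> 'k proj_line"
  assumes "variety_morphism f" "surj f" "X \<in> forms 1" "Y \<in> forms 1" "X (1, 1) = 1" "Y (1, 1) = 1"
  obtains d P Q where "P \<in> forms d" "Q \<in> forms d" "P \<noteq> (\<lambda>_. 0)"
    "\<And>v. v \<noteq> (0, 0) \<Longrightarrow> P v = 0 \<Longrightarrow> Q v \<noteq> 0"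
    "\<And>v w. v \<noteq> (0, 0) \<Longrightarrow> w \<noteq> (0, 0) \<Longrightarrow> f (abs_proj_line v) = abs_proj_line w \<Longrightarrow> Y w \<noteq> 0 \<Longrightarrow>
      Q v \<noteq> 0 \<and> X w / Y w = P v / Q v"
proof -
  let ?V = "nonvanishing Y"
  let ?g = "restrict (ratio X Y) ?V"
  have V: "open ?V"
    by (rule open_nonvanishing[OF assms(4)])
  have "?g \<in> regular_functions ?V"
    by (rule ratio_regular[OF assms(3,4) V subset_refl])
  then have reg: "pullback f ?V ?g \<in> regular_functions (f -` ?V)"
    using assms(1) V unfolding variety_morphism_def by blast
  obtain p where p: "f p = abs_proj_line (1, 1)"
    using assms(2) by (metis surjD)
  then have "p \<in> f -` ?V" "pullback f ?V ?g p = 1"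
    using mem_nonvanishing[OF assms(4), of "(1, 1)"] ratio_abs[OF assms(3,4), of "(1, 1)"] assms(5,6)
    by (simp_all add: pullback_def)
  then have "f -` ?V \<noteq> {}" and nz: "\<exists>p\<in>f -` ?V. pullback f ?V ?g p \<noteq> 0"
    by (auto intro: bexI[of _ p])
  from this(1) reg nz obtain d P Q where PQ: "P \<in> forms d" "Q \<in> forms d" "P \<noteq> (\<lambda>_. 0)"
    "\<And>v. v \<noteq> (0, 0) \<Longrightarrow> P v = 0 \<Longrightarrow> Q v \<noteq> 0" "\<And>v. v \<in> cone (f -` ?V) \<Longrightarrow> Q v \<noteq> 0"
    "\<And>v. v \<in> cone (f -` ?V) \<Longrightarrow> pullback f ?V ?g (abs_proj_line v) = P v / Q v"
    by (rule regular_function_eq_ratio) blast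
  show ?thesis
  proof (rule that[OF PQ(1-4)])
    fix v w :: "'k \<times> 'k"
    assume vw: "v \<noteq> (0, 0)" "w \<noteq> (0, 0)" "f (abs_proj_line v) = abs_proj_line w" "Y w \<noteq> 0"
    then have "v \<in> cone (f -` ?V)" "pullback f ?V ?g (abs_proj_line v) = X w / Y w"
      using mem_nonvanishing[OF assms(4), of w] ratio_abs[OF assms(3,4), of w]
      by (simp_all add: mem_cone pullback_def)
    then show "Q v \<noteq> 0 \<and> X w / Y w = P v / Q v"
      using PQ(5,6) by metis
  qed
qed

text \<open>The chart \<open>y \<noteq> 0\<close> gives \<open>f = [P : Q]\<close>, and the chart
  \<open>x \<noteq> 0\<close> gives \<open>f = [Q' : P']\<close>. On the overlap
  \<open>P P' = Q Q'\<close>, and by density everywhere. Over the point \<open>(1, 0)\<close>, which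
  the first chart misses, \<open>P'\<close> vanishes and \<open>Q'\<close> does not, so this
  identity forces \<open>Q\<close> to vanish there too.\<close>

lemma morphism_eq_projective_map:
  fixes f :: "'k::alg_closed_field proj_line \<Rightarrow> 'k proj_line"
  assumes "variety_morphism f" "surj f"
  obtains P Q m where "projective_map P Q m f"
proof -
  have "fst (1, 1) = (1 :: 'k)" "snd (1, 1) = (1 :: 'k)"
    by simp_all
  with assms fst_in_forms snd_in_forms
  obtain m P Q where PQ: "P \<in> forms m" "Q \<in> forms m" "P \<noteq> (\<lambda>_. 0)"
    "\<And>v. v \<noteq> (0, 0) \<Longrightarrow> P v = 0 \<Longrightarrow> Q v \<noteq> 0"
    "\<And>v w. v \<noteq> (0, 0) \<Longrightarrow> w \<noteq> (0, 0) \<Longrightarrow> f (abs_proj_line v) = abs_proj_line w \<Longrightarrow> snd w \<noteq> 0 \<Longrightarrow>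
      Q v \<noteq> 0 \<and> fst w / snd w = P v / Q v"
    by (rule morphism_chart) blast
  have "snd (1, 1) = (1 :: 'k)" "fst (1, 1) = (1 :: 'k)"
    by simp_all
  with assms snd_in_forms fst_in_forms
  obtain m' P' Q' where PQ': "P' \<in> forms m'" "Q' \<in> forms m'" "P' \<noteq> (\<lambda>_. 0)"
    "\<And>v. v \<noteq> (0, 0) \<Longrightarrow> P' v = 0 \<Longrightarrow> Q' v \<noteq> 0"
    "\<And>v w. v \<noteq> (0, 0) \<Longrightarrow> w \<noteq> (0, 0) \<Longrightarrow> f (abs_proj_line v) = abs_proj_line w \<Longrightarrow> fst w \<noteq> 0 \<Longrightarrow>
      Q' v \<noteq> 0 \<and> snd w / fst w = P' v / Q' v"
    by (rule morphism_chart) blast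
  have cocycle: "P v * P' v = Q v * Q' v" for v
  proof -
    let ?U = "f -` (nonvanishing fst \<inter> nonvanishing snd)"
    have "open ?U"
      using variety_morphism_open_vimage[OF assms(1)] open_nonvanishing[OF fst_in_forms]
        open_nonvanishing[OF snd_in_forms] by blast
    moreover have "?U \<noteq> {}"
    proof -
      obtain p where "f p = abs_proj_line (1, 1)"
        using assms(2) by (metis surjD)
      then have "p \<in> ?U"
        using mem_nonvanishing[OF fst_in_forms, of "(1, 1 :: 'k)"]
          mem_nonvanishing[OF snd_in_forms, of "(1, 1 :: 'k)"] by simp
      then show ?thesis by blast
    qed
    moreover have "P v * P' v = Q v * Q' v" if "v \<in> cone ?U" for v
    proof -
      obtain w where w: "w \<noteq> (0, 0)" "f (abs_proj_line v) = abs_proj_line w"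
        by (rule abs_proj_line_cases)
      have "v \<noteq> (0, 0)" "fst w \<noteq> 0" "snd w \<noteq> 0"
        using that w mem_nonvanishing[OF fst_in_forms w(1)] mem_nonvanishing[OF snd_in_forms w(1)]
        by (auto simp: mem_cone)
      with w PQ(5)[of v w] PQ'(5)[of v w] have "Q v \<noteq> 0" "Q' v \<noteq> 0"
        "P v / Q v * (P' v / Q' v) = fst w / snd w * (snd w / fst w)"
        by auto
      then show ?thesis
        using \<open>fst w \<noteq> 0\<close> \<open>snd w \<noteq> 0\<close> by (simp add: field_simps)
    qed
    ultimately have "(\<lambda>v. P v * P' v) = (\<lambda>v. Q v * Q' v)"
      using forms_eq_if_eq_on_open[OF mult_in_forms[OF PQ(1) PQ'(1)] mult_in_forms[OF PQ(2) PQ'(2)]]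
      by blast
    then show ?thesis
      by (rule fun_cong)
  qed
  have f_abs: "f (abs_proj_line v) = abs_proj_line (P v, Q v)" if v: "v \<noteq> (0, 0)" for v
  proof -
    obtain w where w: "w \<noteq> (0, 0)" "f (abs_proj_line v) = abs_proj_line w"
      by (rule abs_proj_line_cases)
    have PQv: "(P v, Q v) \<noteq> (0, 0)"
      using PQ(4)[OF v] by auto
    have "lin w (P v, Q v) = 0"
    proof (cases "snd w = 0")
      case True
      then have "fst w \<noteq> 0"
        using w(1) by (metis prod.collapse)
      then have "Q' v \<noteq> 0" "P' v = 0"
        using PQ'(5)[OF v w] True by auto
      then have "Q v = 0"
        using cocycle[of v] by simp
      then show ?thesis
        using True by (simp add: lin_def)
    next
      case False
      then have "Q v \<noteq> 0" "fst w / snd w = P v / Q v"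
        using PQ(5)[OF v w] by auto
      then show ?thesis
        using False by (simp add: lin_def field_simps)
    qed
    then show ?thesis
      using abs_proj_line_eq_iff_lin[OF w(1) PQv] w(2) by simp
  qed
  \<comment> \<open>In degree 0 the pair is constant, and so would be \<open>f\<close>, against
    surjectivity.\<close>
  have "0 < m"
  proof (rule ccontr)
    assume "\<not> 0 < m"
    then obtain a b where ab: "P = (\<lambda>_. a)" "Q = (\<lambda>_. b)"
      using PQ(1,2) forms_0E by (metis not_gr_zero)
    have const: "f p = abs_proj_line (a, b)" for p
      using abs_proj_line_cases[of p] f_abs ab by metis
    obtain p p' where "f p = abs_proj_line (1, 0)" "f p' = abs_proj_line (0, 1)"
      using assms(2) by (metis surjD)
    then have "abs_proj_line (1, 0 :: 'k) = abs_proj_line (0, 1)"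
      using const by metis
    then show False
      using abs_proj_line_eq_iff_lin[of "(1, 0)" "(0, 1 :: 'k)"] by (simp add: lin_def)
  qed
  then have "projective_map P Q m f"
    using PQ(1,2,4) f_abs assms by unfold_locales auto
  then show ?thesis
    by (rule that)
qed

context projective_map
begin

lemma PQ_nonzero: "v \<noteq> (0, 0) \<Longrightarrow> (P v, Q v) \<noteq> (0, 0)"
  using no_common_zero by auto

lemma cone_vimage: "v \<in> cone (f -` V) \<longleftrightarrow> v \<noteq> (0, 0) \<and> (P v, Q v) \<in> cone V"
proof (cases "v = (0, 0)")
  case False
  then show ?thesis
    using f_abs[OF False] PQ_nonzero[OF False] by (simp add: mem_cone)
qed (simp add: mem_cone)

lemma open_vimage_f: "open V \<Longrightarrow> open (f -` V)"
  by (rule variety_morphism_open_vimage[OF morphism])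

text \<open>Pulling back along \<open>f\<close> turns the twist \<open>j\<close> into the twist
  \<open>j m\<close>, because substituting \<open>P\<close> and \<open>Q\<close> multiplies the
  degrees of numerator and denominator by \<open>m\<close>.\<close>

lemma comp_in_twist_sections:
  assumes "s \<in> twist_sections j V"
  shows "(\<lambda>v\<in>cone (f -` V). s (P v, Q v)) \<in> twist_sections (j * int m) (f -` V)"
proof (rule twist_sectionsI)
  fix v assume v: "v \<in> cone (f -` V)"
  then have "(P v, Q v) \<in> cone V"
    by (simp add: cone_vimage)
  with assms obtain W d e F G where loc: "open W" "abs_proj_line (P v, Q v) \<in> W" "W \<subseteq> V"
    "F \<in> forms d" "G \<in> forms e" "int d - int e = j"
    "\<And>w. w \<in> cone W \<Longrightarrow> G w \<noteq> 0" "\<And>w. w \<in> cone W \<Longrightarrow> s w = F w / G w"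
    by (rule twist_sectionsE) blast
  have "open (f -` W)" "abs_proj_line v \<in> f -` W" "f -` W \<subseteq> f -` V"
    using open_vimage_f[OF loc(1)] loc(2,3) v f_abs by (auto simp: mem_cone)
  moreover have "int (d * m) - int (e * m) = j * int m"
    using loc(6) by (simp flip: loc(6) add: algebra_simps)
  moreover have "\<forall>w\<in>cone (f -` W). G (P w, Q w) \<noteq> 0 \<and>
      (\<lambda>v\<in>cone (f -` V). s (P v, Q v)) w = F (P w, Q w) / G (P w, Q w)"
  proof
    fix w assume w: "w \<in> cone (f -` W)"
    then have "(P w, Q w) \<in> cone W"
      by (simp add: cone_vimage)
    moreover have "w \<in> cone (f -` V)"
      using w loc(3) by (auto simp: mem_cone)
    ultimately show "G (P w, Q w) \<noteq> 0 \<and>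
      (\<lambda>v\<in>cone (f -` V). s (P v, Q v)) w = F (P w, Q w) / G (P w, Q w)"
      using loc(7,8) by simp
  qed
  ultimately show "\<exists>W d e F G. open W \<and> abs_proj_line v \<in> W \<and> W \<subseteq> f -` V \<and> F \<in> forms d \<and> G \<in> forms e \<and>
      int d - int e = j * int m \<and>
      (\<forall>w\<in>cone W. G w \<noteq> 0 \<and> (\<lambda>v\<in>cone (f -` V). s (P v, Q v)) w = F w / G w)"
    using comp_in_forms[OF loc(4) P_form Q_form] comp_in_forms[OF loc(5) P_form Q_form]
    by - (rule exI[of _ "f -` W"], rule exI[of _ "d * m"], rule exI[of _ "e * m"],
        rule exI[of _ "\<lambda>w. F (P w, Q w)"], rule exI[of _ "\<lambda>w. G (P w, Q w)"], intro conjI)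
qed simp

text \<open>The substitution \<open>(P, Q)\<close> turns the linear form vanishing at \<open>f p\<close> into a form vanishing at \<open>p\<close>.\<close>

lemma forms_dvd_comp:
  assumes "G \<in> forms e" "G \<noteq> (\<lambda>_. 0)"
  obtains H N where "N \<in> forms e" "H \<in> forms (e * m - e)" "N \<noteq> (\<lambda>_. 0)"
    "\<And>v. N (P v, Q v) = G v * H v"
    "\<And>v. v \<noteq> (0, 0) \<Longrightarrow> N v = 0 \<Longrightarrow> \<exists>w. w \<noteq> (0, 0) \<and> G w = 0 \<and> f (abs_proj_line w) = abs_proj_line v"
proof -
  have "\<exists>N\<in>forms e. \<exists>H\<in>forms (e * m - e). N \<noteq> (\<lambda>_. 0) \<and> (\<forall>v. N (P v, Q v) = G v * H v) \<and>
    (\<forall>v. v \<noteq> (0, 0) \<longrightarrow> N v = 0 \<longrightarrow> (\<exists>w. w \<noteq> (0, 0) \<and> G w = 0 \<and> f (abs_proj_line w) = abs_proj_line v))"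
    using assms
  proof (induction e arbitrary: G)
    case 0
    then obtain c where "G = (\<lambda>_. c)" "c \<noteq> 0"
      using forms_0E by (metis (no_types))
    then show ?case
      using const_in_forms[of c] const_in_forms[of 1]
      by (intro bexI[of _ "\<lambda>_. c"] bexI[of _ "\<lambda>_. 1"]) (auto simp: fun_eq_iff)
  next
    case (Suc e)
    obtain a where a: "a \<noteq> (0, 0)" "G a = 0"
      using forms_has_zero[OF Suc.prems(1)] by auto
    obtain G' where G': "G' \<in> forms e" "G = (\<lambda>v. lin a v * G' v)"
      using forms_factor[OF Suc.prems(1) a Suc.prems(2)] by blast
    have "G' \<noteq> (\<lambda>_. 0)"
      using Suc.prems(2) G'(2) by auto
    from Suc.IH[OF G'(1) this] obtain N' H' where NH: "N' \<in> forms e" "H' \<in> forms (e * m - e)" "N' \<noteq> (\<lambda>_. 0)"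
      "\<forall>v. N' (P v, Q v) = G' v * H' v"
      "\<forall>v. v \<noteq> (0, 0) \<longrightarrow> N' v = 0 \<longrightarrow> (\<exists>w. w \<noteq> (0, 0) \<and> G' w = 0 \<and> f (abs_proj_line w) = abs_proj_line v)"
      by blast
    let ?b = "(P a, Q a)"
    have L: "(\<lambda>v. lin ?b (P v, Q v)) \<in> forms m"
      using comp_in_forms[OF lin_in_forms P_form Q_form] by simp
    \<comment> \<open>The factorization lemma speaks of nonzero forms; if the substituted form were
      zero, \<open>K = 0\<close> would do.\<close>
    obtain K where K: "K \<in> forms (m - 1)" "\<And>v. lin ?b (P v, Q v) = lin a v * K v"
    proof (cases "(\<lambda>v. lin ?b (P v, Q v)) = (\<lambda>_. 0)")
      case True
      show ?thesis
        by (rule that[OF zero_in_forms]) (use fun_cong[OF True] in simp)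
    next
      case False
      have "lin ?b (P a, Q a) = 0"
        by simp
      from forms_factor[OF L a(1) this False] obtain d' K
        where K: "m = Suc d'" "K \<in> forms d'" "(\<lambda>v. lin ?b (P v, Q v)) = (\<lambda>w. lin a w * K w)"
        by blast
      show ?thesis
        by (rule that[of K]) (use K(1,2) fun_cong[OF K(3)] in simp_all)
    qed
    have em: "e \<le> e * m"
      using m_pos by simp
    have "m - 1 + (e * m - e) = Suc e * m - Suc e"
      using m_pos em by simp
    then have "(\<lambda>v. K v * H' v) \<in> forms (Suc e * m - Suc e)"
      using mult_in_forms[OF K(1) NH(2)] by simp
    moreover have N: "(\<lambda>v. lin ?b v * N' v) \<in> forms (Suc e)"
      using mult_in_forms[OF lin_in_forms NH(1)] by simp
    moreover have "(\<lambda>v. lin ?b v * N' v) \<noteq> (\<lambda>_. 0)"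
      using forms_no_zero_divisors[OF lin_in_forms NH(1), of ?b] lin_nonzero[OF PQ_nonzero[OF a(1)]] NH(3)
      by (auto simp: fun_eq_iff)
    moreover have "\<forall>v. lin ?b (P v, Q v) * N' (P v, Q v) = G v * (K v * H' v)"
      using K(2) NH(4) G'(2) by (simp add: mult_ac)
    moreover have "\<forall>v. v \<noteq> (0, 0) \<longrightarrow> lin ?b v * N' v = 0 \<longrightarrow>
        (\<exists>w. w \<noteq> (0, 0) \<and> G w = 0 \<and> f (abs_proj_line w) = abs_proj_line v)"
    proof (intro allI impI)
      fix v assume v: "v \<noteq> (0, 0)" "lin ?b v * N' v = 0"
      then consider "lin ?b v = 0" | "N' v = 0"
        by auto
      then show "\<exists>w. w \<noteq> (0, 0) \<and> G w = 0 \<and> f (abs_proj_line w) = abs_proj_line v"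
      proof cases
        case 1
        then have "f (abs_proj_line a) = abs_proj_line v"
          using abs_proj_line_eq_iff_lin[OF PQ_nonzero[OF a(1)] v(1)] f_abs[OF a(1)] by simp
        then show ?thesis
          using a by blast
      next
        case 2
        then obtain w where "w \<noteq> (0, 0)" "G' w = 0" "f (abs_proj_line w) = abs_proj_line v"
          using NH(5) v(1) by blast
        then show ?thesis
          using G'(2) by (intro exI[of _ w]) simp
      qed
    qed
    ultimately show ?case
      by - (rule bexI[of _ "\<lambda>v. lin ?b v * N' v"], rule bexI[of _ "\<lambda>v. K v * H' v"], intro conjI)
  qed
  then show ?thesis
    using that by blast
qed

end

subsection \<open>The isomorphism\<close>

text \<open>The explicit map goes from the direct sum to the direct image, opposite to the direction
  asked for. That the operations on \<open>B\<close> stay in the carriers has to be assumed, since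
  the record carries no module axioms and the inverse is controlled only on the carrier.\<close>

lemma sheaf_iso_if_inverse:
  assumes bij: "\<And>U. open U \<Longrightarrow> bij_betw (\<psi> U) (carrier (sections B U)) (carrier (sections A U))"
    and add: "\<And>U s t. open U \<Longrightarrow> s \<in> carrier (sections B U) \<Longrightarrow> t \<in> carrier (sections B U) \<Longrightarrow>
      s \<oplus>\<^bsub>sections B U\<^esub> t \<in> carrier (sections B U) \<and>
      \<psi> U (s \<oplus>\<^bsub>sections B U\<^esub> t) = \<psi> U s \<oplus>\<^bsub>sections A U\<^esub> \<psi> U t"
    and smult: "\<And>U g s. open U \<Longrightarrow> g \<in> regular_functions U \<Longrightarrow> s \<in> carrier (sections B U) \<Longrightarrow>
      g \<odot>\<^bsub>sections B U\<^esub> s \<in> carrier (sections B U) \<and>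
      \<psi> U (g \<odot>\<^bsub>sections B U\<^esub> s) = g \<odot>\<^bsub>sections A U\<^esub> \<psi> U s"
    and restr: "\<And>U V s. open U \<Longrightarrow> open V \<Longrightarrow> V \<subseteq> U \<Longrightarrow> s \<in> carrier (sections B U) \<Longrightarrow>
      restriction B U V s \<in> carrier (sections B V) \<and>
      \<psi> V (restriction B U V s) = restriction A U V (\<psi> U s)"
  shows "A \<cong>\<^sub>\<O> B"
proof -
  define \<phi> where "\<phi> U = the_inv_into (carrier (sections B U)) (\<psi> U)" for U
  have \<phi>\<psi>: "\<phi> U (\<psi> U s) = s" if "open U" "s \<in> carrier (sections B U)" for U s
    using the_inv_into_f_f[OF bij_betw_imp_inj_on[OF bij[OF that(1)]] that(2)] by (simp add: \<phi>_def)
  have \<phi>: "bij_betw (\<phi> U) (carrier (sections A U)) (carrier (sections B U))" if "open U" for U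
    unfolding \<phi>_def by (rule bij_betw_the_inv_into[OF bij[OF that]])
  have pre: "\<exists>s'\<in>carrier (sections B U). s = \<psi> U s'" if "open U" "s \<in> carrier (sections A U)" for U s
    using bij_betw_imp_surj_on[OF bij[OF that(1)]] that(2) by blast
  show ?thesis
    unfolding sheaf_iso_def
  proof (intro exI[of _ \<phi>] conjI allI impI ballI)
    fix U s t assume U: "open U" and "s \<in> carrier (sections A U)" "t \<in> carrier (sections A U)"
    then obtain s' t' where s': "s' \<in> carrier (sections B U)" "s = \<psi> U s'"
      and t': "t' \<in> carrier (sections B U)" "t = \<psi> U t'"
      using pre by meson
    have "\<phi> U (\<psi> U (s' \<oplus>\<^bsub>sections B U\<^esub> t')) = s' \<oplus>\<^bsub>sections B U\<^esub> t'"
      using add[OF U s'(1) t'(1)] by (intro \<phi>\<psi>[OF U]) simp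
    then show "\<phi> U (s \<oplus>\<^bsub>sections A U\<^esub> t) = \<phi> U s \<oplus>\<^bsub>sections B U\<^esub> \<phi> U t"
      using add[OF U s'(1) t'(1)] \<phi>\<psi>[OF U s'(1)] \<phi>\<psi>[OF U t'(1)] s'(2) t'(2) by simp
  next
    fix U g s assume U: "open U" and g: "g \<in> regular_functions U" and "s \<in> carrier (sections A U)"
    then obtain s' where s': "s' \<in> carrier (sections B U)" "s = \<psi> U s'"
      using pre by meson
    have "\<phi> U (\<psi> U (g \<odot>\<^bsub>sections B U\<^esub> s')) = g \<odot>\<^bsub>sections B U\<^esub> s'"
      using smult[OF U g s'(1)] by (intro \<phi>\<psi>[OF U]) simp
    then show "\<phi> U (g \<odot>\<^bsub>sections A U\<^esub> s) = g \<odot>\<^bsub>sections B U\<^esub> \<phi> U s"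
      using smult[OF U g s'(1)] \<phi>\<psi>[OF U s'(1)] s'(2) by simp
  next
    fix U V s assume UV: "open U" "open V" "V \<subseteq> U" and "s \<in> carrier (sections A U)"
    then obtain s' where s': "s' \<in> carrier (sections B U)" "s = \<psi> U s'"
      using pre by meson
    have "\<phi> V (\<psi> V (restriction B U V s')) = restriction B U V s'"
      using restr[OF UV s'(1)] by (intro \<phi>\<psi>[OF UV(2)]) simp
    then show "\<phi> V (restriction A U V s) = restriction B U V (\<phi> U s)"
      using restr[OF UV s'(1)] \<phi>\<psi>[OF UV(1) s'(1)] s'(2) by simp
  qed (use \<phi> in blast)
qed

lemma twist_sections_extensional: "s \<in> twist_sections j U \<Longrightarrow> s \<in> extensional (cone U)"
  by (simp add: twist_sections_def)

lemma diff_in_twist_sections: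
  assumes "open U" "s \<in> twist_sections j U" "t \<in> twist_sections j U"
  shows "(\<lambda>v\<in>cone U. s v - t v) \<in> twist_sections j U"
proof -
  have "(\<lambda>v\<in>cone U. t v * (\<lambda>v\<in>cone U. -1) v) \<in> twist_sections (j + int 0) U"
    by (rule mult_in_twist_sections[OF assms(3) form_in_twist_sections[OF assms(1) const_in_forms]])
  then have "(\<lambda>v\<in>cone U. s v + (\<lambda>v\<in>cone U. t v * (\<lambda>v\<in>cone U. -1) v) v) \<in> twist_sections j U"
    unfolding of_nat_0 add_0_right by (rule add_in_twist_sections[OF assms(2)])
  moreover have "(\<lambda>v\<in>cone U. s v + (\<lambda>v\<in>cone U. t v * (\<lambda>v\<in>cone U. -1) v) v) = (\<lambda>v\<in>cone U. s v - t v)"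
    by (auto simp: restrict_def)
  ultimately show ?thesis by (simp only:)
qed

lemma smult_in_twist_sections:
  assumes "g \<in> regular_functions U" "s \<in> twist_sections j U"
  shows "(\<lambda>v\<in>cone U. g (abs_proj_line v) * s v) \<in> twist_sections j U"
proof -
  have "(\<lambda>v\<in>cone U. (\<lambda>v\<in>cone U. g (abs_proj_line v)) v * s v) \<in> twist_sections (0 + j) U"
    by (rule mult_in_twist_sections[OF regular_function_in_twist_sections[OF assms(1)] assms(2)])
  moreover have "(\<lambda>v\<in>cone U. (\<lambda>v\<in>cone U. g (abs_proj_line v)) v * s v) = (\<lambda>v\<in>cone U. g (abs_proj_line v) * s v)"
    by (auto simp: restrict_def)
  ultimately show ?thesis by (simp only: add_0)
qed

text \<open>Clearing finitely many sections near a point by one form turns a relation between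
  sections into a relation between forms. The twist \<open>j\<close> varies with the index because
  two different twists occur in the direct sum.\<close>

lemma common_denominator:
  assumes "finite I" "v \<in> cone U" "open U" "\<forall>l\<in>I. s l \<in> twist_sections (j l) U"
  shows "\<exists>W e N. open W \<and> abs_proj_line v \<in> W \<and> W \<subseteq> U \<and> N \<in> forms e \<and> (\<forall>w\<in>cone W. N w \<noteq> 0) \<and>
    (\<forall>l\<in>I. \<exists>d F. F \<in> forms d \<and> int d - int e = j l \<and> (\<forall>w\<in>cone W. N w * s l w = F w))"
  using assms(1,4)
proof (induction I)
  case empty
  then show ?case
    using assms(2,3) const_in_forms[of 1]
    by (intro exI[of _ U] exI[of _ 0] exI[of _ "\<lambda>_. 1"]) (auto simp: mem_cone)
next
  case (insert l I)
  then obtain W e N where IH: "open W" "abs_proj_line v \<in> W" "W \<subseteq> U" "N \<in> forms e" "\<forall>w\<in>cone W. N w \<noteq> 0"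
    "\<forall>l\<in>I. \<exists>d F. F \<in> forms d \<and> int d - int e = j l \<and> (\<forall>w\<in>cone W. N w * s l w = F w)"
    by (metis insertCI)
  have "s l \<in> twist_sections (j l) U"
    using insert.prems by simp
  then obtain W' d' e' F' G' where loc: "open W'" "abs_proj_line v \<in> W'" "W' \<subseteq> U" "F' \<in> forms d'" "G' \<in> forms e'"
    "int d' - int e' = j l" "\<And>w. w \<in> cone W' \<Longrightarrow> G' w \<noteq> 0" "\<And>w. w \<in> cone W' \<Longrightarrow> s l w = F' w / G' w"
    using assms(2) by (rule twist_sectionsE) blast
  have *: "w \<in> cone W" "w \<in> cone W'" if "w \<in> cone (W \<inter> W')" for w
    using that by (auto simp: mem_cone)
  have "\<exists>d F. F \<in> forms d \<and> int d - int (e + e') = j l' \<and> (\<forall>w\<in>cone (W \<inter> W'). N w * G' w * s l' w = F w)"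
    if "l' \<in> insert l I" for l'
  proof (cases "l' = l")
    case True
    have "\<forall>w\<in>cone (W \<inter> W'). N w * G' w * s l' w = N w * F' w"
      using loc(7,8) *(2) True by simp
    then show ?thesis
      using mult_in_forms[OF IH(4) loc(4)] loc(6) True
      by (intro exI[of _ "e + d'"] exI[of _ "\<lambda>w. N w * F' w"]) simp
  next
    case False
    then have "l' \<in> I"
      using that by simp
    with IH(6) obtain d F where F: "F \<in> forms d" "int d - int e = j l'" "\<forall>w\<in>cone W. N w * s l' w = F w"
      by blast
    have "\<forall>w\<in>cone (W \<inter> W'). N w * G' w * s l' w = F w * G' w"
      using F(3) *(1) by (simp add: mult_ac)
    then show ?thesis
      using mult_in_forms[OF F(1) loc(5)] F(2)
      by (intro exI[of _ "d + e'"] exI[of _ "\<lambda>w. F w * G' w"]) simp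
  qed
  moreover have "\<forall>w\<in>cone (W \<inter> W'). N w * G' w \<noteq> 0"
    using IH(5) loc(7) * by simp
  moreover have "open (W \<inter> W')" "abs_proj_line v \<in> W \<inter> W'" "W \<inter> W' \<subseteq> U"
    using IH(1-3) loc(1,2) by auto
  ultimately show ?case
    using mult_in_forms[OF IH(4) loc(5)]
    by - (rule exI[of _ "W \<inter> W'"], rule exI[of _ "e + e'"], rule exI[of _ "\<lambda>w. N w * G' w"],
        intro conjI ballI, blast+)
qed

section \<open>The splitting map on sections\<close>

context projective_map
begin

text \<open>The expansion of \<open>free_generation\<close> with sections on the target as
  coefficients: evaluation at \<open>(P, Q)\<close> pulls them back, and the monomials and
  \<open>B\<close> are the basis.\<close>

definition assemble where
  "assemble i B V = (\<lambda>(s, t). \<lambda>v\<in>cone (f -` V).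
    (\<Sum>l\<le>i. s l (P v, Q v) * hmon i l v) + (\<Sum>l<m - i - 1. t l (P v, Q v) * B l v))"

abbreviation summand_families where
  "summand_families i q V \<equiv>
    (\<Pi>\<^sub>E l\<in>{..<i + 1}. twist_sections q V) \<times> (\<Pi>\<^sub>E l\<in>{..<m - i - 1}. twist_sections (q - 1) V)"

lemma assemble_apply:
  "v \<in> cone (f -` V) \<Longrightarrow> assemble i B V (s, t) v =
    (\<Sum>l\<le>i. s l (P v, Q v) * hmon i l v) + (\<Sum>l<m - i - 1. t l (P v, Q v) * B l v)"
  by (simp add: assemble_def)

lemma assemble_extensional: "assemble i B V st \<in> extensional (cone (f -` V))"
  by (cases st) (simp add: assemble_def)

lemma assemble_in_twist_sections:
  assumes "complement_basis i B" "i < m" "open V" "st \<in> summand_families i q V"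
  shows "assemble i B V st \<in> twist_sections (q * int m + int i) (f -` V)"
proof -
  obtain s t where st: "st = (s, t)"
    by (cases st)
  let ?C = "cone (f -` V)"
  note U = open_vimage_f[OF assms(3)]
  have s: "(\<lambda>v\<in>?C. (\<lambda>v\<in>?C. s l (P v, Q v)) v * restrict (hmon i l) ?C v)
      \<in> twist_sections (q * int m + int i) (f -` V)" if "l \<in> {..i}" for l
    using assms(4) that unfolding st
    by (intro mult_in_twist_sections comp_in_twist_sections form_in_twist_sections U hmon_in_forms) auto
  have t: "(\<lambda>v\<in>?C. (\<lambda>v\<in>?C. t l (P v, Q v)) v * restrict (B l) ?C v)
      \<in> twist_sections (q * int m + int i) (f -` V)" if "l \<in> {..<m - i - 1}" for l
  proof -
    have "(\<lambda>v\<in>?C. (\<lambda>v\<in>?C. t l (P v, Q v)) v * restrict (B l) ?C v)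
      \<in> twist_sections ((q - 1) * int m + int (m + i)) (f -` V)"
      using assms(4) that complement_basis_form[OF assms(1)] unfolding st
      by (intro mult_in_twist_sections comp_in_twist_sections form_in_twist_sections U) auto
    then show ?thesis
      by (simp add: algebra_simps)
  qed
  have "(\<lambda>v\<in>?C. (\<lambda>v\<in>?C. \<Sum>l\<le>i. (\<lambda>v\<in>?C. (\<lambda>v\<in>?C. s l (P v, Q v)) v * restrict (hmon i l) ?C v) v) v +
      (\<lambda>v\<in>?C. \<Sum>l<m - i - 1. (\<lambda>v\<in>?C. (\<lambda>v\<in>?C. t l (P v, Q v)) v * restrict (B l) ?C v) v) v)
      \<in> twist_sections (q * int m + int i) (f -` V)" (is "?S \<in> _")
    by (rule add_in_twist_sections[OF sum_in_twist_sections[OF U s] sum_in_twist_sections[OF U t]])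
  moreover have "?S = assemble i B V st"
    unfolding st by (rule extensionalityI[of _ ?C]) (auto simp: assemble_apply assemble_extensional)
  ultimately show ?thesis by (simp only:)
qed

text \<open>Near a point of \<open>V\<close> the differences of the coefficients are cleared by one
  form \<open>N\<close>. Their assembled form then vanishes on the preimage of a nonempty open set,
  hence identically, and \<open>free_independence\<close> applies.\<close>

lemma assemble_inj:
  assumes "complement_basis i B" "i < m" "open V"
  shows "inj_on (assemble i B V) (summand_families i q V)"
proof (rule inj_onI)
  fix x y assume x: "x \<in> summand_families i q V" and y: "y \<in> summand_families i q V"
    and eq: "assemble i B V x = assemble i B V y"
  obtain s t where xst: "x = (s, t)" by (cases x)
  obtain s' t' where yst: "y = (s', t')" by (cases y)
  have s: "s l \<in> twist_sections q V" "s' l \<in> twist_sections q V" if "l \<le> i" for l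
    using x y that unfolding xst yst by auto
  have t: "t l \<in> twist_sections (q - 1) V" "t' l \<in> twist_sections (q - 1) V" if "l < m - i - 1" for l
    using x y that unfolding xst yst by auto
  \<comment> \<open>Both families of differences are merged over a sum type so that a single
    \<open>N\<close> clears all of them; \<open>j\<close> records their twists.\<close>
  define u where "u = case_sum (\<lambda>l. \<lambda>v\<in>cone V. s l v - s' l v) (\<lambda>l. \<lambda>v\<in>cone V. t l v - t' l v)"
  define j :: "nat + nat \<Rightarrow> int" where "j = case_sum (\<lambda>_. q) (\<lambda>_. q - 1)"
  let ?I = "{..i} <+> {..<m - i - 1}"
  have u: "\<forall>x\<in>?I. u x \<in> twist_sections (j x) V"
    by (rule ballI, elim PlusE)
      (simp_all add: u_def j_def diff_in_twist_sections[OF assms(3) s] diff_in_twist_sections[OF assms(3) t])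
  have main: "(\<forall>l\<le>i. s l v = s' l v) \<and> (\<forall>l<m - i - 1. t l v = t' l v)" if v: "v \<in> cone V" for v
  proof -
    have "finite ?I" by simp
    from common_denominator[of ?I v V u j, OF this v assms(3) u]
    obtain W e N where N: "open W" "abs_proj_line v \<in> W" "W \<subseteq> V" "N \<in> forms e" "\<forall>w\<in>cone W. N w \<noteq> 0"
      and F: "\<forall>x\<in>?I. \<exists>d F. F \<in> forms d \<and> int d - int e = j x \<and> (\<forall>w\<in>cone W. N w * u x w = F w)"
      by (elim exE conjE) (rule that)
    have v: "v \<in> cone W"
      using v N(2) by (simp add: mem_cone)
    have WV: "w \<in> cone V" if "w \<in> cone W" for w
      using that N(3) by (auto simp: mem_cone)
    \<comment> \<open>There is always a left summand, and the degree of its numerator provides a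
      natural number \<open>r\<close> with \<open>r = q + e\<close>.\<close>
    have "Inl i \<in> ?I" by (rule InlI) simp
    from bspec[OF F this] obtain r where r: "int r - int e = q"
      unfolding j_def sum.case by blast
    have "\<forall>l\<in>{..i}. \<exists>F. F \<in> forms r \<and> (\<forall>w\<in>cone W. N w * (s l w - s' l w) = F w)"
    proof
      fix l assume "l \<in> {..i}"
      then have "Inl l \<in> ?I" by (rule InlI)
      with F obtain d F where dF: "F \<in> forms d" "int d - int e = j (Inl l)" "\<forall>w\<in>cone W. N w * u (Inl l) w = F w"
        by blast
      have "d = r"
        using dF(2) r by (simp add: j_def)
      moreover have "\<forall>w\<in>cone W. N w * (s l w - s' l w) = F w"
        using dF(3) WV by (simp add: u_def)
      ultimately show "\<exists>F. F \<in> forms r \<and> (\<forall>w\<in>cone W. N w * (s l w - s' l w) = F w)"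
        using dF(1) by blast
    qed
    from bchoice[OF this] obtain S where
      S: "\<forall>l\<in>{..i}. S l \<in> forms r \<and> (\<forall>w\<in>cone W. N w * (s l w - s' l w) = S l w)"
      by blast
    have "\<forall>l\<in>{..<m - i - 1}. \<exists>F. F \<in> forms (r - 1) \<and> r \<noteq> 0 \<and> (\<forall>w\<in>cone W. N w * (t l w - t' l w) = F w)"
    proof
      fix l assume "l \<in> {..<m - i - 1}"
      then have "Inr l \<in> ?I" by (rule InrI)
      with F obtain d F where dF: "F \<in> forms d" "int d - int e = j (Inr l)" "\<forall>w\<in>cone W. N w * u (Inr l) w = F w"
        by blast
      \<comment> \<open>The degree equation holds in the integers, so a right summand can exist only
        if \<open>r\<close> is positive. This is what \<open>free_independence\<close> asks of its
        second family.\<close>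
      have "d = r - 1" "r \<noteq> 0"
        using dF(2) r by (auto simp: j_def)
      moreover have "\<forall>w\<in>cone W. N w * (t l w - t' l w) = F w"
        using dF(3) WV by (simp add: u_def)
      ultimately show "\<exists>F. F \<in> forms (r - 1) \<and> r \<noteq> 0 \<and> (\<forall>w\<in>cone W. N w * (t l w - t' l w) = F w)"
        using dF(1) by blast
    qed
    from bchoice[OF this] obtain T where
      T: "\<forall>l\<in>{..<m - i - 1}. T l \<in> forms (r - 1) \<and> r \<noteq> 0 \<and> (\<forall>w\<in>cone W. N w * (t l w - t' l w) = T l w)"
      by blast
    let ?Z = "\<lambda>w. (\<Sum>l\<le>i. S l (P w, Q w) * hmon i l w) + (\<Sum>l<m - i - 1. T l (P w, Q w) * B l w)"
    have "(\<lambda>w. S l (P w, Q w) * hmon i l w) \<in> forms (r * m + i)" if "l \<in> {..i}" for l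
      using that S by (intro mult_in_forms comp_in_forms P_form Q_form hmon_in_forms) auto
    moreover have "(\<lambda>w. T l (P w, Q w) * B l w) \<in> forms (r * m + i)" if "l \<in> {..<m - i - 1}" for l
    proof -
      have "(\<lambda>w. T l (P w, Q w) * B l w) \<in> forms ((r - 1) * m + (m + i))" "r \<noteq> 0"
        using that T complement_basis_form[OF assms(1)]
        by (auto intro!: mult_in_forms comp_in_forms P_form Q_form)
      then show ?thesis
        by (cases r) (auto simp: add_ac)
    qed
    ultimately have "?Z \<in> forms (r * m + i)"
      by (intro add_in_forms sum_in_forms)
    moreover have "open (f -` W)"
      by (rule open_vimage_f[OF N(1)])
    moreover have "f -` W \<noteq> {}"
      using N(2) surjD[OF surjective, of "abs_proj_line v"] by auto
    moreover have "?Z w = 0" if w: "w \<in> cone (f -` W)" for w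
    proof -
      have PQ: "(P w, Q w) \<in> cone W"
        using w by (simp add: cone_vimage)
      have wV: "w \<in> cone (f -` V)"
        using w N(3) by (auto simp: mem_cone)
      have "?Z w = N (P w, Q w) * (assemble i B V x w - assemble i B V y w)"
        using S T PQ unfolding xst yst assemble_apply[OF wV]
        by (simp add: sum_distrib_left sum_subtractf sum.distrib algebra_simps)
      then show ?thesis
        using eq by simp
    qed
    ultimately have "?Z = (\<lambda>_. 0)"
      by (rule form_eq_0_if_vanishes_on_open)
    then have "(\<forall>l\<le>i. S l = (\<lambda>_. 0)) \<and> (\<forall>l<m - i - 1. T l = (\<lambda>_. 0))"
      using S T by (intro free_independence[OF assms(1,2), of S r T]) (auto simp: fun_eq_iff)
    then show ?thesis
      using S T N(5) v by auto
  qed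
  have ss: "s l = s' l" if "l \<in> {..<i + 1}" for l
    by (rule extensionalityI[OF s[THEN twist_sections_extensional]]) (use main that in auto)
  have tt: "t l = t' l" if "l \<in> {..<m - i - 1}" for l
    by (rule extensionalityI[OF t[THEN twist_sections_extensional]]) (use main that in auto)
  have "s \<in> (\<Pi>\<^sub>E l\<in>{..<i + 1}. twist_sections q V)" "s' \<in> (\<Pi>\<^sub>E l\<in>{..<i + 1}. twist_sections q V)"
    using x y unfolding xst yst by simp_all
  then have "s = s'"
    using ss by (rule PiE_ext)
  moreover have "t \<in> (\<Pi>\<^sub>E l\<in>{..<m - i - 1}. twist_sections (q - 1) V)"
    "t' \<in> (\<Pi>\<^sub>E l\<in>{..<m - i - 1}. twist_sections (q - 1) V)"
    using x y unfolding xst yst by simp_all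
  then have "t = t'"
    using tt by (rule PiE_ext)
  ultimately have "s = s'" "t = t'"
    by simp_all
  then show "x = y"
    by (simp add: xst yst)
qed

text \<open>In lowest terms \<open>S = F / G\<close>. Extending by \<open>H\<close> gives the
  denominator \<open>N (P, Q)\<close> and a numerator \<open>F H\<close> of degree
  \<open>r m + i\<close> with \<open>r = q + e\<close>; its expansion, with coefficients divided by
  \<open>N\<close>, is the preimage. Zeros of \<open>N\<close> lie over images of zeros of
  \<open>G\<close>, which avoid \<open>V\<close>, so these quotients are sections on all of
  \<open>V\<close>. The zero section, which includes the case of empty \<open>V\<close>, has no
  lowest terms and is treated apart.\<close>

lemma assemble_surj:
  assumes "complement_basis i B" "i < m" "open V" "S \<in> twist_sections (q * int m + int i) (f -` V)"
  shows "S \<in> assemble i B V ` summand_families i q V"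
proof (cases "\<exists>v\<in>cone (f -` V). S v \<noteq> 0")
  case False
  let ?x = "(\<lambda>l\<in>{..<i + 1}. \<lambda>v\<in>cone V. 0, \<lambda>l\<in>{..<m - i - 1}. \<lambda>v\<in>cone V. 0 :: 'a)"
  have "S = assemble i B V ?x"
  proof (rule extensionalityI[OF _ assemble_extensional])
    show "S v = assemble i B V ?x v" if "v \<in> cone (f -` V)" for v
      using False that by (auto simp: assemble_apply cone_vimage)
  qed (use assms(4) in \<open>auto simp: twist_sections_def\<close>)
  moreover have "?x \<in> summand_families i q V"
    using zero_in_twist_sections[OF assms(3)] by auto
  ultimately show ?thesis
    by (rule image_eqI)
next
  case True
  then have "f -` V \<noteq> {}"
    by (auto simp: mem_cone)
  from this assms(4) True obtain d e F G where FG: "F \<in> forms d" "G \<in> forms e"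
    "int d - int e = q * int m + int i" "F \<noteq> (\<lambda>_. 0)" "\<And>v. v \<noteq> (0, 0) \<Longrightarrow> F v = 0 \<Longrightarrow> G v \<noteq> 0"
    "\<And>v. v \<in> cone (f -` V) \<Longrightarrow> G v \<noteq> 0" "\<And>v. v \<in> cone (f -` V) \<Longrightarrow> S v = F v / G v"
    by (rule twist_section_eq_fraction) blast
  have "G \<noteq> (\<lambda>_. 0)"
    using True FG(6) by auto
  with FG(2) obtain H N where HN: "N \<in> forms e" "H \<in> forms (e * m - e)" "N \<noteq> (\<lambda>_. 0)"
    "\<And>v. N (P v, Q v) = G v * H v"
    "\<And>v. v \<noteq> (0, 0) \<Longrightarrow> N v = 0 \<Longrightarrow> \<exists>w. w \<noteq> (0, 0) \<and> G w = 0 \<and> f (abs_proj_line w) = abs_proj_line v"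
    by (rule forms_dvd_comp) blast
  have N_nz: "N v \<noteq> 0" if "v \<in> cone V" for v
  proof
    assume "N v = 0"
    then obtain w where "w \<noteq> (0, 0)" "G w = 0" "f (abs_proj_line w) = abs_proj_line v"
      using HN(5)[of v] \<open>v \<in> cone V\<close> unfolding mem_cone by blast
    then show False
      using FG(6)[of w] that by (simp add: mem_cone)
  qed
  \<comment> \<open>Otherwise \<open>q m \<le> - m - e m\<close>, and \<open>d = q m + i + e\<close>
    would be at most \<open>i - m < 0\<close>, because \<open>e \<le> e m\<close>.\<close>
  have "0 \<le> q + int e"
  proof (rule ccontr)
    assume "\<not> 0 \<le> q + int e"
    then have "(q + int e) * int m \<le> - 1 * int m"
      by (intro mult_right_mono) auto
    moreover have "int e * 1 \<le> int e * int m"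
      using m_pos by (intro mult_left_mono) auto
    ultimately show False
      using FG(3) assms(2) by (simp add: algebra_simps)
  qed
  then obtain r where r: "int r = q + int e"
    by (metis nat_0_le)
  have "e \<le> e * m"
    using m_pos by simp
  then have "int (e * m - e) = int e * int m - int e"
    by (simp add: of_nat_diff)
  then have "int (d + (e * m - e)) = int (r * m + i)"
    unfolding of_nat_add using FG(3) r by (simp add: algebra_simps)
  then have "d + (e * m - e) = r * m + i"
    by linarith
  then have "(\<lambda>v. F v * H v) \<in> forms (r * m + i)"
    using mult_in_forms[OF FG(1) HN(2)] by simp
  from free_generation[OF assms(1,2) this] obtain s t where st: "\<And>l. s l \<in> forms r" "\<And>l. t l \<in> forms (r - 1)"
    "\<And>l. r = 0 \<Longrightarrow> t l = (\<lambda>_. 0)"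
    "(\<lambda>v. F v * H v) = (\<lambda>v. (\<Sum>l\<le>i. s l (P v, Q v) * hmon i l v) + (\<Sum>l<m - i - 1. t l (P v, Q v) * B l v))"
    by blast
  let ?s = "\<lambda>l\<in>{..<i + 1}. \<lambda>v\<in>cone V. s l v / N v"
  let ?t = "\<lambda>l\<in>{..<m - i - 1}. \<lambda>v\<in>cone V. t l v / N v"
  have "S = assemble i B V (?s, ?t)"
  proof (rule extensionalityI[OF _ assemble_extensional])
    fix v assume v: "v \<in> cone (f -` V)"
    then have PQ: "(P v, Q v) \<in> cone V"
      by (simp add: cone_vimage)
    have "assemble i B V (?s, ?t) v = F v * H v / N (P v, Q v)"
      using fun_cong[OF st(4), of v] PQ
      by (simp add: assemble_apply[OF v] add_divide_distrib sum_divide_distrib)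
    also have "\<dots> = F v / G v"
      using N_nz[OF PQ] HN(4)[of v] by simp
    finally show "S v = assemble i B V (?s, ?t) v"
      using FG(7)[OF v] by simp
  qed (use assms(4) in \<open>auto simp: twist_sections_def\<close>)
  moreover have "(?s, ?t) \<in> summand_families i q V"
  proof -
    have "(\<lambda>v\<in>cone V. s l v / N v) \<in> twist_sections q V" for l
      using r N_nz by (intro fraction_in_twist_sections[OF assms(3) st(1) HN(1)]) auto
    moreover have "(\<lambda>v\<in>cone V. t l v / N v) \<in> twist_sections (q - 1) V" for l
    \<comment> \<open>For \<open>r = 0\<close> the degree of \<open>t l\<close> is not
      \<open>q - 1 + e = -1\<close>, so the quotient is no fraction of the right twist; it is a
      section because \<open>t l\<close> is zero.\<close>
    proof (cases "r = 0")
      case True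
      then show ?thesis
        using st(3) zero_in_twist_sections[OF assms(3)] by simp
    next
      case False
      then show ?thesis
        using r N_nz by (intro fraction_in_twist_sections[OF assms(3) st(2) HN(1)]) auto
    qed
    ultimately show ?thesis by auto
  qed
  ultimately show ?thesis
    by (rule image_eqI)
qed

lemma direct_image_iso:
  assumes "i < m"
  shows "direct_image f \<O>(q * int m + int i) \<cong>\<^sub>\<O> \<O>(q)\<^bsup>\<oplus>(i + 1)\<^esup> \<oplus>\<^sub>\<O> \<O>(q - 1)\<^bsup>\<oplus>(m - i - 1)\<^esup>"
proof -
  obtain B where B: "complement_basis i B"
    using complement_basis_exists[OF assms] .
  note defs = direct_image_def sheaf_sum_def sheaf_power_def twisting_sheaf_def
  show ?thesis
  proof (rule sheaf_iso_if_inverse[where \<psi> = "assemble i B"])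
    fix U :: "'a proj_line set" assume U: "open U"
    have "bij_betw (assemble i B U) (summand_families i q U) (twist_sections (q * int m + int i) (f -` U))"
      unfolding bij_betw_def
      using assemble_inj[OF B assms U] assemble_in_twist_sections[OF B assms U] assemble_surj[OF B assms U]
      by blast
    then show "bij_betw (assemble i B U) (carrier (sections (\<O>(q)\<^bsup>\<oplus>(i + 1)\<^esup> \<oplus>\<^sub>\<O> \<O>(q - 1)\<^bsup>\<oplus>(m - i - 1)\<^esup>) U))
        (carrier (sections (direct_image f \<O>(q * int m + int i)) U))"
      by (simp add: defs)
  next
    fix U :: "'a proj_line set" and x y
    assume U: "open U"
      and "x \<in> carrier (sections (\<O>(q)\<^bsup>\<oplus>(i + 1)\<^esup> \<oplus>\<^sub>\<O> \<O>(q - 1)\<^bsup>\<oplus>(m - i - 1)\<^esup>) U)"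
      and "y \<in> carrier (sections (\<O>(q)\<^bsup>\<oplus>(i + 1)\<^esup> \<oplus>\<^sub>\<O> \<O>(q - 1)\<^bsup>\<oplus>(m - i - 1)\<^esup>) U)"
    then have xy: "x \<in> summand_families i q U" "y \<in> summand_families i q U"
      by (simp_all add: defs)
    obtain s t s' t' where st: "x = (s, t)" "y = (s', t')"
      by (cases x, cases y)
    have "assemble i B U (\<lambda>l\<in>{..<i + 1}. \<lambda>v\<in>cone U. s l v + s' l v, \<lambda>l\<in>{..<m - i - 1}. \<lambda>v\<in>cone U. t l v + t' l v)
        = (\<lambda>v\<in>cone (f -` U). assemble i B U (s, t) v + assemble i B U (s', t') v)"
      by (rule extensionalityI[OF assemble_extensional])
        (auto simp: assemble_apply cone_vimage algebra_simps sum.distrib)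
    then show "x \<oplus>\<^bsub>sections (\<O>(q)\<^bsup>\<oplus>(i + 1)\<^esup> \<oplus>\<^sub>\<O> \<O>(q - 1)\<^bsup>\<oplus>(m - i - 1)\<^esup>) U\<^esub> y
          \<in> carrier (sections (\<O>(q)\<^bsup>\<oplus>(i + 1)\<^esup> \<oplus>\<^sub>\<O> \<O>(q - 1)\<^bsup>\<oplus>(m - i - 1)\<^esup>) U) \<and>
        assemble i B U (x \<oplus>\<^bsub>sections (\<O>(q)\<^bsup>\<oplus>(i + 1)\<^esup> \<oplus>\<^sub>\<O> \<O>(q - 1)\<^bsup>\<oplus>(m - i - 1)\<^esup>) U\<^esub> y) =
        assemble i B U x \<oplus>\<^bsub>sections (direct_image f \<O>(q * int m + int i)) U\<^esub> assemble i B U y"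
      using xy unfolding st
      by (auto simp: defs intro!: add_in_twist_sections)
  next
    fix U :: "'a proj_line set" and g x
    assume U: "open U" and g: "g \<in> regular_functions U"
      and "x \<in> carrier (sections (\<O>(q)\<^bsup>\<oplus>(i + 1)\<^esup> \<oplus>\<^sub>\<O> \<O>(q - 1)\<^bsup>\<oplus>(m - i - 1)\<^esup>) U)"
    then have x: "x \<in> summand_families i q U"
      by (simp add: defs)
    obtain s t where st: "x = (s, t)"
      by (cases x)
    have fv: "f (abs_proj_line v) = abs_proj_line (P v, Q v)" "abs_proj_line v \<in> f -` U"
      if "v \<in> cone (f -` U)" for v
      using that f_abs unfolding mem_cone by blast+
    \<comment> \<open>On the direct image \<open>g\<close> acts through its pullback, whose value at
      the class of \<open>v\<close> is that of \<open>g\<close> at the class of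
      \<open>(P v, Q v)\<close>; this is the factor that the coefficients pick up under
      substitution.\<close>
    have "assemble i B U (\<lambda>l\<in>{..<i + 1}. \<lambda>v\<in>cone U. g (abs_proj_line v) * s l v,
          \<lambda>l\<in>{..<m - i - 1}. \<lambda>v\<in>cone U. g (abs_proj_line v) * t l v)
        = (\<lambda>v\<in>cone (f -` U). pullback f U g (abs_proj_line v) * assemble i B U (s, t) v)"
    proof (rule extensionalityI[OF assemble_extensional])
      fix v assume v: "v \<in> cone (f -` U)"
      then have "(P v, Q v) \<in> cone U"
        by (simp add: cone_vimage)
      then show "assemble i B U (\<lambda>l\<in>{..<i + 1}. \<lambda>v\<in>cone U. g (abs_proj_line v) * s l v,
          \<lambda>l\<in>{..<m - i - 1}. \<lambda>v\<in>cone U. g (abs_proj_line v) * t l v) v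
        = (\<lambda>v\<in>cone (f -` U). pullback f U g (abs_proj_line v) * assemble i B U (s, t) v) v"
        using v fv[OF v] by (simp add: assemble_apply pullback_def distrib_left sum_distrib_left mult.assoc)
    qed simp
    then show "g \<odot>\<^bsub>sections (\<O>(q)\<^bsup>\<oplus>(i + 1)\<^esup> \<oplus>\<^sub>\<O> \<O>(q - 1)\<^bsup>\<oplus>(m - i - 1)\<^esup>) U\<^esub> x
          \<in> carrier (sections (\<O>(q)\<^bsup>\<oplus>(i + 1)\<^esup> \<oplus>\<^sub>\<O> \<O>(q - 1)\<^bsup>\<oplus>(m - i - 1)\<^esup>) U) \<and>
        assemble i B U (g \<odot>\<^bsub>sections (\<O>(q)\<^bsup>\<oplus>(i + 1)\<^esup> \<oplus>\<^sub>\<O> \<O>(q - 1)\<^bsup>\<oplus>(m - i - 1)\<^esup>) U\<^esub> x) =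
        g \<odot>\<^bsub>sections (direct_image f \<O>(q * int m + int i)) U\<^esub> assemble i B U x"
      using x g unfolding st
      by (auto simp: defs intro!: smult_in_twist_sections)
  next
    fix U V :: "'a proj_line set" and x
    assume UV: "open U" "open V" "V \<subseteq> U"
      and "x \<in> carrier (sections (\<O>(q)\<^bsup>\<oplus>(i + 1)\<^esup> \<oplus>\<^sub>\<O> \<O>(q - 1)\<^bsup>\<oplus>(m - i - 1)\<^esup>) U)"
    then have x: "x \<in> summand_families i q U"
      by (simp add: defs)
    obtain s t where st: "x = (s, t)"
      by (cases x)
    have "assemble i B V (\<lambda>l\<in>{..<i + 1}. restrict (s l) (cone V), \<lambda>l\<in>{..<m - i - 1}. restrict (t l) (cone V))
        = restrict (assemble i B U (s, t)) (cone (f -` V))"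
    proof (rule extensionalityI[OF assemble_extensional])
      fix v assume v: "v \<in> cone (f -` V)"
      then have "(P v, Q v) \<in> cone V"
        by (simp add: cone_vimage)
      moreover have "v \<in> cone (f -` U)"
        using v UV(3) by (auto simp: mem_cone)
      ultimately show "assemble i B V (\<lambda>l\<in>{..<i + 1}. restrict (s l) (cone V), \<lambda>l\<in>{..<m - i - 1}. restrict (t l) (cone V)) v
        = restrict (assemble i B U (s, t)) (cone (f -` V)) v"
        using v by (simp add: assemble_apply)
    qed simp
    then show "restriction (\<O>(q)\<^bsup>\<oplus>(i + 1)\<^esup> \<oplus>\<^sub>\<O> \<O>(q - 1)\<^bsup>\<oplus>(m - i - 1)\<^esup>) U V x
          \<in> carrier (sections (\<O>(q)\<^bsup>\<oplus>(i + 1)\<^esup> \<oplus>\<^sub>\<O> \<O>(q - 1)\<^bsup>\<oplus>(m - i - 1)\<^esup>) V) \<and>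
        assemble i B V (restriction (\<O>(q)\<^bsup>\<oplus>(i + 1)\<^esup> \<oplus>\<^sub>\<O> \<O>(q - 1)\<^bsup>\<oplus>(m - i - 1)\<^esup>) U V x) =
        restriction (direct_image f \<O>(q * int m + int i)) U V (assemble i B U x)"
      using x UV unfolding st
      by (auto simp: defs intro!: restrict_in_twist_sections)
  qed
qed

end

subsection \<open>The function field\<close>

lemma regular_functions_local:
  assumes "g \<in> regular_functions U" "p \<in> U"
  obtains W d F G where "open W" "p \<in> W" "W \<subseteq> U" "F \<in> forms d" "G \<in> forms d"
    "\<And>v. v \<in> cone W \<Longrightarrow> G v \<noteq> 0" "\<And>v. v \<in> cone W \<Longrightarrow> g (abs_proj_line v) = F v / G v"
proof -
  obtain W d F G where "open W \<and> p \<in> W \<and> W \<subseteq> U \<and> F \<in> forms d \<and> G \<in> forms d \<and>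
      (\<forall>v\<in>cone W. G v \<noteq> 0 \<and> g (abs_proj_line v) = F v / G v)"
    using assms unfolding regular_functions_def by auto
  then show ?thesis
    by (intro that[of W F d G]) auto
qed

text \<open>Through this passage to twist 0, sums, products and restrictions of regular functions
  are inherited from the twisting sheaves.\<close>

lemma regular_functionsI_twist:
  assumes "g \<in> extensional U" "(\<lambda>v\<in>cone U. g (abs_proj_line v)) \<in> twist_sections 0 U"
  shows "g \<in> regular_functions U"
proof -
  have "\<exists>W d F G. open W \<and> p \<in> W \<and> W \<subseteq> U \<and> F \<in> forms d \<and> G \<in> forms d \<and>
      (\<forall>v\<in>cone W. G v \<noteq> 0 \<and> g (abs_proj_line v) = F v / G v)" if "p \<in> U" for p
  proof -
    obtain v where v: "v \<noteq> (0, 0)" "p = abs_proj_line v"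
      by (rule abs_proj_line_cases)
    then have "v \<in> cone U"
      using that by (simp add: mem_cone)
    with assms(2) obtain W d e F G where loc: "open W" "abs_proj_line v \<in> W" "W \<subseteq> U" "F \<in> forms d" "G \<in> forms e"
      "int d - int e = 0" "\<And>w. w \<in> cone W \<Longrightarrow> G w \<noteq> 0"
      "\<And>w. w \<in> cone W \<Longrightarrow> (\<lambda>v\<in>cone U. g (abs_proj_line v)) w = F w / G w"
      by (rule twist_sectionsE) blast
    have "g (abs_proj_line w) = F w / G w" if "w \<in> cone W" for w
      using loc(8)[OF that] loc(3) that by (auto simp: mem_cone split: if_splits)
    moreover have "e = d"
      using loc(6) by simp
    ultimately show ?thesis
      using loc(1-5,7) v(2)
      by (intro exI[of _ W] exI[of _ d] exI[of _ F] exI[of _ G]) auto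
  qed
  then show ?thesis
    using assms(1) unfolding regular_functions_def by auto
qed

lemma regular_function_restrict:
  assumes "g \<in> regular_functions U" "open V" "V \<subseteq> U"
  shows "restrict g V \<in> regular_functions V"
proof (rule regular_functionsI_twist)
  have "restrict (\<lambda>v\<in>cone U. g (abs_proj_line v)) (cone V) \<in> twist_sections 0 V"
    by (rule restrict_in_twist_sections[OF regular_function_in_twist_sections[OF assms(1)] assms(2,3)])
  moreover have "restrict (\<lambda>v\<in>cone U. g (abs_proj_line v)) (cone V) = (\<lambda>v\<in>cone V. restrict g V (abs_proj_line v))"
    by (rule extensionalityI[of _ "cone V"]) (use assms(3) in \<open>auto simp: mem_cone\<close>)
  ultimately show "(\<lambda>v\<in>cone V. restrict g V (abs_proj_line v)) \<in> twist_sections 0 V"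
    by (simp only:)
qed simp

lemma regular_function_add:
  assumes "g \<in> regular_functions U" "h \<in> regular_functions U"
  shows "(\<lambda>p\<in>U. g p + h p) \<in> regular_functions U"
proof (rule regular_functionsI_twist)
  have "(\<lambda>v\<in>cone U. (\<lambda>v\<in>cone U. g (abs_proj_line v)) v + (\<lambda>v\<in>cone U. h (abs_proj_line v)) v) \<in> twist_sections 0 U"
    using assms by (intro add_in_twist_sections[OF regular_function_in_twist_sections regular_function_in_twist_sections])
  moreover have "(\<lambda>v\<in>cone U. (\<lambda>v\<in>cone U. g (abs_proj_line v)) v + (\<lambda>v\<in>cone U. h (abs_proj_line v)) v)
      = (\<lambda>v\<in>cone U. (\<lambda>p\<in>U. g p + h p) (abs_proj_line v))"
    by (auto simp: restrict_def mem_cone)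
  ultimately show "(\<lambda>v\<in>cone U. (\<lambda>p\<in>U. g p + h p) (abs_proj_line v)) \<in> twist_sections 0 U"
    by (simp only:)
qed simp

lemma regular_function_mult:
  assumes "g \<in> regular_functions U" "h \<in> regular_functions U"
  shows "(\<lambda>p\<in>U. g p * h p) \<in> regular_functions U"
proof (rule regular_functionsI_twist)
  have "(\<lambda>v\<in>cone U. (\<lambda>v\<in>cone U. g (abs_proj_line v)) v * (\<lambda>v\<in>cone U. h (abs_proj_line v)) v) \<in> twist_sections (0 + 0) U"
    using assms by (intro mult_in_twist_sections[OF regular_function_in_twist_sections regular_function_in_twist_sections])
  moreover have "(\<lambda>v\<in>cone U. (\<lambda>v\<in>cone U. g (abs_proj_line v)) v * (\<lambda>v\<in>cone U. h (abs_proj_line v)) v)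
      = (\<lambda>v\<in>cone U. (\<lambda>p\<in>U. g p * h p) (abs_proj_line v))"
    by (auto simp: restrict_def mem_cone)
  ultimately show "(\<lambda>v\<in>cone U. (\<lambda>p\<in>U. g p * h p) (abs_proj_line v)) \<in> twist_sections 0 U"
    by (simp only: add_0)
qed simp

text \<open>The identity principle: by irreducibility the domains of two local fractions at
  \<open>p\<close> meet \<open>A\<close>, so the cross products agree there and hence as forms, and
  this decides the values at \<open>p\<close>.\<close>

lemma regular_functions_agree:
  fixes g h :: "'k::alg_closed_field proj_line \<Rightarrow> 'k"
  assumes "g \<in> regular_functions U" "h \<in> regular_functions V" "open A" "A \<noteq> {}"
    and "\<And>p. p \<in> A \<Longrightarrow> p \<in> U \<Longrightarrow> p \<in> V \<Longrightarrow> g p = h p" "p \<in> U" "p \<in> V"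
  shows "g p = h p"
proof -
  obtain W d F G where 1: "open W" "p \<in> W" "W \<subseteq> U" "F \<in> forms d" "G \<in> forms d"
    "\<And>v. v \<in> cone W \<Longrightarrow> G v \<noteq> 0" "\<And>v. v \<in> cone W \<Longrightarrow> g (abs_proj_line v) = F v / G v"
    using assms(1,6) by (rule regular_functions_local) blast
  obtain W' d' F' G' where 2: "open W'" "p \<in> W'" "W' \<subseteq> V" "F' \<in> forms d'" "G' \<in> forms d'"
    "\<And>v. v \<in> cone W' \<Longrightarrow> G' v \<noteq> 0" "\<And>v. v \<in> cone W' \<Longrightarrow> h (abs_proj_line v) = F' v / G' v"
    using assms(2,7) by (rule regular_functions_local) blast
  have "W \<inter> W' \<noteq> {}"
    using 1(2) 2(2) by blast
  then have "open (W \<inter> W' \<inter> A)" "W \<inter> W' \<inter> A \<noteq> {}"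
    using 1(1) 2(1) assms(3,4) open_Int_nonempty[of "W \<inter> W'" A] by auto
  moreover have "F v * G' v = F' v * G v" if "v \<in> cone (W \<inter> W' \<inter> A)" for v
  proof -
    have v: "v \<in> cone W" "v \<in> cone W'" "abs_proj_line v \<in> A" "abs_proj_line v \<in> U" "abs_proj_line v \<in> V"
      using that 1(3) 2(3) by (auto simp: mem_cone)
    then have "F v / G v = F' v / G' v"
      using 1(7) 2(7) assms(5) by metis
    then show ?thesis
      using 1(6) 2(6) v(1,2) by (simp add: frac_eq_eq)
  qed
  moreover have "(\<lambda>v. F' v * G v) \<in> forms (d + d')"
    using mult_in_forms[OF 2(4) 1(5)] by (simp add: add.commute)
  ultimately have eq: "(\<lambda>v. F v * G' v) = (\<lambda>v. F' v * G v)"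
    using forms_eq_if_eq_on_open[OF mult_in_forms[OF 1(4) 2(5)]] by blast
  obtain v where v: "v \<noteq> (0, 0)" "p = abs_proj_line v"
    by (rule abs_proj_line_cases)
  then have "v \<in> cone W" "v \<in> cone W'"
    using 1(2) 2(2) by (auto simp: mem_cone)
  then show ?thesis
    using 1(6,7) 2(6,7) v(2) fun_cong[OF eq, of v] by (simp add: frac_eq_eq)
qed

lemma rational_rel_commute: "(x, y) \<in> rational_rel \<longleftrightarrow> (y, x) \<in> rational_rel"
  by (auto simp: rational_rel_def)

lemma equiv_rational_rel: "equiv rational_pairs (rational_rel :: (('k::alg_closed_field proj_line set \<times> _) \<times> _) set)"
proof (rule equivI)
  show "refl_on rational_pairs (rational_rel :: (('k proj_line set \<times> _) \<times> _) set)"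
    by (auto simp: refl_on_def rational_rel_def)
  show "rational_rel \<subseteq> rational_pairs \<times> (rational_pairs :: ('k proj_line set \<times> _) set)"
    by (auto simp: rational_rel_def)
  show "sym (rational_rel :: (('k proj_line set \<times> _) \<times> _) set)"
    by (auto simp: sym_def rational_rel_def)
  show "trans (rational_rel :: (('k proj_line set \<times> _) \<times> _) set)"
  proof (rule transI)
    fix x y z :: "'k proj_line set \<times> ('k proj_line \<Rightarrow> 'k)"
    assume xy: "(x, y) \<in> rational_rel" and yz: "(y, z) \<in> rational_rel"
    obtain U g V h W k where [simp]: "x = (U, g)" "y = (V, h)" "z = (W, k)"
      by (cases x, cases y, cases z)
    have pairs: "(U, g) \<in> rational_pairs" "(V, h) \<in> rational_pairs" "(W, k) \<in> rational_pairs"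
      and eqs: "\<forall>p\<in>U \<inter> V. g p = h p" "\<forall>p\<in>V \<inter> W. h p = k p"
      using xy yz by (auto simp: rational_rel_def)
    \<comment> \<open>Transitivity is not immediate, since \<open>p\<close> may lie outside
      \<open>V\<close>. The comparison through \<open>h\<close> works on \<open>V\<close>, and the
      identity principle extends it.\<close>
    have "g p = k p" if "p \<in> U" "p \<in> W" for p
      using regular_functions_agree[of g U k W V p] pairs eqs that by (auto simp: rational_pairs_def)
    then show "(x, z) \<in> rational_rel"
      using pairs by (auto simp: rational_rel_def)
  qed
qed

section \<open>Fractions of forms as elements of the function field\<close>

definition valid_fraction :: "('k::field \<times> 'k \<Rightarrow> 'k) \<Rightarrow> ('k \<times> 'k \<Rightarrow> 'k) \<Rightarrow> bool"
  where "valid_fraction F G \<longleftrightarrow> (\<exists>d. F \<in> forms d \<and> G \<in> forms d \<and> G \<noteq> (\<lambda>_. 0))"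

definition form_quotient where
  "form_quotient F G = rational_rel `` {(nonvanishing G, restrict (ratio F G) (nonvanishing G))}"

lemma valid_fraction_pair:
  fixes F :: "'k::alg_closed_field \<times> 'k \<Rightarrow> 'k"
  assumes "valid_fraction F G"
  shows "(nonvanishing G, restrict (ratio F G) (nonvanishing G)) \<in> rational_pairs"
proof -
  obtain d where "F \<in> forms d" "G \<in> forms d" "G \<noteq> (\<lambda>_. 0)"
    using assms unfolding valid_fraction_def by blast
  then show ?thesis
    using ratio_regular[OF _ _ open_nonvanishing subset_refl, of F d G d] open_nonvanishing[of G d]
      nonvanishing_nonempty[of G d] by (simp add: rational_pairs_def)
qed

lemma valid_fraction_value:
  assumes "valid_fraction F G" "v \<noteq> (0, 0)"
  shows "abs_proj_line v \<in> nonvanishing G \<longleftrightarrow> G v \<noteq> 0"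
    and "ratio F G (abs_proj_line v) = F v / G v"
  using assms mem_nonvanishing ratio_abs unfolding valid_fraction_def by blast+

lemma related_fraction_iff:
  fixes F :: "'k::alg_closed_field \<times> 'k \<Rightarrow> 'k"
  assumes "valid_fraction F G"
  shows "((U, g), (nonvanishing G, restrict (ratio F G) (nonvanishing G))) \<in> rational_rel \<longleftrightarrow>
    (U, g) \<in> rational_pairs \<and> (\<forall>v\<in>cone U. G v \<noteq> 0 \<longrightarrow> g (abs_proj_line v) = F v / G v)"
proof -
  have "(\<forall>p\<in>U \<inter> nonvanishing G. g p = restrict (ratio F G) (nonvanishing G) p) \<longleftrightarrow>
      (\<forall>v\<in>cone U. G v \<noteq> 0 \<longrightarrow> g (abs_proj_line v) = F v / G v)"
  proof (intro iffI ballI impI)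
    fix v assume *: "\<forall>p\<in>U \<inter> nonvanishing G. g p = restrict (ratio F G) (nonvanishing G) p"
      and "v \<in> cone U" "G v \<noteq> 0"
    then show "g (abs_proj_line v) = F v / G v"
      using valid_fraction_value[OF assms, of v] bspec[OF *, of "abs_proj_line v"] by (simp add: mem_cone)
  next
    fix p assume *: "\<forall>v\<in>cone U. G v \<noteq> 0 \<longrightarrow> g (abs_proj_line v) = F v / G v"
      and p: "p \<in> U \<inter> nonvanishing G"
    obtain v where v: "v \<noteq> (0, 0)" "p = abs_proj_line v"
      by (rule abs_proj_line_cases)
    then show "g p = restrict (ratio F G) (nonvanishing G) p"
      using valid_fraction_value[OF assms, of v] bspec[OF *, of v] p by (simp add: mem_cone)
  qed
  then show ?thesis
    using valid_fraction_pair[OF assms] by (simp add: rational_rel_def)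
qed

lemma mem_form_quotient_iff:
  fixes F :: "'k::alg_closed_field \<times> 'k \<Rightarrow> 'k"
  assumes "valid_fraction F G"
  shows "(U, g) \<in> form_quotient F G \<longleftrightarrow> (U, g) \<in> rational_pairs \<and> (\<forall>v\<in>cone U. G v \<noteq> 0 \<longrightarrow> g (abs_proj_line v) = F v / G v)"
  unfolding form_quotient_def related_fraction_iff[OF assms, symmetric]
  by (simp add: rational_rel_commute)

lemma class_eq_form_quotient:
  fixes F :: "'k::alg_closed_field \<times> 'k \<Rightarrow> 'k"
  assumes "valid_fraction F G" "(U, g) \<in> rational_pairs"
    "\<And>v. v \<in> cone U \<Longrightarrow> G v \<noteq> 0 \<Longrightarrow> g (abs_proj_line v) = F v / G v"
  shows "rational_rel `` {(U, g)} = form_quotient F G"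
  unfolding form_quotient_def
  using assms by (intro equiv_class_eq[OF equiv_rational_rel]) (simp add: related_fraction_iff)

text \<open>This identifies the function field with the fractions of forms of equal degree: after
  cross multiplication every equation in it is an identity of forms.\<close>

lemma form_quotient_eq_iff:
  fixes F :: "'k::alg_closed_field \<times> 'k \<Rightarrow> 'k"
  assumes "valid_fraction F G" "valid_fraction F' G'"
  shows "form_quotient F G = form_quotient F' G' \<longleftrightarrow> (\<forall>v. F v * G' v = F' v * G v)"
proof
  obtain d where FG: "F \<in> forms d" "G \<in> forms d" "G \<noteq> (\<lambda>_. 0)"
    using assms(1) unfolding valid_fraction_def by blast
  obtain d' where FG': "F' \<in> forms d'" "G' \<in> forms d'" "G' \<noteq> (\<lambda>_. 0)"
    using assms(2) unfolding valid_fraction_def by blast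
  assume eq: "form_quotient F G = form_quotient F' G'"
  have "((nonvanishing G, restrict (ratio F G) (nonvanishing G)),
      (nonvanishing G', restrict (ratio F' G') (nonvanishing G'))) \<in> rational_rel"
    using eq_equiv_class[OF eq[unfolded form_quotient_def] equiv_rational_rel valid_fraction_pair[OF assms(2)]] .
  then have *: "F v / G v = F' v / G' v" if "v \<noteq> (0, 0)" "G v \<noteq> 0" "G' v \<noteq> 0" for v
    using valid_fraction_value[OF assms(1) that(1)] that
    unfolding related_fraction_iff[OF assms(2)] by (simp add: mem_cone)
  let ?U = "nonvanishing G \<inter> nonvanishing G'"
  have "open ?U" "?U \<noteq> {}"
    using open_nonvanishing[OF FG(2)] open_nonvanishing[OF FG'(2)] nonvanishing_nonempty[OF FG(2,3)]
      nonvanishing_nonempty[OF FG'(2,3)] open_Int_nonempty by auto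
  moreover have "F v * G' v = F' v * G v" if "v \<in> cone ?U" for v
  proof -
    have "v \<noteq> (0, 0)" "G v \<noteq> 0" "G' v \<noteq> 0"
      using that mem_nonvanishing[OF FG(2), of v] mem_nonvanishing[OF FG'(2), of v] by (auto simp: mem_cone)
    then show ?thesis
      using *[of v] by (simp add: frac_eq_eq)
  qed
  moreover have "(\<lambda>v. F' v * G v) \<in> forms (d + d')"
    using mult_in_forms[OF FG'(1) FG(2)] by (simp add: add.commute)
  ultimately have "(\<lambda>v. F v * G' v) = (\<lambda>v. F' v * G v)"
    using forms_eq_if_eq_on_open[OF mult_in_forms[OF FG(1) FG'(2)]] by blast
  then show "\<forall>v. F v * G' v = F' v * G v"
    by (simp add: fun_eq_iff)
next
  assume eq: "\<forall>v. F v * G' v = F' v * G v"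
  have "restrict (ratio F G) (nonvanishing G) (abs_proj_line v) = F' v / G' v"
    if "v \<in> cone (nonvanishing G)" "G' v \<noteq> 0" for v
    using valid_fraction_value[OF assms(1), of v] that spec[OF eq, of v] by (simp add: mem_cone frac_eq_eq)
  then show "form_quotient F G = form_quotient F' G'"
    unfolding form_quotient_def[of F G]
    using valid_fraction_pair[OF assms(1)] by (intro class_eq_form_quotient[OF assms(2)])
qed

lemma form_quotient_in_carrier:
  fixes F :: "'k::alg_closed_field \<times> 'k \<Rightarrow> 'k"
  assumes "valid_fraction F G"
  shows "form_quotient F G \<in> carrier function_field"
  using valid_fraction_pair[OF assms] by (simp add: function_field_def form_quotient_def quotientI)

lemma valid_fraction_const: "valid_fraction (\<lambda>_. a) (\<lambda>_. 1)"
  using const_in_forms unfolding valid_fraction_def by (auto simp: fun_eq_iff)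

text \<open>Lowest terms provide one fraction for a whole representative; the zero function has none
  and is represented by \<open>0 / 1\<close>.\<close>

lemma function_field_cases:
  fixes X :: "('k::alg_closed_field proj_line set \<times> _) set"
  assumes "X \<in> carrier function_field"
  obtains F G where "valid_fraction F G" "X = form_quotient F G"
proof -
  obtain U g where Ug: "(U, g) \<in> rational_pairs" "X = rational_rel `` {(U, g)}"
    using assms by (auto simp: function_field_def elim!: quotientE)
  then have U: "open U" "U \<noteq> {}" "g \<in> regular_functions U"
    by (auto simp: rational_pairs_def)
  show ?thesis
  proof (cases "\<exists>p\<in>U. g p \<noteq> 0")
    case True
    with U(2,3) obtain d F G where FG: "F \<in> forms d" "G \<in> forms d" "F \<noteq> (\<lambda>_. 0)"
      "\<And>v. v \<noteq> (0, 0) \<Longrightarrow> F v = 0 \<Longrightarrow> G v \<noteq> 0"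
      "\<And>v. v \<in> cone U \<Longrightarrow> G v \<noteq> 0" "\<And>v. v \<in> cone U \<Longrightarrow> g (abs_proj_line v) = F v / G v"
      by (rule regular_function_eq_ratio) blast
    obtain p where "p \<in> U"
      using U(2) by blast
    moreover obtain v where "v \<noteq> (0, 0)" "p = abs_proj_line v"
      by (rule abs_proj_line_cases)
    ultimately have "G v \<noteq> 0"
      using FG(5) by (simp add: mem_cone)
    then have "valid_fraction F G"
      using FG(1,2) unfolding valid_fraction_def by auto
    then show ?thesis
      using that class_eq_form_quotient[OF _ Ug(1) FG(6)] Ug(2) by blast
  next
    case False
    then have "rational_rel `` {(U, g)} = form_quotient (\<lambda>_. 0) (\<lambda>_. 1)"
      by (intro class_eq_form_quotient[OF valid_fraction_const Ug(1)]) (auto simp: mem_cone)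
    then show ?thesis
      using that valid_fraction_const Ug(2) by blast
  qed
qed

lemma form_quotient_const: "form_quotient (\<lambda>_. a) (\<lambda>_. 1) = rational_rel `` {(UNIV :: 'k::alg_closed_field proj_line set, \<lambda>_. a)}"
proof -
  have "nonvanishing (\<lambda>_. 1) = (UNIV :: 'k proj_line set)"
    using cone_nonempty by (auto simp: nonvanishing_def zero_locus_def)
  moreover have "ratio (\<lambda>_. a) (\<lambda>_. 1) = (\<lambda>_. a)"
    by (simp add: ratio_def fun_eq_iff)
  ultimately show ?thesis
    by (simp add: form_quotient_def restrict_UNIV)
qed

lemma zero_function_field: "\<zero>\<^bsub>function_field\<^esub> = form_quotient (\<lambda>_. 0 :: 'k::alg_closed_field) (\<lambda>_. 1)"
  and one_function_field: "\<one>\<^bsub>function_field\<^esub> = form_quotient (\<lambda>_. 1 :: 'k::alg_closed_field) (\<lambda>_. 1)"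
  by (simp_all add: function_field_def form_quotient_const)

lemma valid_fraction_mult_denominator:
  fixes F :: "'k::alg_closed_field \<times> 'k \<Rightarrow> 'k"
  assumes "valid_fraction F G" "valid_fraction F' G'"
  shows "valid_fraction (\<lambda>v. F v * F' v) (\<lambda>v. G v * G' v)"
    and "valid_fraction (\<lambda>v. F v * G' v + F' v * G v) (\<lambda>v. G v * G' v)"
proof -
  obtain d where FG: "F \<in> forms d" "G \<in> forms d" "G \<noteq> (\<lambda>_. 0)"
    using assms(1) unfolding valid_fraction_def by blast
  obtain d' where FG': "F' \<in> forms d'" "G' \<in> forms d'" "G' \<noteq> (\<lambda>_. 0)"
    using assms(2) unfolding valid_fraction_def by blast
  have GG: "(\<lambda>v. G v * G' v) \<in> forms (d + d')" "(\<lambda>v. G v * G' v) \<noteq> (\<lambda>_. 0)"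
    using mult_in_forms[OF FG(2) FG'(2)] forms_no_zero_divisors[OF FG(2) FG'(2)] FG(3) FG'(3)
    by (auto simp: fun_eq_iff)
  show "valid_fraction (\<lambda>v. F v * F' v) (\<lambda>v. G v * G' v)"
    using GG mult_in_forms[OF FG(1) FG'(1)] unfolding valid_fraction_def by blast
  have "(\<lambda>v. F' v * G v) \<in> forms (d + d')"
    using mult_in_forms[OF FG'(1) FG(2)] by (simp add: add.commute)
  then show "valid_fraction (\<lambda>v. F v * G' v + F' v * G v) (\<lambda>v. G v * G' v)"
    using GG add_in_forms[OF mult_in_forms[OF FG(1) FG'(2)]] unfolding valid_fraction_def by blast
qed

text \<open>The operations are defined as unions over all pairs of representatives. Each pair yields
  the same class, so the union collapses to it. The parameter \<open>b\<close> stands for addition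
  or multiplication.\<close>

lemma lift_operation_form_quotient:
  fixes F :: "'k::alg_closed_field \<times> 'k \<Rightarrow> 'k"
  assumes "valid_fraction F G" "valid_fraction F' G'" "valid_fraction H (\<lambda>v. G v * G' v)"
    and reg: "\<And>U g h. g \<in> regular_functions U \<Longrightarrow> h \<in> regular_functions U \<Longrightarrow>
      (\<lambda>p\<in>U. b (g p) (h p)) \<in> regular_functions U"
    and val: "\<And>v. G v \<noteq> 0 \<Longrightarrow> G' v \<noteq> 0 \<Longrightarrow> b (F v / G v) (F' v / G' v) = H v / (G v * G' v)"
  shows "(\<Union>(U, g)\<in>form_quotient F G. \<Union>(V, h)\<in>form_quotient F' G'. rational_rel `` {(U \<inter> V, \<lambda>p\<in>U \<inter> V. b (g p) (h p))})
    = form_quotient H (\<lambda>v. G v * G' v)"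
proof -
  have *: "rational_rel `` {(U \<inter> V, \<lambda>p\<in>U \<inter> V. b (g p) (h p))} = form_quotient H (\<lambda>v. G v * G' v)"
    if Ug: "(U, g) \<in> form_quotient F G" and Vh: "(V, h) \<in> form_quotient F' G'" for U g V h
  proof (rule class_eq_form_quotient[OF assms(3)])
    note 1 = Ug[unfolded mem_form_quotient_iff[OF assms(1)]] and 2 = Vh[unfolded mem_form_quotient_iff[OF assms(2)]]
    have op: "open U" "U \<noteq> {}" "g \<in> regular_functions U" "open V" "V \<noteq> {}" "h \<in> regular_functions V"
      using 1 2 by (auto simp: rational_pairs_def)
    then have UV: "open (U \<inter> V)" "U \<inter> V \<noteq> {}"
      using open_Int_nonempty by auto
    have "(\<lambda>p\<in>U \<inter> V. b (restrict g (U \<inter> V) p) (restrict h (U \<inter> V) p)) \<in> regular_functions (U \<inter> V)"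
      by (rule reg[OF regular_function_restrict[OF op(3) UV(1)] regular_function_restrict[OF op(6) UV(1)]]) auto
    moreover have "(\<lambda>p\<in>U \<inter> V. b (restrict g (U \<inter> V) p) (restrict h (U \<inter> V) p)) = (\<lambda>p\<in>U \<inter> V. b (g p) (h p))"
      by (auto simp: restrict_def)
    ultimately have "(\<lambda>p\<in>U \<inter> V. b (g p) (h p)) \<in> regular_functions (U \<inter> V)"
      by (simp only:)
    then show "(U \<inter> V, \<lambda>p\<in>U \<inter> V. b (g p) (h p)) \<in> rational_pairs"
      using UV by (simp add: rational_pairs_def)
    fix v assume v: "v \<in> cone (U \<inter> V)" "G v * G' v \<noteq> 0"
    then have "v \<in> cone U" "v \<in> cone V" "G v \<noteq> 0" "G' v \<noteq> 0"
      by (auto simp: mem_cone)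
    then have "g (abs_proj_line v) = F v / G v" "h (abs_proj_line v) = F' v / G' v"
      using 1 2 by auto
    then show "(\<lambda>p\<in>U \<inter> V. b (g p) (h p)) (abs_proj_line v) = H v / (G v * G' v)"
      using v val[of v] by (simp add: mem_cone)
  qed
  \<comment> \<open>The union equals the common class only if the index sets are nonempty.\<close>
  have "form_quotient F G \<noteq> {}" "form_quotient F' G' \<noteq> {}"
    using equiv_class_self[OF equiv_rational_rel] valid_fraction_pair[OF assms(1)] valid_fraction_pair[OF assms(2)]
    unfolding form_quotient_def by blast+
  then obtain U g V h where "(U, g) \<in> form_quotient F G" "(V, h) \<in> form_quotient F' G'"
    by fastforce
  with * show ?thesis by fast
qed

lemma mult_form_quotient:
  fixes F :: "'k::alg_closed_field \<times> 'k \<Rightarrow> 'k"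
  assumes "valid_fraction F G" "valid_fraction F' G'"
  shows "form_quotient F G \<otimes>\<^bsub>function_field\<^esub> form_quotient F' G' = form_quotient (\<lambda>v. F v * F' v) (\<lambda>v. G v * G' v)"
proof -
  have "form_quotient F G \<otimes>\<^bsub>function_field\<^esub> form_quotient F' G' = (\<Union>(U, g)\<in>form_quotient F G.
      \<Union>(V, h)\<in>form_quotient F' G'. rational_rel `` {(U \<inter> V, \<lambda>p\<in>U \<inter> V. g p * h p)})"
    by (simp add: function_field_def)
  also have "\<dots> = form_quotient (\<lambda>v. F v * F' v) (\<lambda>v. G v * G' v)"
    by (rule lift_operation_form_quotient[OF assms valid_fraction_mult_denominator(1)[OF assms] regular_function_mult])
      simp_all
  finally show ?thesis .
qed

lemma add_form_quotient:
  fixes F :: "'k::alg_closed_field \<times> 'k \<Rightarrow> 'k"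
  assumes "valid_fraction F G" "valid_fraction F' G'"
  shows "form_quotient F G \<oplus>\<^bsub>function_field\<^esub> form_quotient F' G' = form_quotient (\<lambda>v. F v * G' v + F' v * G v) (\<lambda>v. G v * G' v)"
proof -
  have "form_quotient F G \<oplus>\<^bsub>function_field\<^esub> form_quotient F' G' = (\<Union>(U, g)\<in>form_quotient F G.
      \<Union>(V, h)\<in>form_quotient F' G'. rational_rel `` {(U \<inter> V, \<lambda>p\<in>U \<inter> V. g p + h p)})"
    by (simp add: function_field_def)
  also have "\<dots> = form_quotient (\<lambda>v. F v * G' v + F' v * G v) (\<lambda>v. G v * G' v)"
    by (rule lift_operation_form_quotient[OF assms valid_fraction_mult_denominator(2)[OF assms] regular_function_add])
      (simp_all add: add_frac_eq)
  finally show ?thesis .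
qed

lemma valid_fraction_uminus: "valid_fraction F G \<Longrightarrow> valid_fraction (\<lambda>v. - F v) G"
  using minus_in_forms unfolding valid_fraction_def by blast

lemmas form_quotient_simps = mult_form_quotient add_form_quotient zero_function_field one_function_field form_quotient_eq_iff
  valid_fraction_const valid_fraction_mult_denominator valid_fraction_uminus form_quotient_in_carrier

text \<open>With fractions as representatives, the axioms reduce to identities of forms; the inverse
  swaps numerator and denominator.\<close>

lemma field_function_field:
  "field (function_field :: ('k::alg_closed_field proj_line set \<times> ('k proj_line \<Rightarrow> 'k)) set ring)"
proof -
  let ?K = "function_field :: ('k proj_line set \<times> ('k proj_line \<Rightarrow> 'k)) set ring"
  have "abelian_group ?K"
  proof (rule abelian_groupI)
    fix x y assume "x \<in> carrier ?K" "y \<in> carrier ?K"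
    then obtain F G F' G' where "valid_fraction F G" "x = form_quotient F G"
      "valid_fraction F' G'" "y = form_quotient F' G'"
      by (elim function_field_cases)
    then show "x \<oplus>\<^bsub>?K\<^esub> y \<in> carrier ?K" "x \<oplus>\<^bsub>?K\<^esub> y = y \<oplus>\<^bsub>?K\<^esub> x"
      by (simp_all add: form_quotient_simps)
  next
    fix x y z assume "x \<in> carrier ?K" "y \<in> carrier ?K" "z \<in> carrier ?K"
    then obtain F1 G1 F2 G2 F3 G3 where xyz: "valid_fraction F1 G1" "x = form_quotient F1 G1"
      "valid_fraction F2 G2" "y = form_quotient F2 G2" "valid_fraction F3 G3" "z = form_quotient F3 G3"
      by (elim function_field_cases)
    from xyz(1,3,5) show "x \<oplus>\<^bsub>?K\<^esub> y \<oplus>\<^bsub>?K\<^esub> z = x \<oplus>\<^bsub>?K\<^esub> (y \<oplus>\<^bsub>?K\<^esub> z)"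
      unfolding xyz(2,4,6) by (simp add: form_quotient_simps) (simp add: algebra_simps)
  next
    show "\<zero>\<^bsub>?K\<^esub> \<in> carrier ?K"
      by (simp add: form_quotient_simps)
  next
    fix x assume "x \<in> carrier ?K"
    then obtain F G where "valid_fraction F G" "x = form_quotient F G"
      by (rule function_field_cases)
    then show "\<zero>\<^bsub>?K\<^esub> \<oplus>\<^bsub>?K\<^esub> x = x"
      by (simp add: form_quotient_simps)
  next
    fix x assume "x \<in> carrier ?K"
    then obtain F G where FG: "valid_fraction F G" "x = form_quotient F G"
      by (rule function_field_cases)
    have "form_quotient (\<lambda>v. - F v) G \<oplus>\<^bsub>?K\<^esub> x = \<zero>\<^bsub>?K\<^esub>"
      unfolding FG(2) using FG(1) by (simp only: form_quotient_simps) simp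
    then show "\<exists>y\<in>carrier ?K. y \<oplus>\<^bsub>?K\<^esub> x = \<zero>\<^bsub>?K\<^esub>"
      using FG form_quotient_in_carrier valid_fraction_uminus by blast
  qed
  moreover have "comm_monoid ?K"
  proof (rule comm_monoidI)
    fix x y assume "x \<in> carrier ?K" "y \<in> carrier ?K"
    then obtain F G F' G' where "valid_fraction F G" "x = form_quotient F G"
      "valid_fraction F' G'" "y = form_quotient F' G'"
      by (elim function_field_cases)
    then show "x \<otimes>\<^bsub>?K\<^esub> y \<in> carrier ?K" "x \<otimes>\<^bsub>?K\<^esub> y = y \<otimes>\<^bsub>?K\<^esub> x"
      by (simp_all add: form_quotient_simps)
  next
    fix x y z assume "x \<in> carrier ?K" "y \<in> carrier ?K" "z \<in> carrier ?K"
    then obtain F1 G1 F2 G2 F3 G3 where xyz: "valid_fraction F1 G1" "x = form_quotient F1 G1"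
      "valid_fraction F2 G2" "y = form_quotient F2 G2" "valid_fraction F3 G3" "z = form_quotient F3 G3"
      by (elim function_field_cases)
    from xyz(1,3,5) show "x \<otimes>\<^bsub>?K\<^esub> y \<otimes>\<^bsub>?K\<^esub> z = x \<otimes>\<^bsub>?K\<^esub> (y \<otimes>\<^bsub>?K\<^esub> z)"
      unfolding xyz(2,4,6) by (simp add: form_quotient_simps)
  next
    show "\<one>\<^bsub>?K\<^esub> \<in> carrier ?K"
      by (simp add: form_quotient_simps)
  next
    fix x assume "x \<in> carrier ?K"
    then obtain F G where "valid_fraction F G" "x = form_quotient F G"
      by (rule function_field_cases)
    then show "\<one>\<^bsub>?K\<^esub> \<otimes>\<^bsub>?K\<^esub> x = x"
      by (simp add: form_quotient_simps)
  qed
  ultimately have "cring ?K"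
  proof (rule cringI)
    fix x y z assume "x \<in> carrier ?K" "y \<in> carrier ?K" "z \<in> carrier ?K"
    then obtain F1 G1 F2 G2 F3 G3 where xyz: "valid_fraction F1 G1" "x = form_quotient F1 G1"
      "valid_fraction F2 G2" "y = form_quotient F2 G2" "valid_fraction F3 G3" "z = form_quotient F3 G3"
      by (elim function_field_cases)
    from xyz(1,3,5) show "(x \<oplus>\<^bsub>?K\<^esub> y) \<otimes>\<^bsub>?K\<^esub> z = x \<otimes>\<^bsub>?K\<^esub> z \<oplus>\<^bsub>?K\<^esub> y \<otimes>\<^bsub>?K\<^esub> z"
      unfolding xyz(2,4,6) by (simp add: form_quotient_simps) (simp add: algebra_simps)
  qed
  then show ?thesis
  proof (rule cring.cring_fieldI2)
    show "\<zero>\<^bsub>?K\<^esub> \<noteq> \<one>\<^bsub>?K\<^esub>"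
      by (simp add: form_quotient_simps)
    fix x assume x: "x \<in> carrier ?K" "x \<noteq> \<zero>\<^bsub>?K\<^esub>"
    obtain F G where FG: "valid_fraction F G" "x = form_quotient F G"
      using x(1) by (rule function_field_cases)
    have "F \<noteq> (\<lambda>_. 0)"
      using x(2) FG by (auto simp: form_quotient_simps)
    then have "valid_fraction G F"
      using FG(1) unfolding valid_fraction_def by blast
    moreover from this have "x \<otimes>\<^bsub>?K\<^esub> form_quotient G F = \<one>\<^bsub>?K\<^esub>"
      unfolding FG(2) using FG(1) by (simp only: form_quotient_simps) (simp add: mult.commute)
    ultimately show "\<exists>y\<in>carrier ?K. x \<otimes>\<^bsub>?K\<^esub> y = \<one>\<^bsub>?K\<^esub>"
      using form_quotient_in_carrier by blast
  qed
qed

subsection \<open>The degree\<close>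

text \<open>With one denominator and numerators of one degree, a linear dependence over the image
  field becomes a single relation between forms.\<close>

lemma common_denominator_form_quotient:
  fixes X :: "nat \<Rightarrow> ('k::alg_closed_field proj_line set \<times> _) set"
  assumes "\<forall>l<N. X l \<in> carrier function_field"
  shows "\<exists>e A D. D \<in> forms e \<and> D \<noteq> (\<lambda>_. 0) \<and> (\<forall>l<N. A l \<in> forms e \<and> X l = form_quotient (A l) D)"
  using assms
proof (induction N)
  case 0
  then show ?case
    using const_in_forms[of 1] by (intro exI[of _ 0] exI[of _ "\<lambda>_. 1"]) (auto simp: fun_eq_iff)
next
  case (Suc N)
  then have "\<exists>e A D. D \<in> forms e \<and> D \<noteq> (\<lambda>_. 0) \<and> (\<forall>l<N. A l \<in> forms e \<and> X l = form_quotient (A l) D)"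
    by simp
  then obtain e A D where IH: "D \<in> forms e" "D \<noteq> (\<lambda>_. 0)" "\<forall>l<N. A l \<in> forms e \<and> X l = form_quotient (A l) D"
    by blast
  have "X N \<in> carrier function_field"
    using Suc.prems by simp
  then obtain F G where FG: "valid_fraction F G" "X N = form_quotient F G"
    by (rule function_field_cases)
  then obtain d where d: "F \<in> forms d" "G \<in> forms d" "G \<noteq> (\<lambda>_. 0)"
    unfolding valid_fraction_def by blast
  define A' where "A' l = (if l = N then (\<lambda>v. D v * F v) else (\<lambda>v. A l v * G v))" for l
  have DG: "(\<lambda>v. D v * G v) \<in> forms (e + d)" "(\<lambda>v. D v * G v) \<noteq> (\<lambda>_. 0)"
    using mult_in_forms[OF IH(1) d(2)] forms_no_zero_divisors[OF IH(1) d(2)] IH(2) d(3)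
    by (auto simp: fun_eq_iff)
  have "A' l \<in> forms (e + d) \<and> X l = form_quotient (A' l) (\<lambda>v. D v * G v)" if "l < Suc N" for l
  proof -
    have form: "A' l \<in> forms (e + d)"
      using that IH(3) mult_in_forms[OF IH(1) d(1)] mult_in_forms[OF _ d(2), of "A l" e]
      by (auto simp: A'_def)
    then have valid: "valid_fraction (A' l) (\<lambda>v. D v * G v)"
      using DG unfolding valid_fraction_def by blast
    show ?thesis
    proof (cases "l = N")
      case True
      then show ?thesis
        using form form_quotient_eq_iff[OF FG(1) valid] FG(2) by (simp add: A'_def mult_ac)
    next
      case False
      then have l: "A l \<in> forms e" "X l = form_quotient (A l) D"
        using that IH(3) by auto
      then have "valid_fraction (A l) D"
        using IH(1,2) unfolding valid_fraction_def by blast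
      then show ?thesis
        using form form_quotient_eq_iff[OF _ valid] l(2) False by (simp add: A'_def mult_ac)
    qed
  qed
  then show ?case
    using DG by - (rule exI[of _ "e + d"], rule exI[of _ A'], rule exI[of _ "\<lambda>v. D v * G v"], blast)
qed

text \<open>Scalars over \<open>D\<close> and vectors over \<open>R\<close> combine over
  \<open>D R\<close> without further denominators. That the numerator is a form of the right degree
  belongs to the induction, because equality of quotients is decided only for valid
  fractions.\<close>

lemma combine_form_quotient:
  fixes D :: "'k::alg_closed_field \<times> 'k \<Rightarrow> 'k"
  assumes "D \<in> forms e" "D \<noteq> (\<lambda>_. 0)" "R \<in> forms d" "R \<noteq> (\<lambda>_. 0)"
    and "\<And>l. l \<in> set ls \<Longrightarrow> A l \<in> forms e" "\<And>l. l \<in> set ls \<Longrightarrow> E l \<in> forms d"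
  shows "ring.combine function_field (map (\<lambda>l. form_quotient (A l) D) ls) (map (\<lambda>l. form_quotient (E l) R) ls) =
      form_quotient (\<lambda>v. \<Sum>l\<leftarrow>ls. A l v * E l v) (\<lambda>v. D v * R v) \<and>
    (\<lambda>v. \<Sum>l\<leftarrow>ls. A l v * E l v) \<in> forms (e + d)"
  using assms(5,6)
proof (induction ls)
  have ring: "ring (function_field :: ('k proj_line set \<times> _) set ring)"
    using field_function_field by (rule field.is_ring)
  note combine = ring.combine.simps[OF ring]
  have DR: "(\<lambda>v. D v * R v) \<in> forms (e + d)" "(\<lambda>v. D v * R v) \<noteq> (\<lambda>_. 0)"
    using mult_in_forms[OF assms(1,3)] forms_no_zero_divisors[OF assms(1,3)] assms(2,4)
    by (auto simp: fun_eq_iff)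
  then have valid: "valid_fraction F (\<lambda>v. D v * R v)" if "F \<in> forms (e + d)" for F
    using that unfolding valid_fraction_def by blast
  {
    case Nil
    have "form_quotient (\<lambda>_. 0) (\<lambda>_. 1) = form_quotient (\<lambda>_. 0) (\<lambda>v. D v * R v)"
      by (simp add: form_quotient_eq_iff[OF valid_fraction_const valid[OF zero_in_forms]])
    then show ?case
      using zero_in_forms by (simp add: combine zero_function_field)
  next
    case (Cons l ls)
    let ?S = "\<lambda>v. \<Sum>l\<leftarrow>ls. A l v * E l v"
    have IH: "ring.combine function_field (map (\<lambda>l. form_quotient (A l) D) ls) (map (\<lambda>l. form_quotient (E l) R) ls) =
        form_quotient ?S (\<lambda>v. D v * R v)" "?S \<in> forms (e + d)"
      using Cons by simp_all
    have AE: "A l \<in> forms e" "E l \<in> forms d"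
      using Cons.prems by simp_all
    then have v1: "valid_fraction (A l) D" "valid_fraction (E l) R"
      using assms(1-4) unfolding valid_fraction_def by blast+
    note v2 = valid_fraction_mult_denominator(1)[OF v1]
    note v3 = valid[OF IH(2)]
    have form: "(\<lambda>v. A l v * E l v + ?S v) \<in> forms (e + d)"
      by (rule add_in_forms[OF mult_in_forms[OF AE] IH(2)])
    have "form_quotient (A l) D \<otimes>\<^bsub>function_field\<^esub> form_quotient (E l) R \<oplus>\<^bsub>function_field\<^esub> form_quotient ?S (\<lambda>v. D v * R v)
        = form_quotient (\<lambda>v. A l v * E l v + ?S v) (\<lambda>v. D v * R v)"
      unfolding mult_form_quotient[OF v1] add_form_quotient[OF v2 v3]
        form_quotient_eq_iff[OF valid_fraction_mult_denominator(2)[OF v2 v3] valid[OF form]]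
      by (simp add: algebra_simps)
    then show ?case
      using form by (simp add: combine IH(1))
  }
qed

context projective_map
begin

text \<open>\<open>P\<close> and \<open>Q\<close> satisfy no homogeneous relation: a point where
  \<open>G\<close> does not vanish has a preimage under \<open>f\<close>.\<close>

lemma comp_nonzero:
  assumes "G \<in> forms d" "G \<noteq> (\<lambda>_. 0)"
  shows "(\<lambda>v. G (P v, Q v)) \<noteq> (\<lambda>_. 0)"
proof -
  obtain p where "p \<in> nonvanishing G"
    using nonvanishing_nonempty[OF assms] by blast
  moreover obtain p' where "p = f p'"
    using surjective by (rule surjE)
  moreover obtain v where "v \<noteq> (0, 0)" "p' = abs_proj_line v"
    by (rule abs_proj_line_cases)
  ultimately have "G (P v, Q v) \<noteq> 0"
    using f_abs[of v] mem_nonvanishing[OF assms(1) PQ_nonzero[of v]] by simp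
  then show ?thesis
    using fun_cong[of "\<lambda>v. G (P v, Q v)" "\<lambda>_. 0" v] by auto
qed

lemma valid_fraction_comp:
  assumes "valid_fraction F G"
  shows "valid_fraction (\<lambda>v. F (P v, Q v)) (\<lambda>v. G (P v, Q v))"
proof -
  obtain d where "F \<in> forms d" "G \<in> forms d" "G \<noteq> (\<lambda>_. 0)"
    using assms unfolding valid_fraction_def by blast
  then show ?thesis
    using comp_in_forms[OF _ P_form Q_form] comp_nonzero unfolding valid_fraction_def by blast
qed

lemma function_field_pullback_form_quotient:
  assumes "valid_fraction F G"
  shows "function_field_pullback f (form_quotient F G) = form_quotient (\<lambda>v. F (P v, Q v)) (\<lambda>v. G (P v, Q v))"
proof -
  have *: "rational_rel `` {(f -` V, pullback f V h)} = form_quotient (\<lambda>v. F (P v, Q v)) (\<lambda>v. G (P v, Q v))"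
    if Vh: "(V, h) \<in> form_quotient F G" for V h
  proof (rule class_eq_form_quotient[OF valid_fraction_comp[OF assms]])
    note 1 = Vh[unfolded mem_form_quotient_iff[OF assms]]
    then have V: "open V" "V \<noteq> {}" "h \<in> regular_functions V"
      by (auto simp: rational_pairs_def)
    have "f -` V \<noteq> {}"
      using V(2) surjective by (metis ex_in_conv surjD vimageI2)
    then show "(f -` V, pullback f V h) \<in> rational_pairs"
      using V open_vimage_f[OF V(1)] morphism unfolding rational_pairs_def variety_morphism_def by blast
    fix v assume v: "v \<in> cone (f -` V)" "G (P v, Q v) \<noteq> 0"
    have "abs_proj_line v \<in> f -` V" "v \<noteq> (0, 0)"
      using v(1) by (simp_all add: mem_cone)
    moreover have "(P v, Q v) \<in> cone V"
      using v(1) by (simp add: cone_vimage)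
    ultimately show "pullback f V h (abs_proj_line v) = F (P v, Q v) / G (P v, Q v)"
      using 1 v(2) f_abs[of v] by (simp add: pullback_def)
  qed
  have "(nonvanishing G, restrict (ratio F G) (nonvanishing G)) \<in> form_quotient F G"
    using equiv_class_self[OF equiv_rational_rel valid_fraction_pair[OF assms]] by (simp add: form_quotient_def)
  with * show ?thesis
    unfolding function_field_pullback_def by fast
qed

lemma pullback_hom:
  "ring_hom_ring function_field function_field (function_field_pullback f)"
proof (rule ring_hom_ringI[OF field.is_ring[OF field_function_field] field.is_ring[OF field_function_field]])
  fix x :: "('a proj_line set \<times> ('a proj_line \<Rightarrow> 'a)) set"
  assume "x \<in> carrier function_field"
  then obtain F G where "valid_fraction F G" "x = form_quotient F G"
    by (rule function_field_cases)
  then show "function_field_pullback f x \<in> carrier function_field"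
    by (simp add: function_field_pullback_form_quotient valid_fraction_comp form_quotient_in_carrier)
next
  fix x y :: "('a proj_line set \<times> ('a proj_line \<Rightarrow> 'a)) set"
  assume "x \<in> carrier function_field" "y \<in> carrier function_field"
  then obtain F G F' G' where xy: "valid_fraction F G" "x = form_quotient F G"
      "valid_fraction F' G'" "y = form_quotient F' G'"
    by (elim function_field_cases)
  note v = valid_fraction_mult_denominator[OF xy(1,3)]
  show "function_field_pullback f (x \<otimes>\<^bsub>function_field\<^esub> y) =
      function_field_pullback f x \<otimes>\<^bsub>function_field\<^esub> function_field_pullback f y"
    unfolding xy(2,4) mult_form_quotient[OF xy(1,3)] function_field_pullback_form_quotient[OF xy(1)]
      function_field_pullback_form_quotient[OF xy(3)] function_field_pullback_form_quotient[OF v(1)]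
      mult_form_quotient[OF valid_fraction_comp[OF xy(1)] valid_fraction_comp[OF xy(3)]] ..
  show "function_field_pullback f (x \<oplus>\<^bsub>function_field\<^esub> y) =
      function_field_pullback f x \<oplus>\<^bsub>function_field\<^esub> function_field_pullback f y"
    unfolding xy(2,4) add_form_quotient[OF xy(1,3)] function_field_pullback_form_quotient[OF xy(1)]
      function_field_pullback_form_quotient[OF xy(3)] function_field_pullback_form_quotient[OF v(2)]
      add_form_quotient[OF valid_fraction_comp[OF xy(1)] valid_fraction_comp[OF xy(3)]] ..
next
  show "function_field_pullback f \<one>\<^bsub>function_field\<^esub> = \<one>\<^bsub>function_field\<^esub>"
    by (simp add: one_function_field function_field_pullback_form_quotient[OF valid_fraction_const])
qed

lemma subfield_pullback:
  "subfield (function_field_pullback f ` carrier function_field) function_field"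
proof -
  interpret K: field "function_field :: ('a proj_line set \<times> ('a proj_line \<Rightarrow> 'a)) set ring"
    by (rule field_function_field)
  show ?thesis
    using ring_hom_ring.img_is_subfield(2)[OF pullback_hom K.carrier_is_subfield] K.one_not_zero by simp
qed

text \<open>For \<open>i = 0\<close> the free basis consists of 1 in degree 0 and
  \<open>m - 1\<close> forms \<open>B l\<close> in degree \<open>m\<close>. As elements of the
  function field these become 1 and \<open>B l / P\<close>, and they form a basis over the field of
  fractions in \<open>P\<close> and \<open>Q\<close>.\<close>

lemma has_degree_m: "has_degree f m"
proof -
  let ?K = "function_field :: ('a proj_line set \<times> ('a proj_line \<Rightarrow> 'a)) set ring"
  let ?L = "function_field_pullback f ` carrier ?K"
  interpret K: field ?K
    by (rule field_function_field)
  note L = subfield_pullback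
  obtain B where B: "complement_basis 0 B"
    using complement_basis_exists[OF m_pos] .
  have B_form: "B l \<in> forms m" if "l < m - 1" for l
    using complement_basis_form[OF B, of l] that by simp
  \<comment> \<open>The basis element 1 is written as \<open>P / P\<close>, so that all basis
    elements have numerators of degree \<open>m\<close> over the same denominator.\<close>
  define E where "E l = (if l = 0 then P else B (l - 1))" for l
  have E_form: "E l \<in> forms m" if "l < m" for l
    using that P_form B_form[of "l - 1"] by (simp add: E_def)
  have sum_E: "(\<Sum>l\<leftarrow>[0..<m]. c l * E l v) = c 0 * P v + (\<Sum>l<m - 1. c (Suc l) * B l v)" for c v
  proof -
    have "(\<Sum>l\<leftarrow>[0..<m]. c l * E l v) = (\<Sum>l<Suc (m - 1). c l * E l v)"
      using m_pos by (simp add: interv_sum_list_conv_sum_set_nat atLeast0LessThan)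
    then show ?thesis
      unfolding sum.lessThan_Suc_shift by (simp add: E_def)
  qed
  define Us where "Us = map (\<lambda>l. form_quotient (E l) P) [0..<m]"
  have Us: "set Us \<subseteq> carrier ?K"
  proof -
    have "form_quotient (E l) P \<in> carrier ?K" if "l < m" for l
      using E_form[OF that] P_form P_nonzero
      by (intro form_quotient_in_carrier) (auto simp: valid_fraction_def)
    then show ?thesis
      by (auto simp: Us_def)
  qed
  have combine: "K.combine (map (\<lambda>l. form_quotient (A l) D) [0..<m]) Us =
      form_quotient (\<lambda>v. A 0 v * P v + (\<Sum>l<m - 1. A (Suc l) v * B l v)) (\<lambda>v. D v * P v)"
    and combine_form: "(\<lambda>v. A 0 v * P v + (\<Sum>l<m - 1. A (Suc l) v * B l v)) \<in> forms (e + m)"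
    if "D \<in> forms e" "D \<noteq> (\<lambda>_. 0)" "\<And>l. l < m \<Longrightarrow> A l \<in> forms e" for A D e
    using combine_form_quotient[OF that(1,2) P_form P_nonzero, of "[0..<m]" A E] that(3) E_form
    unfolding Us_def sum_E by auto
  have "K.independent ?L Us"
  proof (rule ccontr)
    assume "K.dependent ?L Us"
    then obtain Ks where Ks: "length Ks = length Us" "K.combine Ks Us = \<zero>\<^bsub>?K\<^esub>" "set Ks \<subseteq> ?L" "set Ks \<noteq> {\<zero>\<^bsub>?K\<^esub>}"
      by (rule K.dependent_imp_non_trivial_combine[OF L Us])
    have len: "length Ks = m"
      using Ks(1) by (simp add: Us_def)
    have "\<forall>l\<in>{..<m}. \<exists>X. X \<in> carrier ?K \<and> Ks ! l = function_field_pullback f X"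
    proof
      fix l assume "l \<in> {..<m}"
      then have "Ks ! l \<in> ?L"
        using Ks(3) len by (auto simp: subset_iff)
      then show "\<exists>X. X \<in> carrier ?K \<and> Ks ! l = function_field_pullback f X"
        by (elim imageE) (intro exI conjI)
    qed
    from bchoice[OF this] obtain X where
      "\<forall>l\<in>{..<m}. X l \<in> carrier ?K \<and> Ks ! l = function_field_pullback f (X l)"
      by (elim exE)
    then have X: "\<forall>l<m. X l \<in> carrier ?K" "\<And>l. l < m \<Longrightarrow> Ks ! l = function_field_pullback f (X l)"
      by simp_all
    obtain e A D where AD: "D \<in> forms e" "D \<noteq> (\<lambda>_. 0)" "\<forall>l<m. A l \<in> forms e \<and> X l = form_quotient (A l) D"
      using common_denominator_form_quotient[OF X(1)] by (elim exE conjE) (rule that)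
    let ?A = "\<lambda>l v. A l (P v, Q v)" and ?D = "\<lambda>v. D (P v, Q v)"
    have valid: "valid_fraction (A l) D" if "l < m" for l
      using AD that unfolding valid_fraction_def by blast
    have D': "?D \<in> forms (e * m)" "?D \<noteq> (\<lambda>_. 0)"
      using comp_in_forms[OF AD(1) P_form Q_form] comp_nonzero[OF AD(1,2)] by auto
    have A': "?A l \<in> forms (e * m)" if "l < m" for l
      using comp_in_forms[OF _ P_form Q_form] AD(3) that by auto
    have "Ks ! l = form_quotient (?A l) ?D" if "l < m" for l
      using X(2)[OF that] AD(3) that function_field_pullback_form_quotient[OF valid[OF that]] by auto
    then have Ks_eq: "Ks = map (\<lambda>l. form_quotient (?A l) ?D) [0..<m]"
      using len by (intro nth_equalityI) auto
    let ?S = "\<lambda>v. ?A 0 v * P v + (\<Sum>l<m - 1. ?A (Suc l) v * B l v)"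
    have S_form: "?S \<in> forms (e * m + m)"
      by (rule combine_form[OF D' A'])
    have DP: "(\<lambda>v. ?D v * P v) \<in> forms (e * m + m)" "(\<lambda>v. ?D v * P v) \<noteq> (\<lambda>_. 0)"
      using mult_in_forms[OF D'(1) P_form] forms_no_zero_divisors[OF D'(1) P_form] D'(2) P_nonzero
      by (auto simp: fun_eq_iff)
    have "K.combine (map (\<lambda>l. form_quotient (?A l) ?D) [0..<m]) Us = form_quotient ?S (\<lambda>v. ?D v * P v)"
      by (rule combine[OF D' A'])
    then have S_eq: "form_quotient ?S (\<lambda>v. ?D v * P v) = form_quotient (\<lambda>_. 0) (\<lambda>_. 1)"
      using Ks(2) unfolding Ks_eq zero_function_field by (rule trans[OF sym])
    have "valid_fraction ?S (\<lambda>v. ?D v * P v)"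
      using S_form DP unfolding valid_fraction_def by blast
    note S_zero = iffD1[OF form_quotient_eq_iff[OF this valid_fraction_const] S_eq]
    have S0: "?S v = 0" for v
      using spec[OF S_zero, of v] by simp
    \<comment> \<open>Over the denominator \<open>P\<close> the scalar \<open>A 0\<close> meets the
      numerator \<open>P\<close>, which on the level of coefficients is \<open>x A 0\<close> of
      degree \<open>e + 1\<close>. The scalars of \<open>B\<close> keep degree \<open>e\<close>, as
      \<open>free_independence\<close> with \<open>r = Suc e\<close> requires.\<close>
    have "(\<forall>l\<le>(0::nat). (\<lambda>v. fst v * A 0 v) = (\<lambda>_. 0)) \<and> (\<forall>l<m - 0 - 1. A (Suc l) = (\<lambda>_. 0))"
    proof (rule free_independence[OF B m_pos, where s = "\<lambda>_ v. fst v * A 0 v" and r = "Suc e" and t = "\<lambda>l. A (Suc l)"])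
      show "(\<lambda>v. fst v * A 0 v) \<in> forms (Suc e)"
        using mult_in_forms[OF fst_in_forms, of "A 0" e] AD(3) m_pos by simp
      show "A (Suc l) \<in> forms (Suc e - 1)" if "l < m - 0 - 1" for l
        using AD(3) that by simp
      show "(\<Sum>l\<le>0. fst (P v, Q v) * A 0 (P v, Q v) * hmon 0 l v) +
          (\<Sum>l<m - 0 - 1. A (Suc l) (P v, Q v) * B l v) = 0" for v
        using S0[of v] by (simp add: hmon_def mult.commute)
    qed simp
    then have A0: "(\<lambda>v. fst v * A 0 v) = (\<lambda>_. 0)" "\<forall>l<m - 1. A (Suc l) = (\<lambda>_. 0)"
      by auto
    have "fst \<noteq> (\<lambda>_::'a \<times> 'a. 0 :: 'a)"
      using fun_cong[of fst "\<lambda>_::'a \<times> 'a. 0 :: 'a" "(1, 0)"] by auto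
    then have "A 0 = (\<lambda>_. 0)"
      using forms_no_zero_divisors[OF fst_in_forms, of "A 0" e] AD(3) m_pos fun_cong[OF A0(1)] by auto
    then have A_zero: "A l = (\<lambda>_. 0)" if "l < m" for l
      using A0(2) that by (cases l) auto
    have "form_quotient (\<lambda>_. 0) ?D = \<zero>\<^bsub>?K\<^esub>"
      using D' zero_in_forms[of "e * m"] form_quotient_eq_iff[OF _ valid_fraction_const, of "\<lambda>_. 0" ?D 0]
      unfolding zero_function_field valid_fraction_def by auto
    then have "set Ks = {\<zero>\<^bsub>?K\<^esub>}"
      using A_zero m_pos unfolding Ks_eq by (auto simp: image_def)
    with Ks(4) show False by simp
  qed
  moreover have "K.Span ?L Us = carrier ?K"
  proof
    show "K.Span ?L Us \<subseteq> carrier ?K"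
      using K.Span_in_carrier[OF _ Us] subfieldE(3)[OF L] by blast
    show "carrier ?K \<subseteq> K.Span ?L Us"
    proof
      fix x assume "x \<in> carrier ?K"
      then obtain F G where FG: "valid_fraction F G" "x = form_quotient F G"
        by (rule function_field_cases)
      then obtain e where e: "F \<in> forms e" "G \<in> forms e" "G \<noteq> (\<lambda>_. 0)"
        unfolding valid_fraction_def by blast
      \<comment> \<open>The fraction \<open>F / G\<close> is rewritten as
        \<open>F H / N (P, Q)\<close>, whose denominator is a form in \<open>P\<close> and
        \<open>Q\<close>.\<close>
      obtain H N where HN: "N \<in> forms e" "H \<in> forms (e * m - e)" "N \<noteq> (\<lambda>_. 0)" "\<And>v. N (P v, Q v) = G v * H v"
        using e(2,3) by (rule forms_dvd_comp) blast
      have "e \<le> e * m"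
        using m_pos by simp
      then have "(\<lambda>v. F v * H v) \<in> forms (e * m + 0)"
        using mult_in_forms[OF e(1) HN(2)] by simp
      from free_generation[OF B m_pos this] obtain s t where st: "\<And>l. s l \<in> forms e" "\<And>l. t l \<in> forms (e - 1)"
        "\<And>l. e = 0 \<Longrightarrow> t l = (\<lambda>_. 0)"
        "(\<lambda>v. F v * H v) = (\<lambda>v. (\<Sum>l\<le>0. s l (P v, Q v) * hmon 0 l v) + (\<Sum>l<m - 0 - 1. t l (P v, Q v) * B l v))"
        by blast
      \<comment> \<open>Numerator and denominator are multiplied by \<open>P\<close>. At
        \<open>s 0\<close> this factor is the numerator of \<open>P / P\<close>; at the coefficients
        of \<open>B\<close> it becomes \<open>x\<close>, which lifts their degree from
        \<open>e - 1\<close> to \<open>e\<close>. For \<open>e = 0\<close> those coefficients are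
        zero.\<close>
      define A where "A l = (if l = 0 then s 0 else (\<lambda>v. fst v * t (l - 1) v))" for l
      have A: "A l \<in> forms e" for l
        using st(1) mult_in_forms[OF fst_in_forms st(2), of "l - 1"] st(3)[of "l - 1"] zero_in_forms
        by (cases "e = 0") (auto simp: A_def)
      let ?A = "\<lambda>l v. A l (P v, Q v)" and ?N = "\<lambda>v. N (P v, Q v)"
      have N': "?N \<in> forms (e * m)" "?N \<noteq> (\<lambda>_. 0)"
        using comp_in_forms[OF HN(1) P_form Q_form] comp_nonzero[OF HN(1,3)] by auto
      have A': "?A l \<in> forms (e * m)" for l
        using comp_in_forms[OF A P_form Q_form] .
      let ?S = "\<lambda>v. ?A 0 v * P v + (\<Sum>l<m - 1. ?A (Suc l) v * B l v)"
      have S: "?S v = P v * (F v * H v)" for v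
        using fun_cong[OF st(4), of v] by (simp add: A_def hmon_def algebra_simps sum_distrib_left)
      have S_form: "?S \<in> forms (e * m + m)"
        by (rule combine_form[OF N' A'])
      have NP: "(\<lambda>v. ?N v * P v) \<in> forms (e * m + m)" "(\<lambda>v. ?N v * P v) \<noteq> (\<lambda>_. 0)"
        using mult_in_forms[OF N'(1) P_form] forms_no_zero_divisors[OF N'(1) P_form] N'(2) P_nonzero
        by (auto simp: fun_eq_iff)
      then have "valid_fraction ?S (\<lambda>v. ?N v * P v)"
        using S_form unfolding valid_fraction_def by blast
      then have "x = form_quotient ?S (\<lambda>v. ?N v * P v)"
        unfolding FG(2) form_quotient_eq_iff[OF FG(1) \<open>valid_fraction ?S _\<close>]
        unfolding S HN(4) by (simp add: mult_ac)
      also have "\<dots> = K.combine (map (\<lambda>l. form_quotient (?A l) ?N) [0..<m]) Us"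
        by (rule combine[OF N' A', symmetric])
      finally have x: "x = K.combine (map (\<lambda>l. form_quotient (?A l) ?N) [0..<m]) Us" .
      have "form_quotient (?A l) ?N \<in> ?L" for l
      proof -
        have valid: "valid_fraction (A l) N"
          using A HN(1,3) unfolding valid_fraction_def by blast
        have "function_field_pullback f (form_quotient (A l) N) \<in> ?L"
          by (rule imageI[OF form_quotient_in_carrier[OF valid]])
        then show ?thesis
          by (simp only: function_field_pullback_form_quotient[OF valid])
      qed
      then show "x \<in> K.Span ?L Us"
        unfolding K.Span_eq_combine_set[OF L Us] x
        by (intro CollectI exI[of _ "map (\<lambda>l. form_quotient (?A l) ?N) [0..<m]"] conjI refl) (simp add: image_subset_iff)
    qed
  qed
  ultimately have "K.dimension (length Us) ?L (carrier ?K)"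
    using K.dimensionI[OF L] by blast
  then show ?thesis
    by (simp add: has_degree_def Us_def)
qed

lemma degree_unique: "has_degree f n \<Longrightarrow> n = m"
  using ring.dimension_is_inj[OF field.is_ring[OF field_function_field] subfield_pullback] has_degree_m
  unfolding has_degree_def by blast

end

theorem mainTheorem2:
  fixes f :: "'k::alg_closed_field proj_line \<Rightarrow> 'k proj_line"
    and n i :: nat and q :: int
  assumes "variety_morphism f" and "surj f" and "has_degree f n"
    and "i < n"
  shows "direct_image f \<O>(q * int n + int i) \<cong>\<^sub>\<O>
    \<O>(q)\<^bsup>\<oplus>(i + 1)\<^esup> \<oplus>\<^sub>\<O> \<O>(q - 1)\<^bsup>\<oplus>(n - i - 1)\<^esup>"
proof -
  obtain P Q m where "projective_map P Q m f"
    using assms(1,2) by (rule morphism_eq_projective_map)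
  then interpret projective_map P Q m f .
  have "n = m"
    using assms(3) by (rule degree_unique)
  then show ?thesis
    using direct_image_iso assms(4) by simp
qed

end
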